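(* Let $n$ be an odd natural number and $h_n:=\frac{n-1}{2}$, and let $\beta,m\in\mathbb{N}_0$ with $\beta+m\le h_n$. Let $T\in\mathcal{BC}^{0,1}(V_n)$ be such that its components $T_i$, $i=0,\dots,n-1$, have real spectra. Let $f$ be a left slice hyperholomorphic function with domain $\mathcal{D}(f)$. Then the Dirac functional calculi based on the $S$-spectrum are well defined, i.e. the integrals $$f_{\beta,m}(T)=\frac1{2\pi}\int_{\partial(U\cap\mathbb{C}_I)}S^{-1}_{L,D^\beta\Delta^m}(s,T)\,ds_I\,f(s),\qquad f_{\overline\beta,m}(T)=\frac1{2\pi}\int_{\partial(U\cap\mathbb{C}_I)}S^{-1}_{L,\overline D^\beta\Delta^m}(s,T)\,ds_I\,f(s),$$ where $ds_I=ds(-I)$, depend neither on the imaginary unit $I\in\mathbb{S}$ nor on the bounded slice Cauchy domain $U$ with $\sigma_S(T)\subset U\subset\mathcal{D}(f)$ ($f$ being defined also on the boundary of $U$, as the integrals require).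
   Context: $\mathbb{R}_n$ is the real Clifford algebra generated by $e_1,\dots,e_n$, $e_ie_j+e_je_i=-2\delta_{ij}$, with basis $e_A$; $\mathbb{R}^{n+1}$ is identified with paravectors $x=x_0+\underline x$, $\underline x=\sum_{j\ge1}x_je_j$. $\mathbb{S}=\{\underline x:|\underline x|=1\}$, $\mathbb{C}_I=\mathbb{R}+I\mathbb{R}$, $[x]=\{x_0+I|\underline x|:I\in\mathbb{S}\}$; $U\subseteq\mathbb{R}^{n+1}$ is axially symmetric if $[x]\subset U$ for $x\in U$. A slice Cauchy domain is an axially symmetric open set $U$ such that for all $I\in\mathbb{S}$ the boundary of $U\cap\mathbb{C}_I$ in $\mathbb{C}_I$ is a finite union of non-intersecting piecewise continuously differentiable Jordan curves. A function $f$ on an axially symmetric open set $W$ with values in $\mathbb{R}_n$ is left slice hyperholomorphic if $f(u+Iv)=A(u,v)+IB(u,v)$ for all $I\in\mathbb{S}$, with $C^1$ functions $A,B$ on $\{(u,v)\in\mathbb{R}^2:u+Iv\in W\ \forall I\in\mathbb{S}\}$ valued in $\mathbb{R}_n$, $A$ even and $B$ odd in $v$, $\partial_uA=\partial_vB$, $\partial_vA=-\partial_uB$. $V$ is a real Banach space, $V_n=V\otimes\mathbb{R}_n$. For $T_A\in\mathcal{B}(V)$, $T=\sum_AT_Ae_A$ acts by $T(\sum_Bv_Be_B)=\sum_{A,B}T_A(v_B)e_Ae_B$; these operators form $\mathcal{B}(V_n)$, with norm $\|T\|=\sum_A\|T_A\|$; Clifford numbers act by left multiplication. $\mathcal{BC}^{0,1}(V_n)$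 is the set of operators $T=T_0+\sum_{\mu=1}^ne_\mu T_\mu$ with pairwise commuting $T_\mu\in\mathcal{B}(V)$; $\overline T=T_0-\sum_{\mu\ge1}e_\mu T_\mu$. $\mathcal{Q}_{c,s}(T)=s^2\mathcal{I}-2sT_0+T\overline T$, $\rho_S(T)=\{s\in\mathbb{R}^{n+1}:\mathcal{Q}_{c,s}(T)\text{ is invertible in }\mathcal{B}(V_n)\}$, $\sigma_S(T)=\mathbb{R}^{n+1}\setminus\rho_S(T)$. For $s\in\rho_S(T)$ and integers $\nu\ge0$, $\ell\ge1$: $K^{1,L}_{\nu,\ell}=(s\mathcal{I}-\overline T)(s\mathcal{I}-T_0)^\nu\mathcal{Q}_{c,s}^{-\ell}(T)$, $K^2_{\nu,\ell}=(s\mathcal{I}-T_0)^\nu\mathcal{Q}_{c,s}^{-\ell}(T)$. Let $(-h_n)_m=(-1)^m\frac{h_n!}{(h_n-m)!}$. $D$-resolvents, with $c=2^\beta(h_n-m)4^m(-h_n)_m$ (no $D$-resolvent is defined for $\beta=0$). If $\beta=2k+1$, $k\in\mathbb{N}_0$: $S^{-1}_{L,D^\beta\Delta^m}(s,T)=c\big(\sum_{j=0}^{k-1}a^1_jK^{1,L}_{2j+1,m+j+2+k}-\sum_{j=0}^{k}b^1_jK^2_{2j,m+1+k+j}\big)$ with $b^1_j=2^{2j}(m+k+j)!\binom{h_n-m-k-j-1}{h_n-m-2k-1}\frac{(k+j)!}{(2j)!}$, $a^1_j=\frac{j+1}{k+j+1}b^1_{j+1}$. If $\beta=2k$, $k\in\mathbb{N}$: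 $S^{-1}_{L,D^\beta\Delta^m}(s,T)=c\big(\sum_{j=0}^{k-1}a^2_jK^{1,L}_{2j,m+j+1+k}-\sum_{j=0}^{k-1}b^2_jK^2_{2j+1,m+1+j+k}\big)$ with $a^2_j=2^{2j}(m+k+j)!\frac{(k+j-1)!}{(2j)!}\binom{h_n-m-k-1-j}{h_n-m-2k}$, $b^2_j=\frac{2(k+j)}{2j+1}a^2_j$. $\overline D$-resolvents, with $\mathbf{c}=2^\beta4^m(-h_n)_m$; a binomial coefficient with lower entry $-1$ (occurring only if $\beta+m=h_n$) is $1$ if its upper entry is $-1$ and $0$ otherwise. If $\beta=2k+1$, $k\in\mathbb{N}_0$: $S^{-1}_{L,\overline D^\beta\Delta^m}(s,T)=\mathbf{c}\big(\sum_{j=0}^{k}\mathbf{a}^1_jK^{1,L}_{2j+1,m+j+2+k}+\sum_{j=0}^{k}\mathbf{b}^1_jK^2_{2j,m+j+1+k}\big)$ with $\mathbf{a}^1_j=2^{2j+1}\frac{(m+k+1+j)!(k+j+1)!}{(2j+1)!}\binom{h_n-m-k-j-2}{h_n-m-2k-2}$, $\mathbf{b}^1_{j+1}=\frac{\mathbf{a}^1_j}{(j+1)(k-j)}$ for $0\le j\le k-1$, and $\mathbf{b}^1_0$ a real constant depending only on $k,m,n$. If $\beta=2k$, $k\in\mathbb{N}_0$: $S^{-1}_{L,\overline D^\beta\Delta^m}(s,T)=\mathbf{c}\big(\sum_{j=0}^{k}\mathbf{a}^2_jK^{1,L}_{2j,m+j+1+k}+\sum_{j=0}^{k-1}\mathbf{b}^2_jK^2_{2j+1,m+1+k+j}\big)$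 with $\mathbf{a}^2_j=2^{2j}(m+k+j)!(k-j)!\binom{k+j}{2j}\binom{h_n-m-k-1-j}{h_n-m-2k-1}$, $\mathbf{b}^2_j=\frac{2(k-j)}{2j+1}\mathbf{a}^2_j$. *)

theory Defs
  imports "HOL-Complex_Analysis.Complex_Analysis"
begin

unbundle no fps_syntax

section \<open>The Clifford algebra and the module \<open>V\<^sub>n\<close>\<close>

text \<open>
  The generators \<open>e\<^sub>1, \<dots>, e\<^sub>n\<close> are indexed by a finite linearly ordered type \<open>'n\<close>, so that
  \<open>n = CARD('n)\<close>. An element of \<open>\<real>\<^sub>n\<close> is the family of its coefficients with respect to the basis
  \<open>e\<^sub>A\<close> (\<open>A \<subseteq> {1..n}\<close>, factors in increasing order), an element of \<open>V\<^sub>n = V \<otimes> \<real>\<^sub>n\<close> likewise. The norm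
  of the type \<open>_ ^ 'n set\<close> is equivalent to the sum of the norms of the coefficients. Beware that
  \<open>*\<close> on this type is the componentwise product, which is never used here.
\<close>

type_synonym 'n clifford = "real ^ ('n set)"
type_synonym ('v, 'n) cmodule = "'v ^ ('n set)"
type_synonym 'n paravector = "real \<times> (real ^ 'n)"

text \<open>
  \<open>e\<^sub>A e\<^sub>B = cl_sign A B e\<^sub>C\<close> with \<open>C\<close> the symmetric difference of \<open>A\<close> and \<open>B\<close>: sorting costs one
  sign for each pair \<open>a > b\<close> (anticommutation) and one for each \<open>a = b\<close> (\<open>e\<^sub>a\<^sup>2 = -1\<close>).
\<close>

definition cl_sign :: "'n::{finite,linorder} set \<Rightarrow> 'n set \<Rightarrow> real" where
  "cl_sign A B = (- 1) ^ card {(a, b). a \<in> A \<and> b \<in> B \<and> b \<le> a}"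

definition cl_mult :: "'n::{finite,linorder} clifford \<Rightarrow> 'n clifford \<Rightarrow> 'n clifford" where
  "cl_mult a b = (\<Sum>A\<in>UNIV. \<Sum>B\<in>UNIV. axis ((A - B) \<union> (B - A)) (cl_sign A B * (a $ A * b $ B)))"

lemma cl_mult_axis:
  "cl_mult (axis A x) (axis B y) = axis ((A - B) \<union> (B - A)) (cl_sign A B * (x * y))"
proof -
  let ?X = "axis ((A - B) \<union> (B - A)) (cl_sign A B * (x * y))"
  have "(\<Sum>B'\<in>UNIV. axis ((A' - B') \<union> (B' - A')) (cl_sign A' B' * (axis A x $ A' * axis B y $ B')))
      = (if A' = A then ?X else 0)" for A'
  proof (cases "A' = A")
    case True
    then have "(\<Sum>B'\<in>UNIV. axis ((A' - B') \<union> (B' - A'))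
          (cl_sign A' B' * (axis A x $ A' * axis B y $ B'))) = (\<Sum>B'\<in>UNIV. if B' = B then ?X else 0)"
      by (intro sum.cong) (simp_all add: axis_def vec_eq_iff)
    then show ?thesis using True by simp
  qed (simp add: axis_def vec_eq_iff)
  then show ?thesis
    by (simp add: cl_mult_def)
qed

lemma cl_generators:
  fixes i j :: "'n::{finite,linorder}"
  shows "cl_mult (axis {i} 1) (axis {j} 1) + cl_mult (axis {j} 1) (axis {i} 1)
     = axis {} (if i = j then - 2 else 0)"
proof -
  have card: "card {(a, b). a = i \<and> b = j \<and> b \<le> a} = (if j \<le> i then 1 else 0)" for i j :: 'n
  proof -
    have "{(a, b). a = i \<and> b = j \<and> b \<le> a} = (if j \<le> i then {(i, j)} else {})"
      by auto
    then show ?thesis by simp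
  qed
  have comm: "{i} - {j} \<union> ({j} - {i}) = {j} - {i} \<union> ({i} - {j})"
    by auto
  consider "i = j" | "i < j" | "j < i" by (rule linorder_cases)
  then show ?thesis
    by cases (simp_all only: cl_mult_axis comm, simp_all add: cl_sign_def card,
        simp_all add: axis_def vec_eq_iff)
qed

text \<open>The action \<open>(\<Sum>\<^sub>A T\<^sub>A e\<^sub>A) (\<Sum>\<^sub>B v\<^sub>B e\<^sub>B) = \<Sum>\<^sub>A\<^sub>,\<^sub>B T\<^sub>A(v\<^sub>B) e\<^sub>A e\<^sub>B\<close>.\<close>

definition cl_apply ::
    "('v::banach \<Rightarrow>\<^sub>L 'v) ^ ('n::{finite,linorder} set) \<Rightarrow> ('v, 'n) cmodule \<Rightarrow> ('v, 'n) cmodule" where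
  "cl_apply T v = (\<Sum>A\<in>UNIV. \<Sum>B\<in>UNIV.
     axis ((A - B) \<union> (B - A)) (cl_sign A B *\<^sub>R blinfun_apply (T $ A) (v $ B)))"

lemma bounded_linear_axis: "bounded_linear (\<lambda>x::'v::real_normed_vector. axis (i::'k::finite) x)"
proof (rule bounded_linear_intro[where K = 1])
  show "norm (axis i x) \<le> norm x * 1" for x :: 'v
  proof -
    have "norm (axis i x) \<le> (\<Sum>j\<in>UNIV. norm (axis i x $ j))"
      unfolding norm_vec_def by (rule L2_set_le_sum) simp
    also have "\<dots> = (\<Sum>j\<in>UNIV. if j = i then norm x else 0)"
      by (intro sum.cong) (auto simp: axis_def)
    finally show ?thesis by simp
  qed
qed (auto simp: axis_def vec_eq_iff)

lemma bounded_linear_cl_apply: "bounded_linear (cl_apply T)"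
  unfolding cl_apply_def
  by (intro bounded_linear_sum bounded_linear_compose[OF bounded_linear_axis]
      bounded_linear_compose[OF bounded_linear_scaleR_right]
      bounded_linear_compose[OF blinfun.bounded_linear_right] bounded_linear_vec_nth)

definition cl_op ::
    "('v::banach \<Rightarrow>\<^sub>L 'v) ^ ('n::{finite,linorder} set)
      \<Rightarrow> ('v, 'n) cmodule \<Rightarrow>\<^sub>L ('v, 'n) cmodule" where
  "cl_op T = Blinfun (cl_apply T)"

lemma blinfun_apply_cl_op: "blinfun_apply (cl_op T) = cl_apply T"
  unfolding cl_op_def by (rule bounded_linear_Blinfun_apply[OF bounded_linear_cl_apply])

text \<open>
  \<open>\<B>(V\<^sub>n)\<close>, as a set of bounded operators on \<open>V\<^sub>n\<close>. On this set the norm \<open>\<Sum>\<^sub>A \<parallel>T\<^sub>A\<parallel>\<close> is equivalent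
  to the operator norm.
\<close>

definition B_Vn :: "(('v::banach, 'n::{finite,linorder}) cmodule \<Rightarrow>\<^sub>L ('v, 'n) cmodule) set" where
  "B_Vn = range cl_op"

definition cl_left ::
    "'n::{finite,linorder} clifford \<Rightarrow> ('v::banach, 'n) cmodule \<Rightarrow>\<^sub>L ('v, 'n) cmodule" where
  "cl_left a = cl_op (\<chi> A. (a $ A) *\<^sub>R id_blinfun)"

definition para :: "'n::{finite,linorder} paravector \<Rightarrow> 'n clifford" where
  "para x = axis {} (fst x) + (\<Sum>j\<in>UNIV. axis {j} (snd x $ j))"


section \<open>Slices and slice Cauchy domains\<close>

text \<open>The unit sphere \<open>\<S>\<close> is \<open>sphere 0 1 :: (real ^ 'n) set\<close>; \<open>slice_pt I (u + \<i>v) = u + I v\<close>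
  identifies \<open>\<complex>\<close> with \<open>\<complex>\<^sub>I\<close>, and \<open>slice U I\<close> is \<open>U \<inter> \<complex>\<^sub>I\<close> seen in \<open>\<complex>\<close>.\<close>

definition slice_pt :: "real ^ ('n::{finite,linorder}) \<Rightarrow> complex \<Rightarrow> 'n::{finite,linorder} paravector" where
  "slice_pt I z = (Re z, Im z *\<^sub>R I)"

definition slice :: "'n::{finite,linorder} paravector set \<Rightarrow> real ^ ('n::{finite,linorder}) \<Rightarrow> complex set" where
  "slice U I = {z. slice_pt I z \<in> U}"

definition axially_symmetric :: "'n::{finite,linorder} paravector set \<Rightarrow> bool" where
  "axially_symmetric U \<longleftrightarrow> (\<forall>x\<in>U. \<forall>I\<in>sphere 0 1. (fst x, norm (snd x) *\<^sub>R I) \<in> U)"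

definition jordan_family :: "(real \<Rightarrow> complex) set \<Rightarrow> bool" where
  "jordan_family \<Gamma> \<longleftrightarrow> finite \<Gamma> \<and>
     (\<forall>\<gamma>\<in>\<Gamma>. valid_path \<gamma> \<and> simple_path \<gamma> \<and> pathfinish \<gamma> = pathstart \<gamma>) \<and>
     pairwise (\<lambda>\<gamma> \<delta>. disjnt (path_image \<gamma>) (path_image \<delta>)) \<Gamma>"

definition slice_cauchy_domain :: "'n::{finite,linorder} paravector set \<Rightarrow> bool" where
  "slice_cauchy_domain U \<longleftrightarrow> open U \<and> axially_symmetric U \<and>
     (\<forall>I\<in>sphere 0 1. \<exists>\<Gamma>. jordan_family \<Gamma> \<and> frontier (slice U I) = (\<Union>\<gamma>\<in>\<Gamma>. path_image \<gamma>))"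

text \<open>
  The positively oriented boundary \<open>\<partial>\<Omega>\<close>: the boundary curves are traversed so that the cycle they
  form winds once around the points of \<open>\<Omega>\<close> and not around the points outside its closure. Every
  boundary curve with \<open>\<Omega>\<close> on just one side then occurs in \<open>\<Gamma>\<close>. A boundary curve with \<open>\<Omega>\<close> on both
  sides (such as the inner circle for a disc with a concentric circle removed) is left out: it is
  traversed once in each direction and contributes nothing. This is why only an inclusion in the
  frontier is demanded.
\<close>

definition oriented_boundary :: "complex set \<Rightarrow> (real \<Rightarrow> complex) set \<Rightarrow> bool" where
  "oriented_boundary \<Omega> \<Gamma> \<longleftrightarrow> jordan_family \<Gamma> \<and> (\<Union>\<gamma>\<in>\<Gamma>. path_image \<gamma>) \<subseteq> frontier \<Omega> \<and>
     (\<forall>z\<in>\<Omega>. (\<Sum>\<gamma>\<in>\<Gamma>. winding_number \<gamma> z) = 1) \<and>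
     (\<forall>z. z \<notin> closure \<Omega> \<longrightarrow> (\<Sum>\<gamma>\<in>\<Gamma>. winding_number \<gamma> z) = 0)"

definition slice_dom :: "'n::{finite,linorder} paravector set \<Rightarrow> (real \<times> real) set" where
  "slice_dom W = {(u, v). \<forall>I\<in>sphere 0 1. (u, v *\<^sub>R I) \<in> W}"

text \<open>\<open>A'\<close> and \<open>B'\<close> are the total derivatives; \<open>A' p (1, 0)\<close> and \<open>A' p (0, 1)\<close> are the partial
  derivatives of \<open>A\<close> with respect to \<open>u\<close> and \<open>v\<close>.\<close>

definition left_slice_hyperholomorphic ::
    "'n::{finite,linorder} paravector set \<Rightarrow> ('n paravector \<Rightarrow> 'n clifford) \<Rightarrow> bool" where
  "left_slice_hyperholomorphic W f \<longleftrightarrow> open W \<and> axially_symmetric W \<and>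
     (\<exists>(A :: real \<times> real \<Rightarrow> 'n clifford) B
        (A' :: real \<times> real \<Rightarrow> (real \<times> real) \<Rightarrow>\<^sub>L 'n clifford) B'.
        continuous_on (slice_dom W) A' \<and> continuous_on (slice_dom W) B' \<and>
        (\<forall>p\<in>slice_dom W.
           (A has_derivative blinfun_apply (A' p)) (at p) \<and>
           (B has_derivative blinfun_apply (B' p)) (at p) \<and>
           A (fst p, - snd p) = A p \<and>
           B (fst p, - snd p) = - B p \<and>
           blinfun_apply (A' p) (1, 0) = blinfun_apply (B' p) (0, 1) \<and>
           blinfun_apply (A' p) (0, 1) = - blinfun_apply (B' p) (1, 0) \<and>
           (\<forall>I\<in>sphere 0 1. f (fst p, snd p *\<^sub>R I) = A p + cl_mult (para (0, I)) (B p))))"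


section \<open>Paravector operators and the \<open>S\<close>-spectrum\<close>

definition bl_pow :: "('a::real_normed_vector \<Rightarrow>\<^sub>L 'a) \<Rightarrow> nat \<Rightarrow> 'a \<Rightarrow>\<^sub>L 'a" where
  "bl_pow X k = ((o\<^sub>L) X ^^ k) id_blinfun"

definition bl_inverses :: "('a::real_normed_vector \<Rightarrow>\<^sub>L 'a) \<Rightarrow> ('a \<Rightarrow>\<^sub>L 'a) \<Rightarrow> bool" where
  "bl_inverses X Y \<longleftrightarrow> X o\<^sub>L Y = id_blinfun \<and> Y o\<^sub>L X = id_blinfun"

definition bl_inv :: "('a::real_normed_vector \<Rightarrow>\<^sub>L 'a) \<Rightarrow> 'a \<Rightarrow>\<^sub>L 'a" where
  "bl_inv X = (THE Y. bl_inverses X Y)"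

text \<open>
  The spectrum of an operator on a real Banach space is that of its complexification:
  \<open>complexify_shift T z\<close> is \<open>z - T\<close> on \<open>V + \<i>V\<close>, whose elements \<open>x + \<i>y\<close> are written \<open>(x, y)\<close>. An
  inverse of this complex linear operator is automatically complex linear.
\<close>

definition complexify_shift :: "('v::banach \<Rightarrow>\<^sub>L 'v) \<Rightarrow> complex \<Rightarrow> ('v \<times> 'v) \<Rightarrow>\<^sub>L ('v \<times> 'v)" where
  "complexify_shift T z = Blinfun (\<lambda>p.
     (Re z *\<^sub>R fst p - Im z *\<^sub>R snd p - blinfun_apply T (fst p),
      Re z *\<^sub>R snd p + Im z *\<^sub>R fst p - blinfun_apply T (snd p)))"

lemma blinfun_apply_complexify_shift:
  "blinfun_apply (complexify_shift T z) (x, y) =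
     (Re z *\<^sub>R x - Im z *\<^sub>R y - blinfun_apply T x, Re z *\<^sub>R y + Im z *\<^sub>R x - blinfun_apply T y)"
proof -
  have "bounded_linear (\<lambda>p.
     (Re z *\<^sub>R fst p - Im z *\<^sub>R snd p - blinfun_apply T (fst p),
      Re z *\<^sub>R snd p + Im z *\<^sub>R fst p - blinfun_apply T (snd p)))"
    by (intro bounded_linear_Pair bounded_linear_sub bounded_linear_add
        bounded_linear_compose[OF bounded_linear_scaleR_right]
        bounded_linear_compose[OF blinfun.bounded_linear_right]
        bounded_linear_fst bounded_linear_snd)
  then show ?thesis
    by (simp add: complexify_shift_def bounded_linear_Blinfun_apply)
qed

definition op_spectrum :: "('v::banach \<Rightarrow>\<^sub>L 'v) \<Rightarrow> complex set" where
  "op_spectrum T = {z. \<nexists>Y. bl_inverses (complexify_shift T z) Y}"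

definition real_spectrum :: "('v::banach \<Rightarrow>\<^sub>L 'v) \<Rightarrow> bool" where
  "real_spectrum T \<longleftrightarrow> (\<forall>z\<in>op_spectrum T. Im z = 0)"

text \<open>An operator \<open>T = T\<^sub>0 + \<Sum>\<^sub>\<mu> e\<^sub>\<mu> T\<^sub>\<mu>\<close> is given by its components: \<open>T0\<close> is \<open>T\<^sub>0\<close> and \<open>Tv \<mu>\<close> is \<open>T\<^sub>\<mu>\<close>.\<close>

definition commuting_components ::
    "('v::banach \<Rightarrow>\<^sub>L 'v) \<Rightarrow> ('n \<Rightarrow> 'v \<Rightarrow>\<^sub>L 'v) \<Rightarrow> bool" where
  "commuting_components T0 Tv \<longleftrightarrow>
     (\<forall>\<mu>. T0 o\<^sub>L Tv \<mu> = Tv \<mu> o\<^sub>L T0) \<and> (\<forall>\<mu> \<nu>. Tv \<mu> o\<^sub>L Tv \<nu> = Tv \<nu> o\<^sub>L Tv \<mu>)"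

definition real_op ::
    "('v::banach \<Rightarrow>\<^sub>L 'v) \<Rightarrow> ('v, 'n::{finite,linorder}) cmodule \<Rightarrow>\<^sub>L ('v, 'n) cmodule" where
  "real_op T0 = cl_op (axis {} T0)"

definition para_op ::
    "('v::banach \<Rightarrow>\<^sub>L 'v) \<Rightarrow> ('n::{finite,linorder} \<Rightarrow> 'v \<Rightarrow>\<^sub>L 'v)
      \<Rightarrow> ('v, 'n) cmodule \<Rightarrow>\<^sub>L ('v, 'n) cmodule" where
  "para_op T0 Tv = cl_op (axis {} T0 + (\<Sum>\<mu>\<in>UNIV. axis {\<mu>} (Tv \<mu>)))"

abbreviation conj_op ::
    "('v::banach \<Rightarrow>\<^sub>L 'v) \<Rightarrow> ('n::{finite,linorder} \<Rightarrow> 'v \<Rightarrow>\<^sub>L 'v)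
      \<Rightarrow> ('v, 'n) cmodule \<Rightarrow>\<^sub>L ('v, 'n) cmodule" where
  "conj_op T0 Tv \<equiv> para_op T0 (\<lambda>\<mu>. - Tv \<mu>)"

definition Q_op ::
    "('v::banach \<Rightarrow>\<^sub>L 'v) \<Rightarrow> ('n::{finite,linorder} \<Rightarrow> 'v \<Rightarrow>\<^sub>L 'v) \<Rightarrow> 'n paravector
      \<Rightarrow> ('v, 'n) cmodule \<Rightarrow>\<^sub>L ('v, 'n) cmodule" where
  "Q_op T0 Tv s = (cl_left (para s) o\<^sub>L cl_left (para s))
     - 2 *\<^sub>R (cl_left (para s) o\<^sub>L real_op T0) + (para_op T0 Tv o\<^sub>L conj_op T0 Tv)"

definition S_resolvent_set ::
    "('v::banach \<Rightarrow>\<^sub>L 'v) \<Rightarrow> ('n::{finite,linorder} \<Rightarrow> 'v \<Rightarrow>\<^sub>L 'v) \<Rightarrow> 'n paravector set" where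
  "S_resolvent_set T0 Tv = {s. \<exists>Y\<in>B_Vn. bl_inverses (Q_op T0 Tv s) Y}"

definition S_spectrum ::
    "('v::banach \<Rightarrow>\<^sub>L 'v) \<Rightarrow> ('n::{finite,linorder} \<Rightarrow> 'v \<Rightarrow>\<^sub>L 'v) \<Rightarrow> 'n paravector set" where
  "S_spectrum T0 Tv = - S_resolvent_set T0 Tv"


section \<open>The resolvent operators\<close>

text \<open>The resolvents are meant for \<open>s \<in> S_resolvent_set T0 Tv\<close>; elsewhere their value is irrelevant.\<close>

definition K2 ::
    "('v::banach \<Rightarrow>\<^sub>L 'v) \<Rightarrow> ('n::{finite,linorder} \<Rightarrow> 'v \<Rightarrow>\<^sub>L 'v) \<Rightarrow> nat \<Rightarrow> nat \<Rightarrow> 'n paravector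
      \<Rightarrow> ('v, 'n) cmodule \<Rightarrow>\<^sub>L ('v, 'n) cmodule" where
  "K2 T0 Tv \<nu> l s =
     bl_pow (cl_left (para s) - real_op T0) \<nu> o\<^sub>L bl_pow (bl_inv (Q_op T0 Tv s)) l"

definition K1L ::
    "('v::banach \<Rightarrow>\<^sub>L 'v) \<Rightarrow> ('n::{finite,linorder} \<Rightarrow> 'v \<Rightarrow>\<^sub>L 'v) \<Rightarrow> nat \<Rightarrow> nat \<Rightarrow> 'n paravector
      \<Rightarrow> ('v, 'n) cmodule \<Rightarrow>\<^sub>L ('v, 'n) cmodule" where
  "K1L T0 Tv \<nu> l s =
     (cl_left (para s) - conj_op T0 Tv)
       o\<^sub>L (bl_pow (cl_left (para s) - real_op T0) \<nu> o\<^sub>L bl_pow (bl_inv (Q_op T0 Tv s)) l)"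

text \<open>\<open>neg_poch h m\<close> is \<open>(-h)\<^sub>m\<close>.\<close>

definition neg_poch :: "nat \<Rightarrow> nat \<Rightarrow> real" where
  "neg_poch h m = (- 1) ^ m * fact h / fact (h - m)"

text \<open>
  Coefficients for \<open>D\<^sup>\<beta> \<Delta>\<^sup>m\<close>; the suffix \<open>1\<close> is for \<open>\<beta> = 2k + 1\<close> and the suffix \<open>2\<close> for \<open>\<beta> = 2k\<close>, \<open>k > 0\<close>.
  All natural subtractions are exact when \<open>\<beta> + m \<le> h\<close> and \<open>j\<close> is in the summation range.
\<close>

definition b1 :: "nat \<Rightarrow> nat \<Rightarrow> nat \<Rightarrow> nat \<Rightarrow> real" where
  "b1 h m k j = 2 ^ (2 * j) * fact (m + k + j)
     * real ((h - m - k - j - 1) choose (h - m - 2 * k - 1)) * (fact (k + j) / fact (2 * j))"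

definition a1 :: "nat \<Rightarrow> nat \<Rightarrow> nat \<Rightarrow> nat \<Rightarrow> real" where
  "a1 h m k j = real (j + 1) / real (k + j + 1) * b1 h m k (j + 1)"

definition a2 :: "nat \<Rightarrow> nat \<Rightarrow> nat \<Rightarrow> nat \<Rightarrow> real" where
  "a2 h m k j = 2 ^ (2 * j) * fact (m + k + j) * (fact (k + j - 1) / fact (2 * j))
     * real ((h - m - k - 1 - j) choose (h - m - 2 * k))"

definition b2 :: "nat \<Rightarrow> nat \<Rightarrow> nat \<Rightarrow> nat \<Rightarrow> real" where
  "b2 h m k j = real (2 * (k + j)) / real (2 * j + 1) * a2 h m k j"

definition D_resolvent ::
    "nat \<Rightarrow> nat \<Rightarrow> ('v::banach \<Rightarrow>\<^sub>L 'v) \<Rightarrow> ('n::{finite,linorder} \<Rightarrow> 'v \<Rightarrow>\<^sub>L 'v) \<Rightarrow> 'n paravector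
      \<Rightarrow> ('v, 'n) cmodule \<Rightarrow>\<^sub>L ('v, 'n) cmodule" where
  "D_resolvent \<beta> m T0 Tv s =
     (let h = (CARD('n) - 1) div 2; k = \<beta> div 2
      in (2 ^ \<beta> * real (h - m) * 4 ^ m * neg_poch h m) *\<^sub>R
        (if odd \<beta>
         then (\<Sum>j<k. a1 h m k j *\<^sub>R K1L T0 Tv (2 * j + 1) (m + j + 2 + k) s)
              - (\<Sum>j\<le>k. b1 h m k j *\<^sub>R K2 T0 Tv (2 * j) (m + 1 + k + j) s)
         else (\<Sum>j<k. a2 h m k j *\<^sub>R K1L T0 Tv (2 * j) (m + j + 1 + k) s)
              - (\<Sum>j<k. b2 h m k j *\<^sub>R K2 T0 Tv (2 * j + 1) (m + 1 + j + k) s)))"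

text \<open>
  Coefficients for the conjugate operator. The binomial coefficients can have lower entry \<open>-1\<close>
  (when \<open>\<beta> + m = h\<close>), hence integer entries and an explicit convention. \<open>bc1\<close> takes the
  constant coefficient for \<open>j = 0\<close> as its first argument.
\<close>

definition binom_ext :: "int \<Rightarrow> int \<Rightarrow> real" where
  "binom_ext a b = (if b = - 1 then (if a = - 1 then 1 else 0) else real (nat a choose nat b))"

definition ac1 :: "nat \<Rightarrow> nat \<Rightarrow> nat \<Rightarrow> nat \<Rightarrow> real" where
  "ac1 h m k j = 2 ^ (2 * j + 1) * (fact (m + k + 1 + j) * fact (k + j + 1) / fact (2 * j + 1))
     * binom_ext (int h - int m - int k - int j - 2) (int h - int m - 2 * int k - 2)"

definition bc1 :: "real \<Rightarrow> nat \<Rightarrow> nat \<Rightarrow> nat \<Rightarrow> nat \<Rightarrow> real" where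
  "bc1 c0 h m k j =
     (case j of 0 \<Rightarrow> c0 | Suc i \<Rightarrow> ac1 h m k i / (real (i + 1) * real (k - i)))"

definition ac2 :: "nat \<Rightarrow> nat \<Rightarrow> nat \<Rightarrow> nat \<Rightarrow> real" where
  "ac2 h m k j = 2 ^ (2 * j) * fact (m + k + j) * fact (k - j) * real ((k + j) choose (2 * j))
     * binom_ext (int h - int m - int k - 1 - int j) (int h - int m - 2 * int k - 1)"

definition bc2 :: "nat \<Rightarrow> nat \<Rightarrow> nat \<Rightarrow> nat \<Rightarrow> real" where
  "bc2 h m k j = real (2 * (k - j)) / real (2 * j + 1) * ac2 h m k j"

text \<open>\<open>b0 k m n\<close> is the coefficient of index \<open>0\<close>, a real constant depending on \<open>k\<close>, \<open>m\<close>, \<open>n\<close> only.\<close>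

definition Dbar_resolvent ::
    "(nat \<Rightarrow> nat \<Rightarrow> nat \<Rightarrow> real) \<Rightarrow> nat \<Rightarrow> nat \<Rightarrow> ('v::banach \<Rightarrow>\<^sub>L 'v)
      \<Rightarrow> ('n::{finite,linorder} \<Rightarrow> 'v \<Rightarrow>\<^sub>L 'v) \<Rightarrow> 'n paravector
      \<Rightarrow> ('v, 'n) cmodule \<Rightarrow>\<^sub>L ('v, 'n) cmodule" where
  "Dbar_resolvent b0 \<beta> m T0 Tv s =
     (let n = CARD('n); h = (n - 1) div 2; k = \<beta> div 2
      in (2 ^ \<beta> * 4 ^ m * neg_poch h m) *\<^sub>R
        (if odd \<beta>
         then (\<Sum>j\<le>k. ac1 h m k j *\<^sub>R K1L T0 Tv (2 * j + 1) (m + j + 2 + k) s)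
              + (\<Sum>j\<le>k. bc1 (b0 k m n) h m k j *\<^sub>R K2 T0 Tv (2 * j) (m + j + 1 + k) s)
         else (\<Sum>j\<le>k. ac2 h m k j *\<^sub>R K1L T0 Tv (2 * j) (m + j + 1 + k) s)
              + (\<Sum>j<k. bc2 h m k j *\<^sub>R K2 T0 Tv (2 * j + 1) (m + 1 + k + j) s)))"


section \<open>The boundary integral\<close>

text \<open>\<open>R(s) ds\<^sub>I f(s)\<close> along \<open>\<gamma>\<close>, where \<open>ds\<^sub>I = ds (-I)\<close> and Clifford numbers act on \<open>V\<^sub>n\<close> from the left.\<close>

definition slice_integrand ::
    "('n::{finite,linorder} paravector \<Rightarrow> ('v::banach, 'n) cmodule \<Rightarrow>\<^sub>L ('v, 'n) cmodule)
      \<Rightarrow> ('n paravector \<Rightarrow> 'n clifford) \<Rightarrow> real ^ ('n::{finite,linorder}) \<Rightarrow> (real \<Rightarrow> complex) \<Rightarrow> real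
      \<Rightarrow> ('v, 'n) cmodule \<Rightarrow>\<^sub>L ('v, 'n) cmodule" where
  "slice_integrand R f I \<gamma> t =
     R (slice_pt I (\<gamma> t))
       o\<^sub>L cl_left (cl_mult (para (slice_pt I (vector_derivative \<gamma> (at t within {0..1}))))
                          (para (0, - I)))
       o\<^sub>L cl_left (f (slice_pt I (\<gamma> t)))"

text \<open>\<open>F = 1/(2\<pi>) \<integral>\<^bsub>\<partial>(U \<inter> \<complex>\<^sub>I)\<^esub> R(s) ds\<^sub>I f(s)\<close>, with the integral existing and not depending on the
  parametrisation of the positively oriented boundary.\<close>

definition is_calculus_value ::
    "('n::{finite,linorder} paravector \<Rightarrow> ('v::banach, 'n) cmodule \<Rightarrow>\<^sub>L ('v, 'n) cmodule)
      \<Rightarrow> ('n paravector \<Rightarrow> 'n clifford) \<Rightarrow> real ^ ('n::{finite,linorder}) \<Rightarrow> 'n paravector set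
      \<Rightarrow> ('v, 'n) cmodule \<Rightarrow>\<^sub>L ('v, 'n) cmodule \<Rightarrow> bool" where
  "is_calculus_value R f I U F \<longleftrightarrow>
     (\<exists>\<Gamma>. oriented_boundary (slice U I) \<Gamma>) \<and>
     (\<forall>\<Gamma>. oriented_boundary (slice U I) \<Gamma> \<longrightarrow>
        (\<forall>\<gamma>\<in>\<Gamma>. slice_integrand R f I \<gamma> integrable_on {0..1}) \<and>
        F = (1 / (2 * pi)) *\<^sub>R (\<Sum>\<gamma>\<in>\<Gamma>. integral {0..1} (slice_integrand R f I \<gamma>)))"

end

theory Submission
  imports Defs
begin

text \<open>
  Every resolvent is a real linear combination of operators \<open>K1L\<close> and \<open>K2\<close>, so it is enough to treat
  these, whatever the coefficients. On a slice \<open>\<complex>\<^sub>I\<close> the operator \<open>K2\<close> is the image, under the algebra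
  homomorphism sending \<open>\<i>\<close> to \<open>I\<close>, of a holomorphic function \<open>k\<close> on the resolvent set with values in the
  complexification of \<open>\<B>(V)\<close>; \<open>k\<close> does not depend on \<open>I\<close> and satisfies \<open>k (cnj z) = cnj (k z)\<close>. The
  coefficients of \<open>f\<close> with respect to \<open>e\<^sub>C\<close> are likewise images of scalar holomorphic functions \<open>F\<^sub>C\<close> with
  the same symmetry, so the boundary integral is the image of the ordinary contour integrals of
  \<open>- \<i> F\<^sub>C k\<close>. The homology form of Cauchy's theorem, transported to Banach spaces by the Hahn-Banach
  theorem, makes these independent of \<open>U\<close>. Applied to the conjugate cycle it shows that they are real,
  and the image of a real operator does not depend on \<open>I\<close>. Finally \<open>K1L\<close> is \<open>s K2\<close> minus \<open>K2\<close> multiplied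
  by a constant operator from the left. Positively oriented boundaries exist because, by Janiszewski's
  theorem, the indicator function of the domain is constant near either side of a boundary curve, so it
  is a combination of the indicator functions of the insides with coefficients \<open>-1\<close>, \<open>0\<close>, \<open>1\<close>.
\<close>

section \<open>Separating points by bounded functionals\<close>

text \<open>The obstacle is noncommutativity: a paravector \<open>s\<close> need commute neither
  with the units in \<open>T\<close> nor with the values of \<open>f\<close>. As the components
  commute, \<open>T\<close> times its conjugate is the sum of their squares, so \<open>Q_op\<close>
  is built from \<open>s\<close> and operators acting on each coefficient in \<open>V_n\<close>,
  which commute with every Clifford number. What does not fit leaves the integral at its two ends:
  the conjugate of \<open>T\<close> in \<open>K1L\<close> on the left, the basis elements
  \<open>e_C\<close> of \<open>f\<close> on the right. Another gap is that the resolvent set speaks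
  of invertibility on \<open>V_n\<close> at one point of one slice, whereas \<open>k\<close> needs
  an inverse over \<open>V\<close>, the same for all \<open>I\<close>. The main involution closes
  it: along with \<open>A + I B\<close> also \<open>A - I B\<close> is invertible, hence
  \<open>A^2 + B^2\<close>, which acts coefficientwise and so has an inverse on \<open>V\<close>.
  The homology form is needed because the boundaries of two domains \<open>U\<close> need be neither
  nested, disjoint nor homotopic; only their winding numbers can be compared.\<close>

lemma Hahn_Banach_extension_step:
  fixes G :: "('a::real_normed_vector \<times> real) set"
  assumes G: "subspace G" "\<And>p. p \<in> G \<Longrightarrow> snd p \<le> norm (fst p)"
  obtains c where "\<And>p. p \<in> span (insert (x, c) G) \<Longrightarrow> snd p \<le> norm (fst p)"
proof -
  \<comment> \<open>Domination on \<open>y + y'\<close>, split as \<open>(y - x) + (y' + x)\<close>: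
    each lower bound for the value at \<open>x\<close> stays below each upper bound.\<close>
  have key: "t - norm (y - x) \<le> norm (y' + x) - t'" if "(y, t) \<in> G" "(y', t') \<in> G" for y t y' t'
  proof -
    have "(y + y', t + t') \<in> G" using subspace_add[OF G(1) that] by simp
    then have "t + t' \<le> norm (y + y')" using G(2) by fastforce
    also have "\<dots> \<le> norm (y - x) + norm (y' + x)"
      using norm_triangle_ineq[of "y - x" "y' + x"] by (simp add: algebra_simps)
    finally show ?thesis by simp
  qed
  have 0: "(0, 0) \<in> G" using subspace_0[OF G(1)] by (simp add: zero_prod_def)
  \<comment> \<open>The least admissible value at \<open>x\<close>; the point \<open>(0, 0)\<close>
    of \<open>G\<close> makes the set nonempty and, through \<open>key\<close>, bounded
    above.\<close>
  define c where "c = Sup ((\<lambda>(y, t). t - norm (y - x)) ` G)"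
  have lower: "t - norm (y - x) \<le> c" if "(y, t) \<in> G" for y t
    unfolding c_def using that 0 key by (intro cSup_upper) (force intro!: bdd_aboveI2)+
  have upper: "c \<le> norm (y + x) - t" if "(y, t) \<in> G" for y t
    unfolding c_def using that 0 key by (intro cSup_least) auto
  have "snd p \<le> norm (fst p)" if p_in: "p \<in> span (insert (x, c) G)" for p
  proof -
    obtain k where "p - k *\<^sub>R (x, c) \<in> span G"
      using p_in unfolding span_breakdown_eq by blast
    then have "p - k *\<^sub>R (x, c) \<in> G" by (metis G(1) span_eq_iff)
    then obtain y t where yt: "(y, t) \<in> G" and p: "p = (y + k *\<^sub>R x, t + k * c)"
      by (cases p) auto
    have sc: "(r *\<^sub>R y, r * t) \<in> G" for r
      using subspace_scale[OF G(1) yt, of r] by simp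
    consider "k = 0" | "k > 0" | "k < 0" by linarith
    then have "t + k * c \<le> norm (y + k *\<^sub>R x)"
    proof cases
      case 1
      then show ?thesis using G(2)[OF yt] by simp
    next
      case 2
      have "k * c \<le> k * (norm ((1/k) *\<^sub>R y + x) - (1/k) * t)"
        using upper[OF sc[of "1/k"]] 2 by simp
      also have "k * norm ((1/k) *\<^sub>R y + x) = norm (k *\<^sub>R ((1/k) *\<^sub>R y + x))"
        using 2 by simp
      then have "k * (norm ((1/k) *\<^sub>R y + x) - (1/k) * t) = norm (y + k *\<^sub>R x) - t"
        using 2 by (simp add: algebra_simps)
      finally show ?thesis by simp
    next
      case 3
      have "(- k) * ((- 1/k) * t - norm ((- 1/k) *\<^sub>R y - x)) \<le> (- k) * c"
        using lower[OF sc[of "-1/k"]] 3 by (intro mult_left_mono) auto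
      moreover have "(- k) * norm ((- 1/k) *\<^sub>R y - x) = norm ((- k) *\<^sub>R ((- 1/k) *\<^sub>R y - x))"
        using 3 by simp
      then have "(- k) * ((- 1/k) * t - norm ((- 1/k) *\<^sub>R y - x)) = t - norm (y + k *\<^sub>R x)"
        using 3 by (simp add: algebra_simps)
      ultimately show ?thesis by simp
    qed
    then show ?thesis using p by simp
  qed
  then show thesis by (rule that)
qed

text \<open>Zorn's lemma is applied to graphs rather than functions, so that unions of chains are
  again candidates. Domination by the norm makes a graph single-valued, since \<open>(0, t)\<close>
  and \<open>(0, - t)\<close> force \<open>t = 0\<close>.\<close>

theorem bounded_linear_functional_exists:
  fixes x0 :: "'a::real_normed_vector"
  assumes "x0 \<noteq> 0"
  obtains \<phi> :: "'a \<Rightarrow> real" where "bounded_linear \<phi>" "\<phi> x0 \<noteq> 0"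
proof -
  define \<A> where "\<A> = {G :: ('a \<times> real) set. subspace G \<and> (x0, norm x0) \<in> G \<and> (\<forall>p\<in>G. snd p \<le> norm (fst p))}"
  have start: "span {(x0, norm x0)} \<in> \<A>"
  proof -
    have "k * norm x0 \<le> norm (k *\<^sub>R x0)" for k
      by (simp add: mult_right_mono)
    then have "snd p \<le> norm (fst p)" if "p \<in> span {(x0, norm x0)}" for p
      using that by (auto simp: span_singleton)
    then show ?thesis by (auto simp: \<A>_def intro: span_base)
  qed
  have "\<exists>M\<in>\<A>. \<forall>X\<in>\<A>. M \<subseteq> X \<longrightarrow> X = M"
  proof (rule subset_Zorn_nonempty)
    show "\<A> \<noteq> {}" using start by auto
    fix C assume C: "C \<noteq> {}" "subset.chain \<A> C"
    have sub: "\<And>G. G \<in> C \<Longrightarrow> G \<in> \<A>" and chain: "\<And>G H. G \<in> C \<Longrightarrow> H \<in> C \<Longrightarrow> G \<subseteq> H \<or> H \<subseteq> G"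
      using C(2) by (auto simp: subset_chain_def)
    have "subspace (\<Union>C)"
    proof (intro subspaceI)
      show "0 \<in> \<Union>C" using C(1) sub by (auto simp: \<A>_def dest: subspace_0)
      show "a + b \<in> \<Union>C" if ab: "a \<in> \<Union>C" "b \<in> \<Union>C" for a b
      proof -
        obtain G H where GH: "G \<in> C" "a \<in> G" "H \<in> C" "b \<in> H" using ab by blast
        then consider "a \<in> H" | "b \<in> G" using chain by blast
        then show ?thesis using GH sub by cases (auto simp: \<A>_def dest: subspace_add)
      qed
      show "k *\<^sub>R a \<in> \<Union>C" if "a \<in> \<Union>C" for k a
        using that sub by (auto simp: \<A>_def dest: subspace_scale)
    qed
    then show "\<Union>C \<in> \<A>" using C(1) sub by (fastforce simp: \<A>_def)
  qed
  then obtain M where M: "subspace M" "(x0, norm x0) \<in> M" "\<And>p. p \<in> M \<Longrightarrow> snd p \<le> norm (fst p)"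
    and max: "\<And>X. X \<in> \<A> \<Longrightarrow> M \<subseteq> X \<Longrightarrow> X = M"
    by (auto simp: \<A>_def)
  have total: "\<exists>t. (x, t) \<in> M" for x
  proof -
    obtain c where "\<And>p. p \<in> span (insert (x, c) M) \<Longrightarrow> snd p \<le> norm (fst p)"
      using Hahn_Banach_extension_step[OF M(1,3)] by blast
    then have "span (insert (x, c) M) \<in> \<A>"
      using M(2) by (auto simp: \<A>_def intro: span_base)
    then have "span (insert (x, c) M) = M"
      by (intro max) (auto intro: span_base)
    then show ?thesis by (metis insertI1 span_base)
  qed
  have unique: "t = t'" if "(x, t) \<in> M" "(x, t') \<in> M" for x t t'
  proof -
    have "(0, t - t') \<in> M" "(0, t' - t) \<in> M"
      using subspace_diff[OF M(1) that] subspace_diff[OF M(1) that(2,1)] by auto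
    then have "t - t' \<le> 0" "t' - t \<le> 0" using M(3) by force+
    then show ?thesis by simp
  qed
  define \<phi> where "\<phi> x = (THE t. (x, t) \<in> M)" for x
  have \<phi>: "(x, \<phi> x) \<in> M" for x
    unfolding \<phi>_def using total[of x] unique by (metis theI)
  have "bounded_linear \<phi>"
  proof (rule bounded_linear_intro[where K=1])
    show "\<phi> (x + y) = \<phi> x + \<phi> y" for x y
      using unique[OF \<phi>[of "x + y"]] subspace_add[OF M(1) \<phi>[of x] \<phi>[of y]] by simp
    show "\<phi> (r *\<^sub>R x) = r *\<^sub>R \<phi> x" for r x
      using unique[OF \<phi>[of "r *\<^sub>R x"]] subspace_scale[OF M(1) \<phi>[of x], of r] by simp
    \<comment> \<open>Domination is one-sided; applied at \<open>- x\<close> as well it bounds the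
      absolute value.\<close>
    show "norm (\<phi> x) \<le> norm x * 1" for x
      using M(3)[OF \<phi>[of x]] M(3)[OF subspace_neg[OF M(1) \<phi>[of x]]] by simp
  qed
  moreover have "\<phi> x0 = norm x0" using unique \<phi> M(2) by blast
  ultimately show thesis using that assms by simp
qed

lemma eq_by_functionals:
  fixes x y :: "'a::real_normed_vector"
  assumes "\<And>\<phi> :: 'a \<Rightarrow> real. bounded_linear \<phi> \<Longrightarrow> \<phi> x = \<phi> y"
  shows "x = y"
proof (rule ccontr)
  assume "x \<noteq> y"
  then obtain \<phi> :: "'a \<Rightarrow> real" where \<phi>: "bounded_linear \<phi>" "\<phi> (x - y) \<noteq> 0"
    using bounded_linear_functional_exists[of "x - y"] by auto
  then show False using assms[OF \<phi>(1)] by (simp add: linear_diff bounded_linear.linear)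
qed

section \<open>Cauchy's theorem for cycles\<close>

text \<open>Differentiation under the integral sign: \<open>f\<close> is continuous on the path and
  a polynomial path has bounded speed.\<close>

lemma Cauchy_transform_holomorphic:
  assumes \<gamma>: "polynomial_function \<gamma>" and S: "open S" "f holomorphic_on S" "path_image \<gamma> \<subseteq> S"
  shows "(\<lambda>w. contour_integral \<gamma> (\<lambda>z. f z / (z - w))) holomorphic_on (- path_image \<gamma>)"
proof -
  have vp: "valid_path \<gamma>" by (simp add: \<gamma> valid_path_polynomial_function)
  obtain \<gamma>' where \<gamma>': "polynomial_function \<gamma>'" "\<And>x. (\<gamma> has_vector_derivative (\<gamma>' x)) (at x)"
    using has_vector_derivative_polynomial_function [OF \<gamma>] by blast
  then have "bounded (\<gamma>' ` {0..1})"
    by (simp add: compact_imp_bounded compact_continuous_image continuous_on_polymonial_function)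
  then obtain B where B: "\<And>t. t \<in> {0..1} \<Longrightarrow> norm (vector_derivative \<gamma> (at t)) \<le> B"
    using \<gamma>'(2) by (metis bounded_iff imageI vector_derivative_at)
  have int: "((\<lambda>z. f z / (z - w) ^ 1) has_contour_integral contour_integral \<gamma> (\<lambda>z. f z / (z - w))) \<gamma>"
    if "w \<notin> path_image \<gamma>" for w
  proof -
    have "(\<lambda>z. f z / (z - w)) holomorphic_on (S - {w})"
      by (intro holomorphic_intros holomorphic_on_subset [OF S(2)]) auto
    then have "(\<lambda>z. f z / (z - w)) contour_integrable_on \<gamma>"
      using S that vp by (intro contour_integrable_holomorphic_simple [where S="S - {w}"]) auto
    then show ?thesis
      by (simp add: has_contour_integral_integral)
  qed
  have "continuous_on (path_image \<gamma>) f"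
    using S holomorphic_on_imp_continuous_on continuous_on_subset by blast
  then have "((\<lambda>w. contour_integral \<gamma> (\<lambda>z. f z / (z - w))) has_field_derivative
      (1 * contour_integral \<gamma> (\<lambda>u. f u / (u - w) ^ Suc 1))) (at w)" if "w \<notin> path_image \<gamma>" for w
    using Cauchy_next_derivative(2)[of \<gamma> f B UNIV 1 _ w] B int that vp by simp
  then show ?thesis
    unfolding holomorphic_on_def field_differentiable_def
    by (meson ComplD has_field_derivative_at_within)
qed

lemma holomorphic_difference_quotient:
  assumes "open S" "f holomorphic_on S" "w \<in> S"
  shows "(\<lambda>z. if z = w then deriv f w else (f z - f w) / (z - w)) holomorphic_on S"
  by (intro pole_lemma_open assms)

text \<open>Off the point \<open>w\<close> the quotient splits into \<open>f z / (z - w)\<close> and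
  a multiple of \<open>1 / (z - w)\<close>, whose integral is the winding number; the path never
  meets \<open>w\<close>.\<close>

lemma contour_integral_difference_quotient:
  assumes p: "valid_path p" "pathfinish p = pathstart p" "path_image p \<subseteq> S"
    and f: "open S" "f holomorphic_on S" and w: "w \<notin> path_image p"
  shows "contour_integral p (\<lambda>z. if z = w then deriv f w else (f z - f w) / (z - w))
    = contour_integral p (\<lambda>z. f z / (z - w)) - 2 * pi * \<i> * winding_number p w * f w"
proof -
  have h: "(\<lambda>z. f z / (z - w)) holomorphic_on (S - {w})" "(\<lambda>z. f w * (1 / (z - w))) holomorphic_on (S - {w})"
    by (intro holomorphic_intros holomorphic_on_subset [OF f(2)]; auto)+
  have i: "(\<lambda>z. f z / (z - w)) contour_integrable_on p" "(\<lambda>z. f w * (1 / (z - w))) contour_integrable_on p"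
    using p w f h by (auto intro!: contour_integrable_holomorphic_simple [where S="S - {w}"])
  have "contour_integral p (\<lambda>z. if z = w then deriv f w else (f z - f w) / (z - w))
    = contour_integral p (\<lambda>z. f z / (z - w) - f w * (1 / (z - w)))"
    using w by (intro contour_integral_eq) (auto simp: diff_divide_distrib)
  also have "\<dots> = contour_integral p (\<lambda>z. f z / (z - w)) - contour_integral p (\<lambda>z. f w * (1 / (z - w)))"
    by (intro contour_integral_diff i)
  also have "contour_integral p (\<lambda>z. f w * (1 / (z - w))) = f w * contour_integral p (\<lambda>z. 1 / (z - w))"
    using contour_integrable_inversediff p w by (intro contour_integral_lmul) auto
  finally show ?thesis
    using winding_number_valid_path [OF p(1) w] by (simp add: field_simps)
qed

text \<open>This is why paths are first taken polynomial: a null set fills no ball, so arbitrarily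
  near any point there are points off the cycle, and a small translation moves the cycle off the
  given point.\<close>

lemma negligible_polynomial_path:
  fixes \<gamma> :: "real \<Rightarrow> complex"
  assumes "polynomial_function \<gamma>"
  shows "negligible (path_image \<gamma>)"
  unfolding path_image_def
  by (intro negligible_differentiable_image_lowdim)
     (auto simp: assms differentiable_on_polynomial_function)

text \<open>
  Dixon's argument: \<open>\<Phi>\<close> below is entire and tends to \<open>0\<close> at infinity. Near a point of \<open>S\<close>, even one on
  the cycle, \<open>\<Phi>\<close> is holomorphic because a small translation moves the cycle off that point without
  changing the integrals of functions holomorphic on \<open>S\<close>.
\<close>

lemma Cauchy_theorem_polynomial_cycle:
  assumes S: "open S" and A: "finite A"
    and \<gamma>: "\<And>i. i \<in> A \<Longrightarrow> polynomial_function (\<gamma> i)" "\<And>i. i \<in> A \<Longrightarrow> pathfinish (\<gamma> i) = pathstart (\<gamma> i)"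
      "\<And>i. i \<in> A \<Longrightarrow> path_image (\<gamma> i) \<subseteq> S"
    and zero: "\<And>w. w \<notin> S \<Longrightarrow> (\<Sum>i\<in>A. c i * winding_number (\<gamma> i) w) = 0"
    and f: "f holomorphic_on S" and w: "w \<in> S" "\<And>i. i \<in> A \<Longrightarrow> w \<notin> path_image (\<gamma> i)"
  shows "(\<Sum>i\<in>A. c i * contour_integral (\<gamma> i) (\<lambda>z. f z / (z - w)))
    = 2 * pi * \<i> * (\<Sum>i\<in>A. c i * winding_number (\<gamma> i) w) * f w"
proof -
  define K where "K = (\<Union>i\<in>A. path_image (\<gamma> i))"
  define g where "g w z = (if z = w then deriv f w else (f z - f w) / (z - w))" for w z
  \<comment> \<open>The two formulas differ by the winding number term, so they agree on a
    neighbourhood of each point outside \<open>S\<close>, where the winding sum vanishes.\<close>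
  define \<Phi> where "\<Phi> w = (if w \<in> S then \<Sum>i\<in>A. c i * contour_integral (\<gamma> i) (g w)
    else \<Sum>i\<in>A. c i * contour_integral (\<gamma> i) (\<lambda>z. f z / (z - w)))" for w
  have vp: "valid_path (\<gamma> i)" "path (\<gamma> i)" if "i \<in> A" for i
    using \<gamma> that by (simp_all add: valid_path_polynomial_function path_polynomial_function)
  have K: "compact K" "K \<subseteq> S"
    unfolding K_def using A vp(2) by (intro compact_UN compact_path_image UN_least \<gamma>(3); simp)+
  have negK: "negligible K"
    unfolding K_def using A \<gamma> by (intro negligible_Union) (auto intro: negligible_polynomial_path)
  have split: "(\<Sum>i\<in>A. c i * contour_integral (p i) (g w))
      = (\<Sum>i\<in>A. c i * contour_integral (p i) (\<lambda>z. f z / (z - w)))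
        - 2 * pi * \<i> * (\<Sum>i\<in>A. c i * winding_number (p i) w) * f w"
    if p: "\<And>i. i \<in> A \<Longrightarrow> polynomial_function (p i)" "\<And>i. i \<in> A \<Longrightarrow> pathfinish (p i) = pathstart (p i)"
      "\<And>i. i \<in> A \<Longrightarrow> path_image (p i) \<subseteq> S" "\<And>i. i \<in> A \<Longrightarrow> w \<notin> path_image (p i)" for p w
  proof -
    have *: "contour_integral (p i) (g w) = contour_integral (p i) (\<lambda>z. f z / (z - w))
      - 2 * pi * \<i> * winding_number (p i) w * f w" if "i \<in> A" for i
      unfolding g_def
      by (intro contour_integral_difference_quotient[where S=S] S f p that valid_path_polynomial_function)
    have "(\<Sum>i\<in>A. c i * contour_integral (p i) (g w)) = (\<Sum>i\<in>A. c i * contour_integral (p i) (\<lambda>z. f z / (z - w))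
      - 2 * pi * \<i> * (c i * winding_number (p i) w) * f w)"
      by (intro sum.cong refl) (simp only: *, simp add: algebra_simps)
    then show ?thesis
      by (simp add: sum_subtractf sum_distrib_left sum_distrib_right mult_ac)
  qed
  have hol_ball: "(\<lambda>w. \<Sum>i\<in>A. c i * contour_integral (p i) (\<lambda>z. f z / (z - w))) holomorphic_on B"
    if "\<And>i. i \<in> A \<Longrightarrow> polynomial_function (p i)" "\<And>i. i \<in> A \<Longrightarrow> path_image (p i) \<subseteq> S"
      "\<And>i. i \<in> A \<Longrightarrow> B \<subseteq> - path_image (p i)" for p B
    using that S f
    by (intro holomorphic_intros holomorphic_on_subset[OF Cauchy_transform_holomorphic, of _ S]) auto
  have const: "winding_number (p i) w = winding_number (p i) w0"
    if "polynomial_function (p i)" "pathfinish (p i) = pathstart (p i)" "ball w0 e \<inter> path_image (p i) = {}"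
      "w \<in> ball w0 e" for p :: "'a \<Rightarrow> real \<Rightarrow> complex" and i w w0 e
    by (rule winding_number_eq[where S="ball w0 e"])
      (use that path_polynomial_function in \<open>auto simp: dist_commute intro: le_less_trans[OF zero_le_dist]\<close>)
  have loc: "\<exists>e>0. \<Phi> holomorphic_on ball w0 e" for w0
  proof (cases "w0 \<in> S")
    case True
    \<comment> \<open>Nearby closed paths give equal integrals of functions holomorphic on
      \<open>S\<close>. The quotient \<open>g w\<close> is such a function, so \<open>\<Phi>\<close>
      may be computed on a translated cycle.\<close>
    have "\<exists>d>0. \<forall>\<tau>. norm \<tau> < d \<longrightarrow> path_image (\<lambda>t. \<gamma> i t + \<tau>) \<subseteq> S \<and>
        (\<forall>F. F holomorphic_on S \<longrightarrow> contour_integral (\<lambda>t. \<gamma> i t + \<tau>) F = contour_integral (\<gamma> i) F)"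
      if i: "i \<in> A" for i
    proof -
      obtain d where d: "d > 0" "\<And>g h. valid_path g \<Longrightarrow> valid_path h \<Longrightarrow>
         (\<And>t. t \<in> {0..1} \<Longrightarrow> norm (g t - \<gamma> i t) < d \<and> norm (h t - \<gamma> i t) < d) \<Longrightarrow>
            pathfinish g = pathstart g \<Longrightarrow> pathfinish h = pathstart h \<Longrightarrow>
         path_image g \<subseteq> S \<and> path_image h \<subseteq> S \<and> (\<forall>f. f holomorphic_on S \<longrightarrow> contour_integral h f = contour_integral g f)"
        using contour_integral_nearby_loops[OF S, of "\<gamma> i"] vp \<gamma>(3) i by metis
      have "path_image (\<lambda>t. \<gamma> i t + \<tau>) \<subseteq> S \<and>
        (\<forall>F. F holomorphic_on S \<longrightarrow> contour_integral (\<lambda>t. \<gamma> i t + \<tau>) F = contour_integral (\<gamma> i) F)"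
        if "norm \<tau> < d" for \<tau>
        using d(2)[of "\<gamma> i" "\<lambda>t. \<gamma> i t + \<tau>"]
          valid_path_polynomial_function[OF polynomial_function_add[OF \<gamma>(1)[OF i] polynomial_function_const, of \<tau>]] vp \<gamma>(1,2) i d(1) that
        by (auto simp: pathfinish_def pathstart_def intro!: valid_path_polynomial_function)
      then show ?thesis using d(1) by blast
    qed
    then obtain d where d: "\<And>i. i \<in> A \<Longrightarrow> d i > 0" "\<And>i \<tau>. i \<in> A \<Longrightarrow> norm \<tau> < d i \<Longrightarrow> path_image (\<lambda>t. \<gamma> i t + \<tau>) \<subseteq> S"
        "\<And>i \<tau> F. i \<in> A \<Longrightarrow> norm \<tau> < d i \<Longrightarrow> F holomorphic_on S \<Longrightarrow>
           contour_integral (\<lambda>t. \<gamma> i t + \<tau>) F = contour_integral (\<gamma> i) F"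
      by metis
    \<comment> \<open>The extra \<open>1\<close> keeps the minimum meaningful for an empty
      cycle.\<close>
    define D where "D = Min (insert 1 (d ` A))"
    have D: "D > 0" "\<And>i. i \<in> A \<Longrightarrow> D \<le> d i"
      using A d(1) by (auto simp: D_def)
    have "\<not> ball w0 D \<subseteq> K"
      using D open_not_negligible[of "ball w0 D"] negligible_subset[OF negK] by auto
    then obtain y where y: "dist w0 y < D" "y \<notin> K" by (meson mem_ball subsetI)
    \<comment> \<open>The translation carries \<open>y\<close>, which is off the cycle, to
      \<open>w0\<close>; hence the translated cycle avoids \<open>w0\<close>.\<close>
    define \<tau> where "\<tau> = w0 - y"
    define p where "p i t = \<gamma> i t + \<tau>" for i t
    have \<tau>: "norm \<tau> < d i" if "i \<in> A" for i
      using D(2)[OF that] y by (simp add: \<tau>_def dist_norm)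
    have p: "polynomial_function (p i)" "pathfinish (p i) = pathstart (p i)" "path_image (p i) \<subseteq> S"
       "w0 \<notin> path_image (p i)" if "i \<in> A" for i
    proof -
      have "p i = (\<lambda>t. \<gamma> i t + \<tau>)" by (simp add: p_def fun_eq_iff)
      then show "polynomial_function (p i)" "pathfinish (p i) = pathstart (p i)" "path_image (p i) \<subseteq> S"
        using \<gamma>(1,2)[OF that] d(2)[OF that \<tau>[OF that]]
        by (auto simp: pathfinish_def pathstart_def)
      have "\<gamma> i t \<noteq> y" if "t \<in> {0..1}" for t
        using y(2) \<open>i \<in> A\<close> that by (auto simp: K_def path_image_def)
      then show "w0 \<notin> path_image (p i)"
        by (force simp: p_def path_image_def \<tau>_def algebra_simps)
    qed
    have "open (S - (\<Union>i\<in>A. path_image (p i)))"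
      using A p S by (intro open_Diff closed_UN) (auto intro: closed_path_image path_polynomial_function)
    moreover have "w0 \<in> S - (\<Union>i\<in>A. path_image (p i))" using True p by auto
    ultimately obtain e where e: "e > 0" "ball w0 e \<subseteq> S - (\<Union>i\<in>A. path_image (p i))"
      by (meson open_contains_ball)
    \<comment> \<open>On this ball the winding numbers of the translated cycle are frozen at their
      values at \<open>w0\<close>, and its Cauchy transforms are holomorphic.\<close>
    have eq: "(\<Sum>i\<in>A. c i * contour_integral (p i) (\<lambda>z. f z / (z - w)))
        - 2 * pi * \<i> * (\<Sum>i\<in>A. c i * winding_number (p i) w0) * f w = \<Phi> w" if "w \<in> ball w0 e" for w
    proof -
      have wS: "w \<in> S" using e that by auto
      have "\<Phi> w = (\<Sum>i\<in>A. c i * contour_integral (p i) (g w))"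
        using wS d(3)[OF _ \<tau>, of _ "g w"] holomorphic_difference_quotient[OF S f wS]
        by (simp add: \<Phi>_def p_def[abs_def] g_def[abs_def])
      also have "\<dots> = (\<Sum>i\<in>A. c i * contour_integral (p i) (\<lambda>z. f z / (z - w)))
        - 2 * pi * \<i> * (\<Sum>i\<in>A. c i * winding_number (p i) w) * f w"
        using e that p by (intro split) auto
      also have "(\<Sum>i\<in>A. c i * winding_number (p i) w) = (\<Sum>i\<in>A. c i * winding_number (p i) w0)"
        using e that p by (intro sum.cong) (auto simp del: mem_ball intro!: const)
      finally show ?thesis by simp
    qed
    have "(\<lambda>w. (\<Sum>i\<in>A. c i * contour_integral (p i) (\<lambda>z. f z / (z - w)))
        - 2 * pi * \<i> * (\<Sum>i\<in>A. c i * winding_number (p i) w0) * f w) holomorphic_on ball w0 e"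
      using p e by (intro holomorphic_intros hol_ball holomorphic_on_subset[OF f]) auto
    then have "\<Phi> holomorphic_on ball w0 e"
      by (rule holomorphic_transform[OF _ eq])
    then show ?thesis
      using e(1) by auto
  next
    case False
    then have "w0 \<in> - K" "open (- K)" using K by (auto intro: compact_imp_closed)
    then obtain e where e: "e > 0" "ball w0 e \<subseteq> - K"
      by (meson open_contains_ball)
    have eq: "(\<Sum>i\<in>A. c i * contour_integral (\<gamma> i) (\<lambda>z. f z / (z - w))) = \<Phi> w" if "w \<in> ball w0 e" for w
    proof (cases "w \<in> S")
      case True
      have "(\<Sum>i\<in>A. c i * winding_number (\<gamma> i) w) = (\<Sum>i\<in>A. c i * winding_number (\<gamma> i) w0)"
        using e that \<gamma> by (intro sum.cong) (auto simp del: mem_ball simp: K_def intro!: const)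
      then have "(\<Sum>i\<in>A. c i * winding_number (\<gamma> i) w) = 0"
        using zero[OF False] by simp
      moreover have "\<And>i. i \<in> A \<Longrightarrow> w \<notin> path_image (\<gamma> i)"
        using e that by (auto simp: K_def)
      ultimately show ?thesis
        using True split[of \<gamma> w] \<gamma> by (simp add: \<Phi>_def)
    qed (simp add: \<Phi>_def)
    have "(\<lambda>w. \<Sum>i\<in>A. c i * contour_integral (\<gamma> i) (\<lambda>z. f z / (z - w))) holomorphic_on ball w0 e"
      using \<gamma> e by (intro hol_ball) (auto simp: K_def)
    then have "\<Phi> holomorphic_on ball w0 e"
      by (rule holomorphic_transform[OF _ eq])
    then show ?thesis
      using e(1) by auto
  qed
  have hol: "\<Phi> holomorphic_on UNIV"
    unfolding holomorphic_on_def
    by (metis loc UNIV_I centre_in_ball holomorphic_on_imp_differentiable_at open_ball field_differentiable_at_within)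
  have lim: "(\<Phi> \<longlongrightarrow> 0) at_infinity"
  proof -
    have "bounded (f ` K)" "bounded K"
      using K f holomorphic_on_imp_continuous_on
      by (auto intro!: compact_imp_bounded compact_continuous_image intro: continuous_on_subset)
    then obtain M R0 where M: "\<And>z. z \<in> K \<Longrightarrow> norm (f z) < M" and R0: "K \<subseteq> ball 0 R0"
      unfolding bounded_pos_less[of "f ` K"] using bounded_subset_ballD[of K 0] by auto
    \<comment> \<open>The bound for contour integrals asks for an open set on which the integrand is
      bounded, so \<open>K\<close> is enlarged to a bounded neighbourhood on which \<open>f\<close>
      is bounded.\<close>
    define S' where "S' = (S \<inter> (\<lambda>z. norm (f z)) -` {..<M}) \<inter> ball 0 R0"
    have "open (S \<inter> (\<lambda>z. norm (f z)) -` {..<M})"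
      by (intro continuous_open_preimage continuous_on_norm holomorphic_on_imp_continuous_on f S) auto
    then have S': "open S'" "K \<subseteq> S'" "S' \<subseteq> S"
      using K(2) M R0 by (auto simp: S'_def)
    have M: "\<And>z. z \<in> S' \<Longrightarrow> norm (f z) \<le> M" and R: "\<And>z. z \<in> S' \<Longrightarrow> norm z \<le> R0"
      by (auto simp: S'_def)
    have "\<exists>L>0. \<forall>f B. f holomorphic_on S' \<and> (\<forall>z\<in>S'. norm (f z) \<le> B) \<longrightarrow> norm (contour_integral (\<gamma> i) f) \<le> L * B"
      if "i \<in> A" for i
      using contour_integral_bound_exists[OF S'(1) vp(1)[OF that]] S'(2) that by (auto simp: K_def)
    then obtain L where L: "\<And>i. i \<in> A \<Longrightarrow> L i > 0" "\<And>i f B. i \<in> A \<Longrightarrow> f holomorphic_on S' \<Longrightarrow>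
         (\<And>z. z \<in> S' \<Longrightarrow> norm (f z) \<le> B) \<Longrightarrow> norm (contour_integral (\<gamma> i) f) \<le> L i * B"
      by metis
    have "\<forall>i\<in>A. \<exists>B. \<forall>z. B \<le> norm z \<longrightarrow> winding_number (\<gamma> i) z = 0"
      using winding_number_zero_at_infinity vp \<gamma> by blast
    then obtain W where W: "\<And>i z. i \<in> A \<Longrightarrow> W i \<le> norm z \<Longrightarrow> winding_number (\<gamma> i) z = 0"
      by metis
    define Q where "Q = Max (insert (\<bar>R0\<bar> + 1) (W ` A))"
    have Q: "\<bar>R0\<bar> + 1 \<le> Q" "\<And>i. i \<in> A \<Longrightarrow> W i \<le> Q" using A by (auto simp: Q_def)
    have bound: "norm (\<Phi> w) \<le> (\<Sum>i\<in>A. norm (c i) * L i * \<bar>M\<bar>) * (1 / (norm w - \<bar>R0\<bar>))" if w: "norm w \<ge> Q" for w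
    proof -
      have wS': "w \<notin> S'" using R w Q by force
      then have wK: "\<And>i. i \<in> A \<Longrightarrow> w \<notin> path_image (\<gamma> i)" using S' by (auto simp: K_def)
      have "(\<Sum>i\<in>A. c i * winding_number (\<gamma> i) w) = 0"
        using W Q w by (intro sum.neutral) fastforce
      then have "\<Phi> w = (\<Sum>i\<in>A. c i * contour_integral (\<gamma> i) (\<lambda>z. f z / (z - w)))"
        using split[of \<gamma> w] \<gamma> wK by (simp add: \<Phi>_def)
      also have "norm \<dots> \<le> (\<Sum>i\<in>A. norm (c i) * (L i * (\<bar>M\<bar> / (norm w - \<bar>R0\<bar>))))"
      proof (intro sum_norm_le)
        fix i assume i: "i \<in> A"
        have "norm (contour_integral (\<gamma> i) (\<lambda>z. f z / (z - w))) \<le> L i * (\<bar>M\<bar> / (norm w - \<bar>R0\<bar>))"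
        proof (rule L(2)[OF i])
          show "(\<lambda>z. f z / (z - w)) holomorphic_on S'"
            using wS' S' by (intro holomorphic_intros holomorphic_on_subset[OF f]) auto
          show "norm (f z / (z - w)) \<le> \<bar>M\<bar> / (norm w - \<bar>R0\<bar>)" if "z \<in> S'" for z
          proof -
            have "norm w - \<bar>R0\<bar> \<le> norm (z - w)"
              using R[OF that] norm_triangle_ineq2[of w z] by (simp add: norm_minus_commute)
            then show ?thesis
              using M[OF that] w Q by (auto simp: norm_divide intro!: frac_le)
          qed
        qed
        then show "norm (c i * contour_integral (\<gamma> i) (\<lambda>z. f z / (z - w))) \<le> norm (c i) * (L i * (\<bar>M\<bar> / (norm w - \<bar>R0\<bar>)))"
          unfolding norm_mult by (intro mult_left_mono) auto
      qed
      also have "\<dots> = (\<Sum>i\<in>A. norm (c i) * L i * \<bar>M\<bar>) * (1 / (norm w - \<bar>R0\<bar>))"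
        unfolding sum_distrib_right by (intro sum.cong) auto
      finally show ?thesis .
    qed
    show ?thesis
    proof (rule Lim_null_comparison)
      show "\<forall>\<^sub>F w in at_infinity. norm (\<Phi> w) \<le> (\<Sum>i\<in>A. norm (c i) * L i * \<bar>M\<bar>) * (1 / (norm w - \<bar>R0\<bar>))"
        using bound by (auto simp: eventually_at_infinity)
      have "filterlim (\<lambda>w::complex. - \<bar>R0\<bar> + norm w) at_top at_infinity"
        by (rule filterlim_tendsto_add_at_top[OF tendsto_const filterlim_norm_at_top])
      then have "((\<lambda>w::complex. inverse (norm w - \<bar>R0\<bar>)) \<longlongrightarrow> 0) at_infinity"
        by (intro tendsto_inverse_0_at_top) simp
      then show "((\<lambda>w::complex. (\<Sum>i\<in>A. norm (c i) * L i * \<bar>M\<bar>) * (1 / (norm w - \<bar>R0\<bar>))) \<longlongrightarrow> 0) at_infinity"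
        unfolding inverse_eq_divide by (rule tendsto_mult_right_zero)
    qed
  qed
  have "\<Phi> w = 0" using Liouville_weak_0[OF hol lim] .
  then show ?thesis
    using split[of \<gamma> w] \<gamma> w by (simp add: \<Phi>_def)
qed

text \<open>Replacing each path by a nearby polynomial one changes no integral of a function
  holomorphic on \<open>S\<close>, and winding numbers around points outside \<open>S\<close> are
  such integrals. The integral formula is then used for \<open>f z * (z - w)\<close>, which vanishes
  at \<open>w\<close>.\<close>

theorem Cauchy_theorem_cycle:
  assumes S: "open S" and A: "finite A"
    and \<gamma>: "\<And>i. i \<in> A \<Longrightarrow> valid_path (\<gamma> i)" "\<And>i. i \<in> A \<Longrightarrow> pathfinish (\<gamma> i) = pathstart (\<gamma> i)"
      "\<And>i. i \<in> A \<Longrightarrow> path_image (\<gamma> i) \<subseteq> S"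
    and zero: "\<And>w. w \<notin> S \<Longrightarrow> (\<Sum>i\<in>A. c i * winding_number (\<gamma> i) w) = 0"
    and f: "f holomorphic_on S"
  shows "(\<Sum>i\<in>A. c i * contour_integral (\<gamma> i) f) = 0"
proof (cases "A = {}")
  case False
  have "\<exists>p. polynomial_function p \<and> pathfinish p = pathstart p \<and> path_image p \<subseteq> S \<and>
      (\<forall>F. F holomorphic_on S \<longrightarrow> contour_integral p F = contour_integral (\<gamma> i) F)" if i: "i \<in> A" for i
  proof -
    have "path (\<gamma> i)" using \<gamma>(1)[OF i] by (rule valid_path_imp_path)
    obtain d where d: "d > 0" "\<And>g h. valid_path g \<Longrightarrow> valid_path h \<Longrightarrow>
       (\<And>t. t \<in> {0..1} \<Longrightarrow> norm (g t - \<gamma> i t) < d \<and> norm (h t - \<gamma> i t) < d) \<Longrightarrow>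
          pathstart h = pathstart g \<Longrightarrow> pathfinish h = pathfinish g \<Longrightarrow>
       path_image g \<subseteq> S \<and> path_image h \<subseteq> S \<and> (\<forall>f. f holomorphic_on S \<longrightarrow> contour_integral h f = contour_integral g f)"
      using contour_integral_nearby_ends[OF S \<open>path (\<gamma> i)\<close> \<gamma>(3)[OF i]] by metis
    obtain p where p: "polynomial_function p" "pathstart p = pathstart (\<gamma> i)" "pathfinish p = pathfinish (\<gamma> i)"
       "\<And>t. t \<in> {0..1} \<Longrightarrow> norm (p t - \<gamma> i t) < d"
      using path_approx_polynomial_function[OF \<open>path (\<gamma> i)\<close> d(1)] by metis
    have "path_image p \<subseteq> S \<and> (\<forall>F. F holomorphic_on S \<longrightarrow> contour_integral p F = contour_integral (\<gamma> i) F)"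
      using d(2)[OF \<gamma>(1)[OF i] valid_path_polynomial_function[OF p(1)] _ p(2,3)] d(1) p(4) by simp
    then show ?thesis using p(1-3) \<gamma>(2)[OF i] by auto
  qed
  then obtain p where p: "\<And>i. i \<in> A \<Longrightarrow> polynomial_function (p i)" "\<And>i. i \<in> A \<Longrightarrow> pathfinish (p i) = pathstart (p i)"
    "\<And>i. i \<in> A \<Longrightarrow> path_image (p i) \<subseteq> S"
    "\<And>i F. i \<in> A \<Longrightarrow> F holomorphic_on S \<Longrightarrow> contour_integral (p i) F = contour_integral (\<gamma> i) F"
    by metis
  have zero_p: "(\<Sum>i\<in>A. c i * winding_number (p i) w) = 0" if w: "w \<notin> S" for w
  proof -
    have "winding_number (p i) w = winding_number (\<gamma> i) w" if i: "i \<in> A" for i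
    proof -
      have "(\<lambda>z. 1 / (z - w)) holomorphic_on S" using w by (intro holomorphic_intros) auto
      moreover have "w \<notin> path_image (p i)" "w \<notin> path_image (\<gamma> i)" using p(3) \<gamma>(3) i w by auto
      ultimately show ?thesis
        using p i \<gamma> by (simp add: winding_number_valid_path valid_path_polynomial_function)
    qed
    then show ?thesis using zero[OF w] by simp
  qed
  have "negligible (\<Union>i\<in>A. path_image (p i))"
    using A p(1) by (intro negligible_Union) (auto intro: negligible_polynomial_path)
  moreover have "S \<noteq> {}" using False p(3) path_image_nonempty by blast
  ultimately have "\<not> S \<subseteq> (\<Union>i\<in>A. path_image (p i))"
    using S open_not_negligible negligible_subset by blast
  then obtain w where w: "w \<in> S" "\<And>i. i \<in> A \<Longrightarrow> w \<notin> path_image (p i)" by auto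
  have "(\<Sum>i\<in>A. c i * contour_integral (p i) (\<lambda>z. f z * (z - w) / (z - w))) = 0"
    using Cauchy_theorem_polynomial_cycle[OF S A p(1-3) zero_p _ w, of "\<lambda>z. f z * (z - w)"] f
    by (simp add: holomorphic_intros)
  also have "(\<Sum>i\<in>A. c i * contour_integral (p i) (\<lambda>z. f z * (z - w) / (z - w)))
    = (\<Sum>i\<in>A. c i * contour_integral (p i) f)"
    using w by (intro sum.cong arg_cong2[where f="(*)"] contour_integral_eq) auto
  finally show ?thesis using p(4) f by simp
qed simp

section \<open>Existence of the oriented boundary\<close>

text \<open>\<open>M\<close> is the component of \<open>- K\<close> containing the curve. Two points
  of \<open>M\<close> on the same side are separated neither by the curve nor by \<open>- M\<close>;
  as these closed sets are disjoint, their union does not separate the points either.\<close>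

lemma simple_closed_curve_sides_connected:
  fixes \<gamma> :: "real \<Rightarrow> complex"
  assumes \<gamma>: "simple_path \<gamma>" "pathfinish \<gamma> = pathstart \<gamma>" and K: "closed K" "K \<inter> path_image \<gamma> = {}"
  obtains M where "open M" "path_image \<gamma> \<subseteq> M" "M \<inter> K = {}"
    "\<And>a b. a \<in> M \<inter> inside (path_image \<gamma>) \<Longrightarrow> b \<in> M \<inter> inside (path_image \<gamma>) \<Longrightarrow> connected_component (- (path_image \<gamma> \<union> K)) a b"
    "\<And>a b. a \<in> M \<inter> outside (path_image \<gamma>) \<Longrightarrow> b \<in> M \<inter> outside (path_image \<gamma>) \<Longrightarrow> connected_component (- (path_image \<gamma> \<union> K)) a b"
proof
  let ?g = "path_image \<gamma>" and ?p = "pathstart \<gamma>"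
  define M where "M = connected_component_set (- K) ?p"
  have conn: "connected ?g" and comp: "compact ?g"
    using \<gamma>(1) simple_path_imp_path by auto
  show "open M"
    unfolding M_def using K(1) by (metis open_Compl open_connected_component)
  show "M \<inter> K = {}"
    unfolding M_def by (auto dest: connected_component_in)
  show sub: "?g \<subseteq> M"
    unfolding M_def using conn K by (intro connected_component_maximal) auto
  have "connected M" by (simp add: M_def)
  have main: "connected_component (- (?g \<union> K)) a b"
    if "a \<in> M" "b \<in> M" "connected_component (- ?g) a b" for a b
  proof -
    have "?g \<inter> - M = {}" using sub by auto
    then have "connected_component (- (?g \<union> - M)) a b"
      using that \<open>connected M\<close> \<open>open M\<close> comp
      by (intro Janiszewski) (auto simp: connected_component_def)
    moreover have "- (?g \<union> - M) \<subseteq> - (?g \<union> K)" using \<open>M \<inter> K = {}\<close> by auto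
    ultimately show ?thesis using connected_component_of_subset by blast
  qed
  note J = Jordan_inside_outside[OF \<gamma>]
  have io: "inside ?g \<subseteq> - ?g" "outside ?g \<subseteq> - ?g"
    using inside_no_overlap outside_no_overlap by (metis disjoint_eq_subset_Compl)+
  show "connected_component (- (?g \<union> K)) a b" if "a \<in> M \<inter> inside ?g" "b \<in> M \<inter> inside ?g" for a b
    using J that io by (intro main) (auto simp: connected_component_def intro!: exI[of _ "inside ?g"])
  show "connected_component (- (?g \<union> K)) a b" if "a \<in> M \<inter> outside ?g" "b \<in> M \<inter> outside ?g" for a b
    using J that io by (intro main) (auto simp: connected_component_def intro!: exI[of _ "outside ?g"])
qed

text \<open>\<open>c \<gamma>\<close> is the jump of \<open>h\<close> at \<open>\<gamma>\<close>,
  inner value minus outer value. Once the jumps are subtracted, what remains extends to a locally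
  constant function on the whole plane that vanishes far out. The second conclusion limits the jumps
  when \<open>h\<close> takes few values.\<close>

lemma locally_constant_eq_sum_inside:
  fixes h :: "complex \<Rightarrow> int"
  assumes \<Gamma>: "jordan_family \<Gamma>"
    and const: "\<And>a b. connected_component (- (\<Union>\<gamma>\<in>\<Gamma>. path_image \<gamma>)) a b \<Longrightarrow> h a = h b"
    and R: "\<And>z. norm z > R \<Longrightarrow> h z = 0"
  obtains c a b where "\<And>z. z \<notin> (\<Union>\<gamma>\<in>\<Gamma>. path_image \<gamma>) \<Longrightarrow> h z = (\<Sum>\<gamma>\<in>\<Gamma>. if z \<in> inside (path_image \<gamma>) then c \<gamma> else 0)"
    "\<And>\<gamma>. \<gamma> \<in> \<Gamma> \<Longrightarrow> c \<gamma> = h (a \<gamma>) - h (b \<gamma>)"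
proof -
  define E where "E = (\<Union>\<gamma>\<in>\<Gamma>. path_image \<gamma>)"
  have fin: "finite \<Gamma>" and sp: "\<And>\<gamma>. \<gamma> \<in> \<Gamma> \<Longrightarrow> simple_path \<gamma>" "\<And>\<gamma>. \<gamma> \<in> \<Gamma> \<Longrightarrow> pathfinish \<gamma> = pathstart \<gamma>"
    and disj: "\<And>\<gamma> \<delta>. \<gamma> \<in> \<Gamma> \<Longrightarrow> \<delta> \<in> \<Gamma> \<Longrightarrow> \<gamma> \<noteq> \<delta> \<Longrightarrow> path_image \<gamma> \<inter> path_image \<delta> = {}"
    using \<Gamma> by (auto simp: jordan_family_def pairwise_def disjnt_def)
  have cl: "closed (path_image \<gamma>)" "compact (path_image \<gamma>)" if "\<gamma> \<in> \<Gamma>" for \<gamma>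
    using sp that by (auto intro: closed_path_image simple_path_imp_path)
  define P where "P \<gamma> M a b \<longleftrightarrow> open M \<and> path_image \<gamma> \<subseteq> M \<and> (\<forall>\<delta>\<in>\<Gamma>. \<delta> \<noteq> \<gamma> \<longrightarrow> M \<inter> path_image \<delta> = {}) \<and>
      (\<forall>x\<in>M. x \<in> inside (path_image \<gamma>) \<longrightarrow> h x = h a) \<and> (\<forall>x\<in>M. x \<in> outside (path_image \<gamma>) \<longrightarrow> h x = h b)"
    for \<gamma> M a b
  have "\<exists>M a b. P \<gamma> M a b" if \<gamma>: "\<gamma> \<in> \<Gamma>" for \<gamma>
  proof -
    define K where "K = (\<Union>\<delta>\<in>\<Gamma> - {\<gamma>}. path_image \<delta>)"
    have K: "closed K" "K \<inter> path_image \<gamma> = {}" and E: "path_image \<gamma> \<union> K = E"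
      using fin cl \<gamma> by (auto simp: K_def E_def dest: disj[OF \<gamma>])
    obtain M where M: "open M" "path_image \<gamma> \<subseteq> M" "M \<inter> K = {}"
    "\<And>a b. a \<in> M \<inter> inside (path_image \<gamma>) \<Longrightarrow> b \<in> M \<inter> inside (path_image \<gamma>) \<Longrightarrow> connected_component (- E) a b"
    "\<And>a b. a \<in> M \<inter> outside (path_image \<gamma>) \<Longrightarrow> b \<in> M \<inter> outside (path_image \<gamma>) \<Longrightarrow> connected_component (- E) a b"
      using simple_closed_curve_sides_connected[OF sp[OF \<gamma>] K] unfolding E by metis
    have "\<exists>a. \<forall>x\<in>M. x \<in> inside (path_image \<gamma>) \<longrightarrow> h x = h a"
      using M(4) const[folded E_def] by (metis IntI)
    moreover have "\<exists>b. \<forall>x\<in>M. x \<in> outside (path_image \<gamma>) \<longrightarrow> h x = h b"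
      using M(5) const[folded E_def] by (metis IntI)
    moreover have "\<forall>\<delta>\<in>\<Gamma>. \<delta> \<noteq> \<gamma> \<longrightarrow> M \<inter> path_image \<delta> = {}"
      using M(3) by (auto simp: K_def)
    ultimately show ?thesis using M(1,2) unfolding P_def by blast
  qed
  then obtain M a b where P: "\<And>\<gamma>. \<gamma> \<in> \<Gamma> \<Longrightarrow> P \<gamma> (M \<gamma>) (a \<gamma>) (b \<gamma>)"
    by metis
  have M: "open (M \<gamma>)" "path_image \<gamma> \<subseteq> M \<gamma>" "\<And>\<delta>. \<delta> \<in> \<Gamma> \<Longrightarrow> \<delta> \<noteq> \<gamma> \<Longrightarrow> M \<gamma> \<inter> path_image \<delta> = {}"
      "\<And>x. x \<in> M \<gamma> \<Longrightarrow> x \<in> inside (path_image \<gamma>) \<Longrightarrow> h x = h (a \<gamma>)"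
      "\<And>x. x \<in> M \<gamma> \<Longrightarrow> x \<in> outside (path_image \<gamma>) \<Longrightarrow> h x = h (b \<gamma>)" if "\<gamma> \<in> \<Gamma>" for \<gamma>
    using P[OF that] by (simp_all add: P_def)
  define c where "c \<gamma> = h (a \<gamma>) - h (b \<gamma>)" for \<gamma>
  define ind where "ind \<gamma> z = (if z \<in> inside (path_image \<gamma>) then c \<gamma> else 0)" for \<gamma> z
  \<comment> \<open>\<open>\<psi>\<close> takes the value from the outer side on each curve, which makes it locally constant across the curves.\<close>
  define \<psi> where "\<psi> z = (if z \<in> E then h (b (THE \<gamma>. \<gamma> \<in> \<Gamma> \<and> z \<in> path_image \<gamma>)) else h z) - (\<Sum>\<gamma>\<in>\<Gamma>. ind \<gamma> z)" for z
  have ind_const: "ind \<delta> w = ind \<delta> z" if "\<delta> \<in> \<Gamma>" "ball z e \<inter> path_image \<delta> = {}" "w \<in> ball z e" for \<delta> z w e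
  proof -
    have "connected_component (- path_image \<delta>) z w"
      unfolding connected_component_def using that
      by (intro exI[of _ "ball z e"]) (auto intro: le_less_trans[OF zero_le_dist])
    then show ?thesis
      unfolding ind_def by (metis inside_same_component connected_component_sym)
  qed
  have loc: "\<exists>e>0. \<forall>w\<in>ball z e. \<psi> w = \<psi> z" for z
  proof (cases "z \<in> E")
    case False
    have "open (- E)" using fin cl by (auto simp: E_def)
    then obtain e where e: "e > 0" "ball z e \<subseteq> - E" using False by (meson ComplI open_contains_ball)
    have "\<psi> w = \<psi> z" if w: "w \<in> ball z e" for w
    proof -
      have "connected_component (- E) w z"
        unfolding connected_component_def using e w by (intro exI[of _ "ball z e"]) auto
      then have "h w = h z" using const[folded E_def] by blast
      moreover have "(\<Sum>\<gamma>\<in>\<Gamma>. ind \<gamma> w) = (\<Sum>\<gamma>\<in>\<Gamma>. ind \<gamma> z)"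
        using e w by (intro sum.cong refl ind_const[of _ _ e]) (auto simp: E_def)
      moreover have "w \<notin> E" using e w by auto
      ultimately show ?thesis using False by (simp add: \<psi>_def)
    qed
    then show ?thesis using e(1) by blast
  next
    case True
    then obtain \<gamma> where \<gamma>: "\<gamma> \<in> \<Gamma>" "z \<in> path_image \<gamma>" by (auto simp: E_def)
    have the: "(THE \<gamma>. \<gamma> \<in> \<Gamma> \<and> w \<in> path_image \<gamma>) = \<gamma>" if "w \<in> path_image \<gamma>" for w
      using disj \<gamma>(1) that by (intro the_equality) auto
    obtain e where e: "e > 0" "ball z e \<subseteq> M \<gamma>"
      using M(1,2)[OF \<gamma>(1)] \<gamma>(2) by (meson open_contains_ball subsetD)
    \<comment> \<open>Near \<open>z\<close> only its own curve is present: the other indicators are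
      constant, and \<open>ind \<gamma>\<close> cancels the jump of \<open>h\<close>.\<close>
    have "\<psi> w = h (b \<gamma>) - (\<Sum>\<delta>\<in>\<Gamma> - {\<gamma>}. ind \<delta> z)" if w: "w \<in> ball z e" for w
    proof -
      have wM: "w \<in> M \<gamma>" using e w by auto
      have "(\<Sum>\<delta>\<in>\<Gamma> - {\<gamma>}. ind \<delta> w) = (\<Sum>\<delta>\<in>\<Gamma> - {\<gamma>}. ind \<delta> z)"
        using e w M(3)[OF \<gamma>(1)] by (intro sum.cong refl ind_const[of _ _ e]) auto
      then have s: "(\<Sum>\<delta>\<in>\<Gamma>. ind \<delta> w) = ind \<gamma> w + (\<Sum>\<delta>\<in>\<Gamma> - {\<gamma>}. ind \<delta> z)"
        using fin \<gamma>(1) by (simp add: sum.remove)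
      have nE: "w \<notin> E" if "w \<notin> path_image \<gamma>"
        using that M(3)[OF \<gamma>(1)] wM by (auto simp: E_def)
      consider "w \<in> path_image \<gamma>" | "w \<in> inside (path_image \<gamma>)" "w \<notin> path_image \<gamma>"
        | "w \<in> outside (path_image \<gamma>)" "w \<notin> path_image \<gamma>" "w \<notin> inside (path_image \<gamma>)"
        using inside_Un_outside[of "path_image \<gamma>"] inside_no_overlap outside_no_overlap by blast
      then show ?thesis
      proof cases
        case 1
        then have "w \<notin> inside (path_image \<gamma>)" "w \<in> E"
          using \<gamma>(1) by (auto simp: E_def) (metis IntI empty_iff inside_no_overlap)
        then show ?thesis using s the[OF 1] by (simp add: \<psi>_def ind_def)
      next
        case 2
        then show ?thesis using s nE M(4)[OF \<gamma>(1) wM] by (simp add: \<psi>_def ind_def c_def)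
      next
        case 3
        then show ?thesis using s nE M(5)[OF \<gamma>(1) wM] by (simp add: \<psi>_def ind_def)
      qed
    qed
    then show ?thesis using e(1) by (metis centre_in_ball)
  qed
  have "\<psi> constant_on UNIV"
  proof (rule locally_constant_imp_constant)
    show "\<exists>T. openin (top_of_set UNIV) T \<and> z \<in> T \<and> (\<forall>x\<in>T. \<psi> x = \<psi> z)" for z
      using loc[of z] by (metis centre_in_ball open_ball open_openin subtopology_UNIV)
  qed (rule connected_UNIV)
  moreover have "\<exists>z. \<psi> z = 0"
  proof -
    have "bounded (E \<union> (\<Union>\<gamma>\<in>\<Gamma>. inside (path_image \<gamma>)) \<union> cball 0 R)"
      using fin cl Jordan_inside_outside[OF sp] by (auto simp: E_def compact_imp_bounded)
    then obtain z where "z \<notin> E \<union> (\<Union>\<gamma>\<in>\<Gamma>. inside (path_image \<gamma>)) \<union> cball 0 R"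
      using not_bounded_UNIV by (metis UNIV_I UNIV_eq_I)
    then show ?thesis using R[of z] by (intro exI[of _ z]) (auto simp: \<psi>_def ind_def)
  qed
  ultimately have \<psi>0: "\<psi> z = 0" for z
    by (metis UNIV_I constant_on_def)
  have "h z = (\<Sum>\<gamma>\<in>\<Gamma>. ind \<gamma> z)" if "z \<notin> E" for z
    using \<psi>0[of z] that by (simp add: \<psi>_def)
  then show thesis
    by (intro that[of c a b]) (simp_all add: E_def ind_def c_def)
qed

text \<open>A curve with jump \<open>0\<close> has \<open>\<Omega>\<close> on both sides and is
  dropped; the remaining jumps are \<open>1\<close> on outer and \<open>-1\<close> on inner
  boundaries, and they prescribe the orientation.\<close>

theorem oriented_boundary_exists:
  assumes \<Omega>: "open \<Omega>" "bounded \<Omega>" and \<Gamma>: "jordan_family \<Gamma>" "frontier \<Omega> = (\<Union>\<gamma>\<in>\<Gamma>. path_image \<gamma>)"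
  shows "\<exists>\<Gamma>'. oriented_boundary \<Omega> \<Gamma>'"
proof -
  define h :: "complex \<Rightarrow> int" where "h z = (if z \<in> \<Omega> then 1 else 0)" for z
  have h: "h a = h b" if ab: "connected_component (- (\<Union>\<gamma>\<in>\<Gamma>. path_image \<gamma>)) a b" for a b
  proof -
    obtain C where C: "connected C" "C \<subseteq> - frontier \<Omega>" "a \<in> C" "b \<in> C"
      using ab \<Gamma>(2) by (auto simp: connected_component_def)
    then have "C \<inter> \<Omega> = {} \<or> C - \<Omega> = {}"
      using connected_Int_frontier[of C \<Omega>] by blast
    then show ?thesis using C(3,4) by (auto simp: h_def)
  qed
  obtain R where R: "\<And>z. norm z > R \<Longrightarrow> h z = 0"
    using \<Omega>(2) unfolding h_def bounded_iff by (metis linorder_not_less)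
  obtain c a b where c: "\<And>z. z \<notin> frontier \<Omega> \<Longrightarrow> h z = (\<Sum>\<gamma>\<in>\<Gamma>. if z \<in> inside (path_image \<gamma>) then c \<gamma> else 0)"
    and cab: "\<And>\<gamma>. \<gamma> \<in> \<Gamma> \<Longrightarrow> c \<gamma> = h (a \<gamma>) - h (b \<gamma>)"
  proof (rule locally_constant_eq_sum_inside[OF \<Gamma>(1) h R])
    show thesis
      if "\<And>z. z \<notin> (\<Union>\<gamma>\<in>\<Gamma>. path_image \<gamma>) \<Longrightarrow> h z = (\<Sum>\<gamma>\<in>\<Gamma>. if z \<in> inside (path_image \<gamma>) then c \<gamma> else 0)"
        "\<And>\<gamma>. \<gamma> \<in> \<Gamma> \<Longrightarrow> c \<gamma> = h (a \<gamma>) - h (b \<gamma>)"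
        "\<And>c a b. (\<And>z. z \<notin> frontier \<Omega> \<Longrightarrow> h z = (\<Sum>\<gamma>\<in>\<Gamma>. if z \<in> inside (path_image \<gamma>) then c \<gamma> else 0)) \<Longrightarrow>
          (\<And>\<gamma>. \<gamma> \<in> \<Gamma> \<Longrightarrow> c \<gamma> = h (a \<gamma>) - h (b \<gamma>)) \<Longrightarrow> thesis" for c a b
      using that(3)[OF that(1)[folded \<Gamma>(2)] that(2)] .
  qed
  have c_cases: "c \<gamma> \<in> {-1, 0, 1}" if "\<gamma> \<in> \<Gamma>" for \<gamma>
    using cab[OF that] by (simp add: h_def)
  have fin: "finite \<Gamma>" and sp: "\<And>\<gamma>. \<gamma> \<in> \<Gamma> \<Longrightarrow> valid_path \<gamma>" "\<And>\<gamma>. \<gamma> \<in> \<Gamma> \<Longrightarrow> simple_path \<gamma>"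
      "\<And>\<gamma>. \<gamma> \<in> \<Gamma> \<Longrightarrow> pathfinish \<gamma> = pathstart \<gamma>"
    and disj: "\<And>\<gamma> \<delta>. \<gamma> \<in> \<Gamma> \<Longrightarrow> \<delta> \<in> \<Gamma> \<Longrightarrow> \<gamma> \<noteq> \<delta> \<Longrightarrow> path_image \<gamma> \<inter> path_image \<delta> = {}"
    using \<Gamma>(1) by (auto simp: jordan_family_def pairwise_def disjnt_def)
  \<comment> \<open>A simple closed curve winds \<open>1\<close> or \<open>-1\<close> times around
    its inside; reversal where necessary makes this number equal to a nonzero
    \<open>c \<gamma>\<close>.\<close>
  define p where "p \<gamma> = (if \<forall>z\<in>inside (path_image \<gamma>). winding_number \<gamma> z = of_int (c \<gamma>) then \<gamma> else reversepath \<gamma>)" for \<gamma>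
  define \<Gamma>' where "\<Gamma>' = p ` {\<gamma>\<in>\<Gamma>. c \<gamma> \<noteq> 0}"
  have p: "valid_path (p \<gamma>)" "simple_path (p \<gamma>)" "pathfinish (p \<gamma>) = pathstart (p \<gamma>)" "path_image (p \<gamma>) = path_image \<gamma>"
    if "\<gamma> \<in> \<Gamma>" for \<gamma>
    using sp[OF that] by (auto simp: p_def simple_path_reversepath)
  \<comment> \<open>Reversal preserves images, and distinct curves have disjoint nonempty ones:
    \<open>p\<close> is injective, so no winding number is lost in the sum over
    \<open>\<Gamma>'\<close>.\<close>
  have "path_image \<gamma> \<noteq> {}" for \<gamma> :: "real \<Rightarrow> complex" by simp
  then have inj: "inj_on p \<Gamma>"
    by (metis disj inf.idem inj_onI p(4))
  have wn: "winding_number (p \<gamma>) z = of_int (if z \<in> inside (path_image \<gamma>) then c \<gamma> else 0)"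
    if \<gamma>: "\<gamma> \<in> \<Gamma>" "c \<gamma> \<noteq> 0" and z: "z \<notin> frontier \<Omega>" for \<gamma> z
  proof -
    have z': "z \<notin> path_image \<gamma>" using \<gamma> z \<Gamma>(2) by auto
    have rev: "winding_number (reversepath \<gamma>) z = - winding_number \<gamma> z"
      using winding_number_reversepath z' sp \<gamma>(1) simple_path_imp_path by blast
    consider "z \<in> inside (path_image \<gamma>)" | "z \<in> outside (path_image \<gamma>)" "z \<notin> inside (path_image \<gamma>)"
      using inside_Un_outside[of "path_image \<gamma>"] z' by blast
    then show ?thesis
    proof cases
      case 1
      have "(\<forall>z\<in>inside (path_image \<gamma>). winding_number \<gamma> z = 1) \<or> (\<forall>z\<in>inside (path_image \<gamma>). winding_number \<gamma> z = -1)"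
        using simple_closed_path_winding_number_inside[OF sp(2)[OF \<gamma>(1)]] by metis
      then show ?thesis
        using c_cases[OF \<gamma>(1)] \<gamma>(2) 1 rev by (auto simp: p_def)
    next
      case 2
      have "winding_number \<gamma> z = 0"
        using winding_number_zero_in_outside sp \<gamma>(1) 2(1) simple_path_imp_path by blast
      then show ?thesis using 2 rev by (simp add: p_def)
    qed
  qed
  have sum: "(\<Sum>\<gamma>\<in>\<Gamma>'. winding_number \<gamma> z) = of_int (h z)" if z: "z \<notin> frontier \<Omega>" for z
  proof -
    have "(\<Sum>\<gamma>\<in>\<Gamma>'. winding_number \<gamma> z) = (\<Sum>\<gamma>\<in>{\<gamma>\<in>\<Gamma>. c \<gamma> \<noteq> 0}. winding_number (p \<gamma>) z)"
      unfolding \<Gamma>'_def using inj by (subst sum.reindex) (auto intro: inj_on_subset)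
    also have "\<dots> = (\<Sum>\<gamma>\<in>{\<gamma>\<in>\<Gamma>. c \<gamma> \<noteq> 0}. of_int (if z \<in> inside (path_image \<gamma>) then c \<gamma> else 0))"
      using wn z by (intro sum.cong) auto
    also have "\<dots> = (\<Sum>\<gamma>\<in>\<Gamma>. of_int (if z \<in> inside (path_image \<gamma>) then c \<gamma> else 0))"
      using fin by (intro sum.mono_neutral_left) auto
    finally show ?thesis using c[OF z] by simp
  qed
  have "\<gamma> = \<delta>" if "\<gamma> \<in> \<Gamma>" "\<delta> \<in> \<Gamma>" "z \<in> path_image \<gamma>" "z \<in> path_image \<delta>" for \<gamma> \<delta> z
    using disj that by blast
  then have "jordan_family \<Gamma>'"
    using fin p by (auto simp: jordan_family_def \<Gamma>'_def pairwise_def disjnt_def)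
  moreover have "(\<Union>\<gamma>\<in>\<Gamma>'. path_image \<gamma>) \<subseteq> frontier \<Omega>"
    using p(4) \<Gamma>(2) by (auto simp: \<Gamma>'_def)
  moreover have "z \<notin> frontier \<Omega>" if "z \<in> \<Omega> \<or> z \<notin> closure \<Omega>" for z
    using that \<Omega>(1) by (auto simp: frontier_def interior_open)
  ultimately show ?thesis
    using sum closure_subset[of \<Omega>] by (intro exI[of _ \<Gamma>']) (auto simp: oriented_boundary_def h_def)
qed

section \<open>Holomorphic functions with values in a Banach space with a complex structure\<close>

locale complex_structure =
  fixes J :: "'b::banach \<Rightarrow> 'b"
  assumes bounded_linear_J: "bounded_linear J" and J_J: "J (J x) = - x"
begin

definition cscale :: "complex \<Rightarrow> 'b \<Rightarrow> 'b" where
  "cscale z x = Re z *\<^sub>R x + Im z *\<^sub>R J x"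

definition holo :: "complex set \<Rightarrow> (complex \<Rightarrow> 'b) \<Rightarrow> bool" where
  "holo S G \<longleftrightarrow> (\<exists>G'. \<forall>z\<in>S. (G has_derivative (\<lambda>h. cscale h (G' z))) (at z))"

definition path_int :: "(real \<Rightarrow> complex) \<Rightarrow> (complex \<Rightarrow> 'b) \<Rightarrow> 'b" where
  "path_int \<gamma> G = integral {0..1} (\<lambda>t. cscale (vector_derivative \<gamma> (at t within {0..1})) (G (\<gamma> t)))"

text \<open>The complex-linear functional with real part \<open>\<phi>\<close>; it reduces
  vector-valued holomorphy to the scalar case.\<close>

definition complex_functional :: "('b \<Rightarrow> real) \<Rightarrow> 'b \<Rightarrow> complex" where
  "complex_functional \<phi> x = Complex (\<phi> x) (- \<phi> (J x))"

lemmas J_simps = linear_add[OF bounded_linear.linear[OF bounded_linear_J]]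
  linear_scale[OF bounded_linear.linear[OF bounded_linear_J]] linear_neg[OF bounded_linear.linear[OF bounded_linear_J]]
  linear_diff[OF bounded_linear.linear[OF bounded_linear_J]] linear_0[OF bounded_linear.linear[OF bounded_linear_J]]

lemma bounded_bilinear_cscale: "bounded_bilinear cscale"
proof
  obtain K where K: "K \<ge> 0" "\<And>x. norm (J x) \<le> norm x * K"
    using bounded_linear.nonneg_bounded[OF bounded_linear_J] by auto
  have "norm (cscale z x) \<le> norm z * norm x * (1 + K)" for z x
  proof -
    have "norm (cscale z x) \<le> \<bar>Re z\<bar> * norm x + \<bar>Im z\<bar> * norm (J x)"
      unfolding cscale_def by (rule order_trans[OF norm_triangle_ineq]) simp
    also have "\<dots> \<le> norm z * norm x + norm z * (norm x * K)"
      using K abs_Re_le_cmod abs_Im_le_cmod by (intro add_mono mult_mono) auto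
    finally show ?thesis by (simp add: algebra_simps)
  qed
  then show "\<exists>K. \<forall>a b. norm (cscale a b) \<le> norm a * norm b * K" by blast
qed (simp_all add: cscale_def J_simps algebra_simps)

lemma cscale_mult: "cscale (z * w) x = cscale z (cscale w x)"
  by (simp add: cscale_def J_simps J_J algebra_simps)

lemma cscale_1 [simp]: "cscale 1 x = x"
  by (simp add: cscale_def)

lemma bounded_linear_complex_functional:
  assumes "bounded_linear \<phi>"
  shows "bounded_linear (complex_functional \<phi>)"
proof -
  have "bounded_linear (\<lambda>x. of_real (\<phi> x) - \<i> * of_real (\<phi> (J x)))"
    by (intro bounded_linear_sub bounded_linear_const_mult bounded_linear_compose[OF bounded_linear_of_real]
      bounded_linear_compose[OF assms bounded_linear_J] assms)
  moreover have "complex_functional \<phi> = (\<lambda>x. of_real (\<phi> x) - \<i> * of_real (\<phi> (J x)))"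
    by (auto simp: complex_functional_def complex_eq_iff fun_eq_iff)
  ultimately show ?thesis by simp
qed

lemma complex_functional_cscale:
  assumes "bounded_linear \<phi>"
  shows "complex_functional \<phi> (cscale z x) = z * complex_functional \<phi> x"
proof -
  note [simp] = linear_add[OF bounded_linear.linear[OF assms]] linear_scale[OF bounded_linear.linear[OF assms]]
    linear_neg[OF bounded_linear.linear[OF assms]] linear_diff[OF bounded_linear.linear[OF assms]]
  show ?thesis
    by (simp add: complex_functional_def cscale_def J_simps J_J complex_eq_iff)
qed

section \<open>Complex differentiability of vector-valued functions\<close>

lemma holo_complex_functional:
  assumes "bounded_linear \<phi>" "holo S G"
  shows "(\<lambda>z. complex_functional \<phi> (G z)) holomorphic_on S"
proof -
  obtain G' where G': "\<And>z. z \<in> S \<Longrightarrow> (G has_derivative (\<lambda>h. cscale h (G' z))) (at z)"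
    using assms(2) by (auto simp: holo_def)
  have "((\<lambda>z. complex_functional \<phi> (G z)) has_derivative (\<lambda>h. complex_functional \<phi> (cscale h (G' z)))) (at z)"
    if "z \<in> S" for z
    using bounded_linear.has_derivative[OF bounded_linear_complex_functional[OF assms(1)] G'[OF that]] .
  then have "((\<lambda>z. complex_functional \<phi> (G z)) has_field_derivative complex_functional \<phi> (G' z)) (at z)"
    if "z \<in> S" for z
    using that by (simp add: has_field_derivative_def complex_functional_cscale[OF assms(1)] mult_commute_abs)
  then show ?thesis
    unfolding holomorphic_on_def field_differentiable_def using has_field_derivative_at_within by blast
qed

text \<open>Remainder and difference quotient differ by the factor \<open>w - z\<close>, and
  multiplication by it or its inverse distorts norms by a bounded amount only. The quotient form is
  the one suited to differentiating an inverse.\<close>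

lemma has_derivative_cscale_iff:
  "(G has_derivative (\<lambda>h. cscale h y)) (at z) \<longleftrightarrow> ((\<lambda>w. cscale (inverse (w - z)) (G w - G z)) \<longlongrightarrow> y) (at z)"
proof -
  interpret cs: bounded_bilinear cscale by (rule bounded_bilinear_cscale)
  obtain K where K: "K > 0" "\<And>c x. norm (cscale c x) \<le> norm c * norm x * K"
    using cs.pos_bounded by auto
  define D where "D w = G w - G z - cscale (w - z) y" for w
  define q where "q w = cscale (inverse (w - z)) (G w - G z) - y" for w
  have Dq: "D w = cscale (w - z) (q w)" "q w = cscale (inverse (w - z)) (D w)" if "w \<noteq> z" for w
    using that by (simp_all add: D_def q_def cs.diff_right flip: cscale_mult)
  have "((\<lambda>w. norm (D w) / norm (w - z)) \<longlongrightarrow> 0) (at z) \<longleftrightarrow> (q \<longlongrightarrow> 0) (at z)"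
  proof
    assume lim: "((\<lambda>w. norm (D w) / norm (w - z)) \<longlongrightarrow> 0) (at z)"
    have bound: "norm (q w) \<le> norm (D w) / norm (w - z) * K" if "w \<noteq> z" for w
      using K(2)[of "inverse (w - z)" "D w"] Dq(2)[OF that] by (simp add: norm_inverse divide_inverse mult_ac)
    show "(q \<longlongrightarrow> 0) (at z)"
      by (rule Lim_null_comparison[OF eventually_mono[OF eventually_neq_at_within bound]
            tendsto_mult_left_zero[OF lim, of K]])
  next
    assume lim: "(q \<longlongrightarrow> 0) (at z)"
    have bound: "norm (norm (D w) / norm (w - z)) \<le> norm (q w) * K" if "w \<noteq> z" for w
      using K(2)[of "w - z" "q w"] Dq(1)[OF that] that by (simp add: field_simps)
    show "((\<lambda>w. norm (D w) / norm (w - z)) \<longlongrightarrow> 0) (at z)"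
      by (rule Lim_null_comparison[OF eventually_mono[OF eventually_neq_at_within bound]
            tendsto_mult_left_zero[OF tendsto_norm_zero[OF lim], of K]])
  qed
  moreover have "(G has_derivative (\<lambda>h. cscale h y)) (at z) \<longleftrightarrow> ((\<lambda>w. norm (D w) / norm (w - z)) \<longlongrightarrow> 0) (at z)"
    by (simp add: has_derivative_iff_norm cs.bounded_linear_left D_def)
  moreover have "(q \<longlongrightarrow> 0) (at z) \<longleftrightarrow> ((\<lambda>w. cscale (inverse (w - z)) (G w - G z)) \<longlongrightarrow> y) (at z)"
    unfolding q_def by (rule LIM_zero_iff)
  ultimately show ?thesis by simp
qed

lemma holo_subset: "holo S G \<Longrightarrow> T \<subseteq> S \<Longrightarrow> holo T G"
  unfolding holo_def by blast

lemma holo_const: "holo S (\<lambda>_. x)"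
proof -
  interpret cs: bounded_bilinear cscale by (rule bounded_bilinear_cscale)
  show ?thesis unfolding holo_def by (intro exI[of _ "\<lambda>_. 0"]) (simp add: cs.zero_right)
qed

lemma holo_add: "holo S F \<Longrightarrow> holo S G \<Longrightarrow> holo S (\<lambda>z. F z + G z)"
proof -
  interpret cs: bounded_bilinear cscale by (rule bounded_bilinear_cscale)
  assume "holo S F" "holo S G"
  then obtain F' G' where "\<forall>z\<in>S. (F has_derivative (\<lambda>h. cscale h (F' z))) (at z)"
     "\<forall>z\<in>S. (G has_derivative (\<lambda>h. cscale h (G' z))) (at z)"
    by (auto simp: holo_def)
  then show ?thesis
    unfolding holo_def by (intro exI[of _ "\<lambda>z. F' z + G' z"]) (auto simp: cs.add_right intro: has_derivative_add)
qed

lemma holo_cscale: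
  assumes S: "open S" and f: "f holomorphic_on S" and G: "holo S G"
  shows "holo S (\<lambda>z. cscale (f z) (G z))"
proof -
  interpret cs: bounded_bilinear cscale by (rule bounded_bilinear_cscale)
  obtain G' where G': "\<And>z. z \<in> S \<Longrightarrow> (G has_derivative (\<lambda>h. cscale h (G' z))) (at z)"
    using G by (auto simp: holo_def)
  have "((\<lambda>z. cscale (f z) (G z)) has_derivative (\<lambda>h. cscale h (cscale (f z) (G' z) + cscale (deriv f z) (G z)))) (at z)"
    if z: "z \<in> S" for z
  proof -
    have "(f has_derivative (*) (deriv f z)) (at z)"
      using holomorphic_derivI[OF f S z] by (simp add: has_field_derivative_def)
    from cs.FDERIV[OF this G'[OF z]] show ?thesis
      by (simp add: cs.add_right mult_ac flip: cscale_mult)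
  qed
  then show ?thesis
    unfolding holo_def by (intro exI[of _ "\<lambda>z. cscale (f z) (G' z) + cscale (deriv f z) (G z)"]) blast
qed

section \<open>Primitives and path integrals\<close>

lemma holo_continuous_on: "holo S G \<Longrightarrow> continuous_on S G"
  unfolding holo_def by (meson continuous_at_imp_continuous_on has_derivative_continuous)

text \<open>The primitive integrates along segments from the centre. Additivity over triangles is
  checked after applying functionals, where scalar primitives exist; the derivative then follows
  from continuity of \<open>G\<close>.\<close>

lemma holo_local_primitive:
  assumes G: "holo (ball z0 r) G"
  obtains P where "\<And>z. z \<in> ball z0 r \<Longrightarrow> (P has_derivative (\<lambda>h. cscale h (G z))) (at z)"
proof -
  interpret cs: bounded_bilinear cscale by (rule bounded_bilinear_cscale)
  note contG = holo_continuous_on[OF G]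
  define L where "L a b = integral {0..1} (\<lambda>t. cscale (b - a) (G (linepath a b t)))" for a b
  have seg: "linepath a b t \<in> ball z0 r" if "a \<in> ball z0 r" "b \<in> ball z0 r" "t \<in> {0..1}" for a b t
    using that closed_segment_subset[OF that(1,2) convex_ball] linepath_in_path by (metis subsetD)
  have contGl: "continuous_on {0..1} (\<lambda>t. G (linepath a b t))" if "a \<in> ball z0 r" "b \<in> ball z0 r" for a b
    using seg[OF that] by (intro continuous_on_compose2[OF contG] continuous_on_linepath) auto
  have L_has: "((\<lambda>t. cscale (b - a) (G (linepath a b t))) has_integral L a b) {0..1}"
    if "a \<in> ball z0 r" "b \<in> ball z0 r" for a b
    unfolding L_def
    by (intro integrable_integral integrable_continuous_real cs.continuous_on continuous_on_const contGl that)
  have L_add: "L a c = L a b + L b c" if abc: "a \<in> ball z0 r" "b \<in> ball z0 r" "c \<in> ball z0 r" for a b c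
  proof (rule eq_by_functionals)
    fix \<phi> :: "'b \<Rightarrow> real" assume \<phi>: "bounded_linear \<phi>"
    let ?F = "\<lambda>z. complex_functional \<phi> (G z)"
    obtain g where g: "\<And>z. z \<in> ball z0 r \<Longrightarrow> (g has_field_derivative ?F z) (at z within ball z0 r)"
      using holomorphic_convex_primitive'[OF convex_ball open_ball holo_complex_functional[OF \<phi> G]] by blast
    have "complex_functional \<phi> (L a b) = g b - g a" if ab: "a \<in> ball z0 r" "b \<in> ball z0 r" for a b
    proof -
      have "((\<lambda>t. complex_functional \<phi> (cscale (b - a) (G (linepath a b t)))) has_integral complex_functional \<phi> (L a b)) {0..1}"
        using has_integral_linear[OF L_has[OF ab] bounded_linear_complex_functional[OF \<phi>]] by (simp add: o_def)
      then have "(?F has_contour_integral complex_functional \<phi> (L a b)) (linepath a b)"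
        by (simp add: has_contour_integral_linepath complex_functional_cscale[OF \<phi>] mult.commute)
      moreover have "(?F has_contour_integral (g b - g a)) (linepath a b)"
        using contour_integral_primitive[of "ball z0 r" g ?F "linepath a b"] g ab
          closed_segment_subset[OF ab convex_ball] by simp
      ultimately show ?thesis using has_contour_integral_unique by blast
    qed
    then have "complex_functional \<phi> (L a c) = complex_functional \<phi> (L a b + L b c)"
      using abc by (simp add: linear_add[OF bounded_linear.linear[OF bounded_linear_complex_functional[OF \<phi>]]])
    then show "\<phi> (L a c) = \<phi> (L a b + L b c)"
      by (simp add: complex_functional_def)
  qed
  have deriv: "(L z0 has_derivative (\<lambda>h. cscale h (G z))) (at z)" if z: "z \<in> ball z0 r" for z
    unfolding has_derivative_at_alt
  proof (intro conjI allI impI)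
    show "bounded_linear (\<lambda>h. cscale h (G z))" by (rule cs.bounded_linear_left)
    fix e :: real assume e: "e > 0"
    obtain K where K: "K > 0" "\<And>z x. norm (cscale z x) \<le> norm z * norm x * K"
      using cs.pos_bounded by auto
    have "isCont G z" using contG z by (simp add: continuous_on_eq_continuous_at)
    then obtain d1 where d1: "d1 > 0" "\<And>w. dist w z < d1 \<Longrightarrow> dist (G w) (G z) < e / K"
      unfolding continuous_at_eps_delta using e K(1) by (metis divide_pos_pos)
    obtain d2 where d2: "d2 > 0" "ball z d2 \<subseteq> ball z0 r"
      using z by (meson open_ball open_contains_ball)
    have "norm (L z0 w - L z0 z - cscale (w - z) (G z)) \<le> e * norm (w - z)" if w: "norm (w - z) < min d1 d2" for w
    proof -
      have "w \<in> ball z d2" using w by (simp add: dist_norm norm_minus_commute)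
      then have wB: "w \<in> ball z0 r" using d2(2) by blast
      have z0B: "z0 \<in> ball z0 r" using z by (auto intro: le_less_trans[OF zero_le_dist])
      have "((\<lambda>t. cscale (w - z) (G (linepath z w t)) - cscale (w - z) (G z)) has_integral
          L z w - cscale (w - z) (G z)) {0..1}"
        using has_integral_diff[OF L_has[OF z wB] has_integral_const_real[of "cscale (w - z) (G z)" 0 1]] by simp
      then have "L z w - cscale (w - z) (G z) = integral {0..1} (\<lambda>t. cscale (w - z) (G (linepath z w t) - G z))"
        by (simp add: cs.diff_right integral_unique)
      also have "norm \<dots> \<le> (norm (w - z) * e) * (1 - 0)"
      proof (rule integral_bound)
        show "continuous_on {0..1} (\<lambda>t. cscale (w - z) (G (linepath z w t) - G z))"
          by (intro cs.continuous_on continuous_intros contGl z wB)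
        show "norm (cscale (w - z) (G (linepath z w t) - G z)) \<le> norm (w - z) * e" if t: "t \<in> {0..1}" for t
        proof -
          have "dist (linepath z w t) z \<le> norm (w - z)"
            using t by (simp add: linepath_def dist_norm scaleR_diff_left scaleR_diff_right algebra_simps mult_left_le_one_le
              flip: scaleR_diff_right)
          then have "norm (G (linepath z w t) - G z) \<le> e / K"
            using d1(2)[of "linepath z w t"] w by (simp add: dist_norm)
          then have "norm (w - z) * norm (G (linepath z w t) - G z) * K \<le> norm (w - z) * (e / K) * K"
            using K(1) by (intro mult_right_mono mult_left_mono) auto
          then show ?thesis using K order_trans by fastforce
        qed
      qed simp
      finally show ?thesis using L_add[OF z0B z wB] by (simp add: algebra_simps)
    qed
    then show "\<exists>d>0. \<forall>y. norm (y - z) < d \<longrightarrow> norm (L z0 y - L z0 z - cscale (y - z) (G z)) \<le> e * norm (y - z)"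
      using d1(1) d2(1) by (intro exI[of _ "min d1 d2"]) auto
  qed
  then show thesis by (rule that)
qed

text \<open>The speed of a valid path may be unbounded near its finitely many exceptional points.
  Locally, however, the integrand is off a finite set the derivative of a continuous function, a
  primitive composed with the path, and the fundamental theorem for the gauge integral
  applies.\<close>

lemma holo_path_integrable:
  assumes \<gamma>: "valid_path \<gamma>" "path_image \<gamma> \<subseteq> S" and S: "open S" and G: "holo S G"
  shows "(\<lambda>t. cscale (vector_derivative \<gamma> (at t within {0..1})) (G (\<gamma> t))) integrable_on {0..1}"
proof -
  let ?f = "\<lambda>t. cscale (vector_derivative \<gamma> (at t within {0..1})) (G (\<gamma> t))"
  have cont: "continuous_on {0..1} \<gamma>" using \<gamma>(1) valid_path_imp_path path_def by blast
  obtain F D where F: "finite F" and D: "\<And>t. t \<in> {0..1} - F \<Longrightarrow> (\<gamma> has_vector_derivative D t) (at t)"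
    using \<gamma>(1) unfolding valid_path_def piecewise_C1_differentiable_on_def C1_differentiable_on_def by blast
  have "\<exists>d>0. \<forall>u v. t \<in> cbox u v \<and> cbox u v \<subseteq> ball t d \<and> cbox u v \<subseteq> cbox 0 1 \<longrightarrow> ?f integrable_on cbox u v"
    if t: "t \<in> cbox 0 1" for t
  proof -
    have "\<gamma> t \<in> S" using t \<gamma>(2) by (auto simp: path_image_def)
    then obtain r where r: "r > 0" "ball (\<gamma> t) r \<subseteq> S" using S by (meson open_contains_ball)
    then have "holo (ball (\<gamma> t) r) G" using G unfolding holo_def by blast
    then obtain P where P: "\<And>z. z \<in> ball (\<gamma> t) r \<Longrightarrow> (P has_derivative (\<lambda>h. cscale h (G z))) (at z)"
      using holo_local_primitive by blast
    obtain d where d: "d > 0" "\<And>x. x \<in> {0..1} \<Longrightarrow> dist x t < d \<Longrightarrow> dist (\<gamma> x) (\<gamma> t) < r"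
      using cont t r(1) unfolding continuous_on_iff by (metis box_real(2))
    have "?f integrable_on cbox u v" if uv: "t \<in> cbox u v" "cbox u v \<subseteq> ball t d" "cbox u v \<subseteq> cbox 0 1" for u v
    proof -
      have in_ball: "\<gamma> x \<in> ball (\<gamma> t) r" if "x \<in> {u..v}" for x
        using that uv d(2)[of x] by (auto simp: dist_commute subset_iff)
      have "(?f has_integral (P (\<gamma> v) - P (\<gamma> u))) {u..v}"
      proof (rule fundamental_theorem_of_calculus_interior_strong[OF F])
        show "u \<le> v" using uv by auto
        have "continuous_on {u..v} \<gamma>" using cont uv(3) by (auto intro: continuous_on_subset)
        moreover have "continuous_on (ball (\<gamma> t) r) P"
          using P by (meson continuous_at_imp_continuous_on has_derivative_continuous)
        ultimately show "continuous_on {u..v} (\<lambda>x. P (\<gamma> x))"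
          using in_ball by (auto intro: continuous_on_compose2)
        fix x assume x: "x \<in> {u<..<v} - F"
        have x01: "x \<in> {0..1}" using uv(3) x by auto
        then have D': "(\<gamma> has_vector_derivative D x) (at x)" using D x by blast
        have "vector_derivative \<gamma> (at x within {0..1}) = D x"
          using vector_derivative_at_within_ivl[OF D'] x01 by simp
        moreover have "((\<lambda>x. P (\<gamma> x)) has_derivative (\<lambda>h. cscale (h *\<^sub>R D x) (G (\<gamma> x)))) (at x)"
          using has_derivative_compose[OF D'[unfolded has_vector_derivative_def] P[OF in_ball]] x by auto
        ultimately show "((\<lambda>x. P (\<gamma> x)) has_vector_derivative ?f x) (at x)"
          by (simp add: has_vector_derivative_def bounded_bilinear.scaleR_left[OF bounded_bilinear_cscale])
      qed
      then show ?thesis by auto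
    qed
    then show ?thesis using d(1) by blast
  qed
  then show ?thesis
    using integrable_on_little_subintervals[of 0 1 ?f] by simp
qed

lemma contour_integral_complex_functional:
  assumes "valid_path \<gamma>" "path_image \<gamma> \<subseteq> S" "open S" "holo S G" "bounded_linear \<phi>"
  shows "contour_integral \<gamma> (\<lambda>z. complex_functional \<phi> (G z)) = complex_functional \<phi> (path_int \<gamma> G)"
proof -
  have "((\<lambda>t. complex_functional \<phi> (cscale (vector_derivative \<gamma> (at t within {0..1})) (G (\<gamma> t))))
      has_integral complex_functional \<phi> (path_int \<gamma> G)) {0..1}"
    unfolding path_int_def
    using has_integral_linear[OF integrable_integral[OF holo_path_integrable[OF assms(1-4)]]
        bounded_linear_complex_functional[OF assms(5)]] by (simp add: o_def)
  then have "((\<lambda>z. complex_functional \<phi> (G z)) has_contour_integral complex_functional \<phi> (path_int \<gamma> G)) \<gamma>"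
    by (simp add: has_contour_integral_def complex_functional_cscale[OF assms(5)] mult.commute)
  then show ?thesis by (rule contour_integral_unique)
qed

text \<open>The scalar theorem holds after every functional, and functionals separate points. Real
  coefficients suffice, as only sums and differences of cycles will occur.\<close>

theorem holo_Cauchy_cycle:
  fixes c :: "'i \<Rightarrow> real"
  assumes S: "open S" and A: "finite A"
    and \<gamma>: "\<And>i. i \<in> A \<Longrightarrow> valid_path (\<gamma> i)" "\<And>i. i \<in> A \<Longrightarrow> pathfinish (\<gamma> i) = pathstart (\<gamma> i)"
      "\<And>i. i \<in> A \<Longrightarrow> path_image (\<gamma> i) \<subseteq> S"
    and zero: "\<And>w. w \<notin> S \<Longrightarrow> (\<Sum>i\<in>A. c i * winding_number (\<gamma> i) w) = 0"
    and G: "holo S G"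
  shows "(\<Sum>i\<in>A. c i *\<^sub>R path_int (\<gamma> i) G) = 0"
proof (rule eq_by_functionals)
  fix \<phi> :: "'b \<Rightarrow> real" assume \<phi>: "bounded_linear \<phi>"
  note lin = bounded_linear.linear[OF bounded_linear_complex_functional[OF \<phi>]]
  have "complex_functional \<phi> (\<Sum>i\<in>A. c i *\<^sub>R path_int (\<gamma> i) G)
      = (\<Sum>i\<in>A. c i * contour_integral (\<gamma> i) (\<lambda>z. complex_functional \<phi> (G z)))"
    using contour_integral_complex_functional[OF \<gamma>(1,3) S G \<phi>]
    by (simp add: linear_sum[OF lin] linear_scale[OF lin] scaleR_conv_of_real)
  also have "\<dots> = 0"
    by (rule Cauchy_theorem_cycle[OF S A \<gamma> zero holo_complex_functional[OF \<phi> G]])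
  finally show "\<phi> (\<Sum>i\<in>A. c i *\<^sub>R path_int (\<gamma> i) G) = \<phi> 0"
    by (simp add: complex_functional_def complex_eq_iff linear_0[OF bounded_linear.linear[OF \<phi>]])
qed

end

section \<open>Inverses of bounded operators\<close>

lemma blinfun_compose_assoc: "(X o\<^sub>L Y) o\<^sub>L Z = X o\<^sub>L (Y o\<^sub>L Z)"
  by (rule blinfun_eqI) simp

lemma blinfun_compose_id [simp]: "X o\<^sub>L id_blinfun = X" "id_blinfun o\<^sub>L X = X"
  by (auto intro: blinfun_eqI)

interpretation blinfun_compose: bounded_bilinear "(o\<^sub>L)"
  by (rule bounded_bilinear_blinfun_compose)

lemmas blinfun_compose_simps = blinfun_compose.add_left blinfun_compose.add_right
  blinfun_compose.diff_left blinfun_compose.diff_right blinfun_compose.minus_left blinfun_compose.minus_right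
  blinfun_compose.scaleR_left blinfun_compose.scaleR_right

lemma bl_inverses_unique: "bl_inverses X Y \<Longrightarrow> bl_inverses X Z \<Longrightarrow> Y = Z"
  unfolding bl_inverses_def by (metis blinfun_compose_assoc blinfun_compose_id)

lemma bl_inv_eq: "bl_inverses X Y \<Longrightarrow> bl_inv X = Y"
  unfolding bl_inv_def by (blast intro: the_equality bl_inverses_unique)

lemma bl_inverses_comp: "bl_inverses X Y \<Longrightarrow> bl_inverses X' Y' \<Longrightarrow> bl_inverses (X o\<^sub>L X') (Y' o\<^sub>L Y)"
  unfolding bl_inverses_def by (metis blinfun_compose_assoc blinfun_compose_id)

text \<open>The inverse is the Neumann series of the powers \<open>P n\<close> of
  \<open>E\<close>.\<close>

lemma bl_inverses_id_minus:
  fixes E :: "'a::banach \<Rightarrow>\<^sub>L 'a"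
  assumes "norm E < 1"
  obtains Y where "bl_inverses (id_blinfun - E) Y"
proof -
  define P where "P n = ((o\<^sub>L) E ^^ n) id_blinfun" for n
  have P_Suc: "P (Suc n) = E o\<^sub>L P n" for n by (simp add: P_def)
  have P_Suc': "P (Suc n) = P n o\<^sub>L E" for n
    by (induction n) (simp_all add: P_def flip: blinfun_compose_assoc)
  have "norm (P n) \<le> norm E ^ n" for n
  proof (induction n)
    case 0
    then show ?case by (simp add: P_def norm_blinfun_id_le)
  next
    case (Suc n)
    then show ?case
      by (simp add: P_Suc) (meson norm_blinfun_compose mult_left_mono norm_ge_zero order_trans)
  qed
  then have summ: "summable P"
    using assms by (intro summable_comparison_test[OF _ summable_geometric[of "norm E"]]) auto
  then have sh: "(\<Sum>n. P (Suc n)) = (\<Sum>n. P n) - id_blinfun"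
    using suminf_split_head[OF summ] P_def[of 0] by simp
  have "E o\<^sub>L (\<Sum>n. P n) = (\<Sum>n. P (Suc n))" "(\<Sum>n. P n) o\<^sub>L E = (\<Sum>n. P (Suc n))"
    using bounded_linear.suminf[OF blinfun_compose.bounded_linear_right summ, of E]
      bounded_linear.suminf[OF blinfun_compose.bounded_linear_left summ, of E]
    by (simp_all only: P_Suc flip: P_Suc')
  then show thesis
    by (intro that[of "\<Sum>n. P n"]) (simp add: bl_inverses_def blinfun_compose_simps sh)
qed

text \<open>\<open>X\<close> is \<open>X0\<close> times \<open>id - Y0 (X0 - X)\<close>, and the
  second factor is a small perturbation of the identity.\<close>

lemma bl_inverses_near:
  fixes X X0 :: "'a::banach \<Rightarrow>\<^sub>L 'a"
  assumes "bl_inverses X0 Y0" "norm (X - X0) * norm Y0 < 1"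
  obtains Y where "bl_inverses X Y"
proof -
  have small: "norm (Y0 o\<^sub>L (X0 - X)) < 1"
    using norm_blinfun_compose[of Y0 "X0 - X"] assms(2) by (simp add: norm_minus_commute mult.commute)
  obtain Z where Z: "bl_inverses (id_blinfun - (Y0 o\<^sub>L (X0 - X))) Z"
    by (rule bl_inverses_id_minus[OF small])
  have "X0 o\<^sub>L Y0 = id_blinfun" using assms(1) by (simp add: bl_inverses_def)
  then have "X0 o\<^sub>L (id_blinfun - (Y0 o\<^sub>L (X0 - X))) = X"
    by (simp only: blinfun_compose.diff_right blinfun_compose_id flip: blinfun_compose_assoc) simp
  then show thesis using that bl_inverses_comp[OF assms(1) Z] by metis
qed

text \<open>From \<open>Y - Y0 = Y (X0 - X) Y0\<close>: smallness first gives
  \<open>norm Y \<le> 2 * norm Y0\<close>, which is the origin of the factor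
  \<open>2\<close>.\<close>

lemma bl_inv_near_bound:
  fixes X X0 :: "'a::banach \<Rightarrow>\<^sub>L 'a"
  assumes X0: "bl_inverses X0 Y0" and X: "bl_inverses X Y" and small: "norm (X - X0) * norm Y0 \<le> 1 / 2"
  shows "norm (Y - Y0) \<le> 2 * norm Y0 ^ 2 * norm (X - X0)"
proof -
  have eq: "Y - Y0 = Y o\<^sub>L ((X0 - X) o\<^sub>L Y0)"
    using X0 X by (simp add: bl_inverses_def blinfun_compose_simps flip: blinfun_compose_assoc)
  have "norm (Y - Y0) \<le> norm Y * norm ((X0 - X) o\<^sub>L Y0)"
    unfolding eq by (rule norm_blinfun_compose)
  also have "\<dots> \<le> norm Y * (norm (X0 - X) * norm Y0)"
    by (intro mult_left_mono norm_blinfun_compose) auto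
  finally have le: "norm (Y - Y0) \<le> norm Y * (norm (X - X0) * norm Y0)"
    by (simp add: norm_minus_commute)
  also have "\<dots> \<le> norm Y * (1 / 2)" by (intro mult_left_mono small) auto
  finally have "norm Y \<le> 2 * norm Y0" using norm_triangle_ineq2[of Y Y0] by simp
  then have "norm Y * (norm (X - X0) * norm Y0) \<le> 2 * norm Y0 * (norm (X - X0) * norm Y0)"
    by (intro mult_right_mono) auto
  with le show ?thesis by (simp add: power2_eq_square mult_ac)
qed

lemma bl_inverses_open_continuous:
  fixes F :: "complex \<Rightarrow> 'a::banach \<Rightarrow>\<^sub>L 'a"
  assumes F: "continuous_on UNIV F"
  shows "open {z. \<exists>Y. bl_inverses (F z) Y}" (is "open ?S")
    and "continuous_on {z. \<exists>Y. bl_inverses (F z) Y} (\<lambda>z. bl_inv (F z))"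
proof -
  have small: "\<forall>\<^sub>F z in nhds z0. norm (F z - F z0) * norm Y0 < 1 / 2" for z0 and Y0 :: "'a \<Rightarrow>\<^sub>L 'a"
  proof -
    have "isCont F z0" using F by (simp add: continuous_on_eq_continuous_at)
    then have "((\<lambda>z. norm (F z - F z0) * norm Y0) \<longlongrightarrow> norm (F z0 - F z0) * norm Y0) (nhds z0)"
      unfolding isCont_def tendsto_at_iff_tendsto_nhds by (intro tendsto_intros)
    then show ?thesis by (intro order_tendstoD(2)) auto
  qed
  show op: "open ?S"
  proof (subst open_subopen, clarify)
    fix z0 Y0 assume "bl_inverses (F z0) Y0"
    then have "\<forall>\<^sub>F z in nhds z0. z \<in> ?S"
      using eventually_mono[OF small[of z0 Y0], of "\<lambda>z. z \<in> ?S"] bl_inverses_near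
      by (smt (verit, ccfv_SIG) field_sum_of_halves mem_Collect_eq)
    then show "\<exists>T. open T \<and> z0 \<in> T \<and> T \<subseteq> ?S"
      by (auto simp: eventually_nhds)
  qed
  have "isCont (\<lambda>z. bl_inv (F z)) z0" if z0: "bl_inverses (F z0) Y0" for z0 Y0
  proof -
    have in_S: "\<forall>\<^sub>F z in nhds z0. z \<in> ?S"
      using op z0 by (metis (mono_tags, lifting) eventually_nhds mem_Collect_eq)
    have "isCont F z0" using F by (simp add: continuous_on_eq_continuous_at)
    then have lim: "((\<lambda>z. 2 * norm Y0 ^ 2 * norm (F z - F z0)) \<longlongrightarrow> 2 * norm Y0 ^ 2 * norm (F z0 - F z0)) (nhds z0)"
      unfolding isCont_def tendsto_at_iff_tendsto_nhds by (intro tendsto_intros)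
    have "\<forall>\<^sub>F z in nhds z0. norm (bl_inv (F z) - Y0) \<le> 2 * norm Y0 ^ 2 * norm (F z - F z0)"
      using in_S small[of z0 Y0]
    proof eventually_elim
      case (elim z)
      then obtain Y where "bl_inverses (F z) Y" by auto
      then show ?case using bl_inv_near_bound[OF z0] elim(2) by (simp add: bl_inv_eq)
    qed
    then have "((\<lambda>z. bl_inv (F z) - Y0) \<longlongrightarrow> 0) (nhds z0)"
      by (rule Lim_null_comparison) (use lim in simp)
    then have "((\<lambda>z. bl_inv (F z)) \<longlongrightarrow> bl_inv (F z0)) (nhds z0)"
      using bl_inv_eq[OF z0] LIM_zero_iff by metis
    then show ?thesis
      unfolding isCont_def by (rule tendsto_at_iff_tendsto_nhds[THEN iffD2])
  qed
  then show "continuous_on ?S (\<lambda>z. bl_inv (F z))"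
    by (auto intro: continuous_at_imp_continuous_on)
qed

section \<open>The complexified operator algebra\<close>

text \<open>The pair \<open>(A, B)\<close> stands for the operator \<open>A + \<i>B\<close> of the complexified operator algebra.\<close>

type_synonym 'v cop = "('v \<Rightarrow>\<^sub>L 'v) \<times> ('v \<Rightarrow>\<^sub>L 'v)"

definition imul :: "'v::banach cop \<Rightarrow> 'v cop" where
  "imul p = (- snd p, fst p)"

definition cmul :: "'v::banach cop \<Rightarrow> 'v cop \<Rightarrow> 'v cop" where
  "cmul p q = ((fst p o\<^sub>L fst q) - (snd p o\<^sub>L snd q), (fst p o\<^sub>L snd q) + (snd p o\<^sub>L fst q))"

definition cop_one :: "'v::banach cop" where
  "cop_one = (id_blinfun, 0)"

text \<open>Conjugation of the scalars only, not an adjoint: it does not reverse products.\<close>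

definition cop_cnj :: "'v::banach cop \<Rightarrow> 'v cop" where
  "cop_cnj p = (fst p, - snd p)"

primrec cpow :: "'v::banach cop \<Rightarrow> nat \<Rightarrow> 'v cop" where
  "cpow p 0 = cop_one"
| "cpow p (Suc n) = cmul p (cpow p n)"

interpretation cop: complex_structure "imul :: 'v::banach cop \<Rightarrow> 'v cop"
proof (rule complex_structure.intro)
  show "bounded_linear (imul :: 'v cop \<Rightarrow> 'v cop)"
    unfolding imul_def[abs_def]
    by (intro bounded_linear_Pair bounded_linear_minus bounded_linear_fst bounded_linear_snd)
qed (simp add: imul_def uminus_prod_def)

lemma cscale_pair: "cop.cscale z p = (Re z *\<^sub>R fst p - Im z *\<^sub>R snd p, Re z *\<^sub>R snd p + Im z *\<^sub>R fst p)"
  by (simp add: cop.cscale_def imul_def plus_prod_def scaleR_prod_def)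

lemma bounded_bilinear_cmul: "bounded_bilinear (cmul :: 'v::banach cop \<Rightarrow> 'v cop \<Rightarrow> 'v cop)"
proof
  have comp: "norm (X o\<^sub>L Y) \<le> norm p * norm q"
    if "norm X \<le> norm p" "norm Y \<le> norm q" for X Y :: "'v \<Rightarrow>\<^sub>L 'v" and p q :: "'v cop"
    using norm_blinfun_compose[of X Y] mult_mono[OF that] by force
  have "norm (cmul p q) \<le> norm p * norm q * 4" for p q :: "'v cop"
  proof -
    have n: "norm (fst p) \<le> norm p" "norm (snd p) \<le> norm p" "norm (fst q) \<le> norm q" "norm (snd q) \<le> norm q"
      by (metis norm_fst_le norm_snd_le prod.collapse)+
    have "norm (cmul p q) \<le> norm ((fst p o\<^sub>L fst q) - (snd p o\<^sub>L snd q)) + norm ((fst p o\<^sub>L snd q) + (snd p o\<^sub>L fst q))"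
      unfolding cmul_def by (rule norm_Pair_le)
    also have "\<dots> \<le> (norm (fst p o\<^sub>L fst q) + norm (snd p o\<^sub>L snd q)) + (norm (fst p o\<^sub>L snd q) + norm (snd p o\<^sub>L fst q))"
      by (intro add_mono norm_triangle_ineq norm_triangle_ineq4)
    also have "\<dots> \<le> (norm p * norm q + norm p * norm q) + (norm p * norm q + norm p * norm q)"
      by (intro add_mono comp n)
    finally show ?thesis by simp
  qed
  then show "\<exists>K. \<forall>p q. norm (cmul p q :: 'v cop) \<le> norm p * norm q * K" by blast
qed (simp_all add: cmul_def plus_prod_def scaleR_prod_def blinfun_compose_simps algebra_simps)

interpretation cmul: bounded_bilinear cmul
  by (rule bounded_bilinear_cmul)

interpretation cscale: bounded_bilinear "cop.cscale :: complex \<Rightarrow> 'v::banach cop \<Rightarrow> 'v cop"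
  by (rule cop.bounded_bilinear_cscale)

lemma cmul_assoc: "cmul (cmul p q) r = cmul p (cmul q r)"
  by (simp add: cmul_def blinfun_compose_simps blinfun_compose_assoc algebra_simps)

lemma cmul_one [simp]: "cmul cop_one p = p" "cmul p cop_one = p"
  by (simp_all add: cmul_def cop_one_def)

lemma cmul_cscale: "cmul (cop.cscale z p) q = cop.cscale z (cmul p q)" "cmul p (cop.cscale z q) = cop.cscale z (cmul p q)"
  by (simp_all add: cmul_def cscale_pair blinfun_compose_simps algebra_simps)

lemma cop_cnj_cmul: "cop_cnj (cmul p q) = cmul (cop_cnj p) (cop_cnj q)"
  by (simp add: cop_cnj_def cmul_def blinfun_compose_simps)

lemma cop_cnj_cscale: "cop_cnj (cop.cscale z p) = cop.cscale (cnj z) (cop_cnj p)"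
  by (simp add: cop_cnj_def cscale_pair)

lemma cop_cnj_cpow: "cop_cnj (cpow p n) = cpow (cop_cnj p) n"
  by (induction n) (simp_all add: cop_cnj_cmul, simp add: cop_cnj_def cop_one_def)

lemma bounded_linear_cop_cnj: "bounded_linear cop_cnj"
  unfolding cop_cnj_def[abs_def]
  by (intro bounded_linear_Pair bounded_linear_minus bounded_linear_fst bounded_linear_snd)

lemma holo_cmul:
  assumes "cop.holo S F" "cop.holo S G"
  shows "cop.holo S (\<lambda>z. cmul (F z) (G z))"
proof -
  obtain F' G' where F': "\<forall>z\<in>S. (F has_derivative (\<lambda>h. cop.cscale h (F' z))) (at z)"
    and G': "\<forall>z\<in>S. (G has_derivative (\<lambda>h. cop.cscale h (G' z))) (at z)"
    using assms by (auto simp: cop.holo_def)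
  have "((\<lambda>z. cmul (F z) (G z)) has_derivative (\<lambda>h. cop.cscale h (cmul (F z) (G' z) + cmul (F' z) (G z)))) (at z)"
    if "z \<in> S" for z
    using cmul.FDERIV[OF F'[rule_format, OF that] G'[rule_format, OF that]]
    by (simp add: cmul_cscale cscale.add_right)
  then show ?thesis
    unfolding cop.holo_def by (intro exI[of _ "\<lambda>z. cmul (F z) (G' z) + cmul (F' z) (G z)"]) blast
qed

lemma holo_cpow: "cop.holo S F \<Longrightarrow> cop.holo S (\<lambda>z. cpow (F z) n)"
  by (induction n) (simp_all add: cop.holo_const holo_cmul)

text \<open>The identity \<open>p w - p z = - p w (q w - q z) p z\<close> turns the difference
  quotient of the inverse into that of \<open>q\<close>; continuity of \<open>p\<close> gives the
  limit of the outer factor.\<close>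

lemma holo_inverse:
  assumes q: "cop.holo S q" and p: "continuous_on S p" and S: "open S"
    and inv: "\<And>z. z \<in> S \<Longrightarrow> cmul (q z) (p z) = cop_one" "\<And>z. z \<in> S \<Longrightarrow> cmul (p z) (q z) = cop_one"
  shows "cop.holo S p"
proof -
  obtain q' where q': "\<And>z. z \<in> S \<Longrightarrow> (q has_derivative (\<lambda>h. cop.cscale h (q' z))) (at z)"
    using q by (auto simp: cop.holo_def)
  have "(p has_derivative (\<lambda>h. cop.cscale h (- cmul (p z) (cmul (q' z) (p z))))) (at z)" if z: "z \<in> S" for z
    unfolding cop.has_derivative_cscale_iff
  proof (rule Lim_transform_within_open[OF _ S z])
    have "(p \<longlongrightarrow> p z) (at z)"
      using p S z by (simp add: continuous_on_eq_continuous_at isCont_def)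
    moreover have "((\<lambda>w. cop.cscale (inverse (w - z)) (q w - q z)) \<longlongrightarrow> q' z) (at z)"
      using q'[OF z] by (simp only: cop.has_derivative_cscale_iff)
    ultimately show "((\<lambda>w. - cmul (p w) (cmul (cop.cscale (inverse (w - z)) (q w - q z)) (p z)))
        \<longlongrightarrow> - cmul (p z) (cmul (q' z) (p z))) (at z)"
      by (intro tendsto_minus cmul.tendsto tendsto_const)
    fix w assume w: "w \<in> S" "w \<noteq> z"
    have "cmul (p w) (cmul (q w - q z) (p z)) = p z - p w"
      using inv(1)[OF z] inv(2)[OF w(1)]
      by (simp add: cmul.diff_left cmul.diff_right flip: cmul_assoc)
    then show "- cmul (p w) (cmul (cop.cscale (inverse (w - z)) (q w - q z)) (p z))
        = cop.cscale (inverse (w - z)) (p w - p z)"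
      by (simp add: cmul_cscale flip: cscale.minus_right)
  qed
  then show ?thesis
    unfolding cop.holo_def by (intro exI[of _ "\<lambda>z. - cmul (p z) (cmul (q' z) (p z))"]) blast
qed

section \<open>The algebra of operators on the Clifford module\<close>

abbreviation (input) sdiff :: "'a set \<Rightarrow> 'a set \<Rightarrow> 'a set" where
  "sdiff A B \<equiv> (A - B) \<union> (B - A)"

lemma sdiff_eq_iff: "sdiff A B = C \<longleftrightarrow> B = sdiff A C"
  by blast

lemma sdiff_cancel: "sdiff A (sdiff A C) = C"
  by blast

text \<open>Elements of \<open>A \<inter> B\<close> occur twice on the right, and the values of
  \<open>f\<close> square to \<open>1\<close>.\<close>

lemma prod_sdiff:
  fixes f :: "'a \<Rightarrow> real"
  assumes "finite A" "finite B" "\<And>x. f x * f x = 1"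
  shows "prod f (sdiff A B) = prod f A * prod f B"
proof -
  have "prod f A = prod f (A - B) * prod f (A \<inter> B)" "prod f B = prod f (B - A) * prod f (A \<inter> B)"
    using prod.Int_Diff[OF assms(1), of f B] prod.Int_Diff[OF assms(2), of f A] by (simp_all add: Int_commute mult.commute)
  moreover have "prod f (A \<inter> B) * prod f (A \<inter> B) = 1"
    using assms(3) by (simp flip: prod.distrib)
  moreover have "prod f (sdiff A B) = prod f (A - B) * prod f (B - A)"
    using assms(1,2) by (intro prod.union_disjoint) auto
  ultimately show ?thesis by (simp add: mult_ac)
qed

lemma cl_sign_prod: "cl_sign A B = (\<Prod>a\<in>A. \<Prod>b\<in>B. if b \<le> a then - 1 else 1)"
proof -
  have "{(a, b). a \<in> A \<and> b \<in> B \<and> b \<le> a} = {p \<in> A \<times> B. snd p \<le> fst p}" by auto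
  moreover have "(\<Prod>p\<in>A \<times> B. if snd p \<le> fst p then - 1 else 1 :: real) = (- 1) ^ card {p \<in> A \<times> B. snd p \<le> fst p}"
    by (simp add: prod.If_cases Int_def)
  ultimately show ?thesis
    by (simp add: cl_sign_def prod.cartesian_product case_prod_beta)
qed

lemma cl_sign_square [simp]: "cl_sign A B * cl_sign A B = 1"
  by (simp add: cl_sign_def flip: power_mult_distrib)

text \<open>\<open>cl_sign\<close> is a bicharacter of the group of subsets under symmetric difference, hence a
  2-cocycle; this is the associativity of the Clifford product.\<close>

lemma cl_sign_sdiff_left: "cl_sign (sdiff A B) C = cl_sign A C * cl_sign B C"
  unfolding cl_sign_prod by (rule prod_sdiff) (auto simp flip: prod.distrib intro!: prod.neutral)

lemma cl_sign_sdiff_right: "cl_sign C (sdiff A B) = cl_sign C A * cl_sign C B"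
proof -
  have "(\<Prod>b\<in>sdiff A B. if b \<le> c then - 1 else 1 :: real) = (\<Prod>b\<in>A. if b \<le> c then - 1 else 1) * (\<Prod>b\<in>B. if b \<le> c then - 1 else 1)" for c
    by (rule prod_sdiff) auto
  then show ?thesis unfolding cl_sign_prod by (simp add: prod.distrib)
qed

lemma cl_sign_empty [simp]: "cl_sign {} B = 1" "cl_sign A {} = 1"
  by (simp_all add: cl_sign_def)

lemma cl_apply_nth:
  "cl_apply T v $ C = (\<Sum>A\<in>UNIV. cl_sign A (sdiff A C) *\<^sub>R blinfun_apply (T $ A) (v $ sdiff A C))"
proof -
  have "(\<Sum>B\<in>UNIV. axis (sdiff A B) (cl_sign A B *\<^sub>R blinfun_apply (T $ A) (v $ B))) $ C
      = cl_sign A (sdiff A C) *\<^sub>R blinfun_apply (T $ A) (v $ sdiff A C)" for A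
  proof -
    have "(\<Sum>B\<in>UNIV. axis (sdiff A B) (cl_sign A B *\<^sub>R blinfun_apply (T $ A) (v $ B))) $ C
      = (\<Sum>B\<in>UNIV. if B = sdiff A C then cl_sign A B *\<^sub>R blinfun_apply (T $ A) (v $ B) else 0)"
      unfolding sum_component
    proof (rule sum.cong[OF refl])
      fix B
      show "axis (sdiff A B) (cl_sign A B *\<^sub>R blinfun_apply (T $ A) (v $ B)) $ C
        = (if B = sdiff A C then cl_sign A B *\<^sub>R blinfun_apply (T $ A) (v $ B) else 0)"
        using sdiff_eq_iff[of A B C] unfolding axis_def by (simp only: vec_lambda_beta) metis
    qed
    then show ?thesis by simp
  qed
  then show ?thesis by (simp add: cl_apply_def)
qed

lemma cl_mult_nth: "cl_mult a b $ C = (\<Sum>A\<in>UNIV. cl_sign A (sdiff A C) * (a $ A * b $ sdiff A C))"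
proof -
  have "(\<Sum>B\<in>UNIV. axis (sdiff A B) (cl_sign A B * (a $ A * b $ B))) $ C
      = cl_sign A (sdiff A C) * (a $ A * b $ sdiff A C)" for A
  proof -
    have "(\<Sum>B\<in>UNIV. axis (sdiff A B) (cl_sign A B * (a $ A * b $ B))) $ C
      = (\<Sum>B\<in>UNIV. if B = sdiff A C then cl_sign A B * (a $ A * b $ B) else 0)"
      unfolding sum_component
    proof (rule sum.cong[OF refl])
      fix B
      show "axis (sdiff A B) (cl_sign A B * (a $ A * b $ B)) $ C
        = (if B = sdiff A C then cl_sign A B * (a $ A * b $ B) else 0)"
        using sdiff_eq_iff[of A B C] unfolding axis_def by (simp only: vec_lambda_beta) metis
    qed
    then show ?thesis by simp
  qed
  then show ?thesis by (simp add: cl_mult_def)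
qed

lemma cl_op_nth:
  "blinfun_apply (cl_op T) v $ C = (\<Sum>A\<in>UNIV. cl_sign A (sdiff A C) *\<^sub>R blinfun_apply (T $ A) (v $ sdiff A C))"
  by (simp add: blinfun_apply_cl_op cl_apply_nth)

lemma cl_left_nth:
  "blinfun_apply (cl_left a) v $ C = (\<Sum>A\<in>UNIV. (cl_sign A (sdiff A C) * a $ A) *\<^sub>R v $ sdiff A C)"
  by (simp add: cl_left_def cl_op_nth blinfun.scaleR_left)

lemma cl_left_axis_nth:
  "blinfun_apply (cl_left (axis A r)) v $ C = (cl_sign A (sdiff A C) * r) *\<^sub>R v $ sdiff A C"
proof -
  have "(cl_sign A' (sdiff A' C) * axis A r $ A') *\<^sub>R v $ sdiff A' C
    = (if A' = A then (cl_sign A (sdiff A C) * r) *\<^sub>R v $ sdiff A C else 0)" for A'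
    by (simp add: axis_def)
  then show ?thesis by (simp add: cl_left_nth)
qed

lemma real_op_nth: "blinfun_apply (real_op X) v $ C = blinfun_apply X (v $ C)"
proof -
  have "cl_sign A (sdiff A C) *\<^sub>R blinfun_apply (axis {} X $ A) (v $ sdiff A C)
    = (if A = {} then blinfun_apply X (v $ C) else 0)" for A
    by (simp add: axis_def)
  then show ?thesis by (simp add: real_op_def cl_op_nth)
qed

lemma cmodule_op_eqI: "(\<And>v C. blinfun_apply X v $ C = blinfun_apply Y v $ C) \<Longrightarrow> X = Y"
  for X Y :: "('v::real_normed_vector, 'n::finite) cmodule \<Rightarrow>\<^sub>L ('v, 'n) cmodule"
  by (intro blinfun_eqI) (simp add: vec_eq_iff)

lemma cl_left_add: "cl_left (a + b) = cl_left a + cl_left b"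
  by (rule cmodule_op_eqI) (simp add: cl_left_nth blinfun.add_left algebra_simps sum.distrib)

lemma cl_left_scaleR: "cl_left (r *\<^sub>R a) = r *\<^sub>R cl_left a"
  by (rule cmodule_op_eqI) (simp add: cl_left_nth blinfun.scaleR_left scaleR_sum_right mult_ac)

lemma cl_left_0: "cl_left 0 = 0"
  using cl_left_scaleR[of 0 0] by simp

lemma cl_left_sum: "cl_left (\<Sum>i\<in>S. f i) = (\<Sum>i\<in>S. cl_left (f i))"
  by (induction S rule: infinite_finite_induct) (simp_all add: cl_left_0 cl_left_add)

lemma cl_left_1 [simp]: "cl_left (axis {} 1) = id_blinfun"
  by (rule cmodule_op_eqI) (simp add: cl_left_axis_nth)

lemma cl_left_scalar: "cl_left (axis {} r) = r *\<^sub>R id_blinfun"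
  by (rule cmodule_op_eqI) (simp add: cl_left_axis_nth blinfun.scaleR_left)

lemma cl_left_mult: "cl_left (cl_mult a b) = cl_left a o\<^sub>L cl_left b"
proof (rule cmodule_op_eqI)
  fix v :: "('a, 'b) cmodule" and C
  let ?S = "\<lambda>A B. (cl_sign A B * cl_sign (sdiff A B) (sdiff (sdiff A B) C) * (a $ A * b $ B)) *\<^sub>R v $ sdiff (sdiff A B) C"
  have "blinfun_apply (cl_left (cl_mult a b)) v $ C
    = (\<Sum>D\<in>UNIV. \<Sum>A\<in>UNIV. (cl_sign D (sdiff D C) * (cl_sign A (sdiff A D) * (a $ A * b $ sdiff A D))) *\<^sub>R v $ sdiff D C)"
    by (simp add: cl_left_nth cl_mult_nth sum_distrib_left scaleR_sum_left)
  also have "\<dots> = (\<Sum>A\<in>UNIV. \<Sum>D\<in>UNIV. (cl_sign D (sdiff D C) * (cl_sign A (sdiff A D) * (a $ A * b $ sdiff A D))) *\<^sub>R v $ sdiff D C)"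
    by (rule sum.swap)
  also have "\<dots> = (\<Sum>A\<in>UNIV. \<Sum>B\<in>UNIV. ?S A B)"
  proof (rule sum.cong[OF refl])
    fix A
    show "(\<Sum>D\<in>UNIV. (cl_sign D (sdiff D C) * (cl_sign A (sdiff A D) * (a $ A * b $ sdiff A D))) *\<^sub>R v $ sdiff D C) = (\<Sum>B\<in>UNIV. ?S A B)"
      \<comment> \<open>The substitution \<open>B = sdiff A D\<close> is its own inverse for fixed
        \<open>A\<close>.\<close>
      by (rule sum.reindex_bij_witness[where i="sdiff A" and j="sdiff A"]) (simp_all only: sdiff_cancel UNIV_I mult_ac)
  qed
  also have "\<dots> = (\<Sum>A\<in>UNIV. \<Sum>B\<in>UNIV. ((cl_sign A (sdiff A C) * a $ A) * (cl_sign B (sdiff B (sdiff A C)) * b $ B)) *\<^sub>R v $ sdiff B (sdiff A C))"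
  proof (intro sum.cong refl)
    fix A B
    have s: "sdiff (sdiff A B) C = sdiff B (sdiff A C)" by blast
    \<comment> \<open>Expanded by the bicharacter rules, the two sides differ by the square of
      \<open>cl_sign A B\<close>.\<close>
    have "cl_sign A B * cl_sign (sdiff A B) (sdiff (sdiff A B) C) = cl_sign A (sdiff A C) * cl_sign B (sdiff B (sdiff A C))"
      unfolding s cl_sign_sdiff_left cl_sign_sdiff_right
      using cl_sign_square[of A B] by algebra
    then show "?S A B = ((cl_sign A (sdiff A C) * a $ A) * (cl_sign B (sdiff B (sdiff A C)) * b $ B)) *\<^sub>R v $ sdiff B (sdiff A C)"
      unfolding s by (simp add: mult_ac)
  qed
  also have "\<dots> = blinfun_apply (cl_left a o\<^sub>L cl_left b) v $ C"
    by (simp add: cl_left_nth scaleR_sum_right)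
  finally show "blinfun_apply (cl_left (cl_mult a b)) v $ C = blinfun_apply (cl_left a o\<^sub>L cl_left b) v $ C" .
qed

section \<open>Operators acting on each coefficient\<close>

text \<open>A Clifford number forms real linear combinations of the coefficients, and
  \<open>X\<close> is real linear. The passage from \<open>V_n\<close> to operators on
  \<open>V\<close> rests on this.\<close>

lemma real_op_cl_left: "real_op X o\<^sub>L cl_left a = cl_left a o\<^sub>L real_op X"
  by (rule cmodule_op_eqI) (simp add: cl_left_nth real_op_nth blinfun.sum_right blinfun.scaleR_right)

lemma real_op_cl_left_left: "real_op X o\<^sub>L (cl_left a o\<^sub>L Y) = cl_left a o\<^sub>L (real_op X o\<^sub>L Y)"
  by (simp add: real_op_cl_left flip: blinfun_compose_assoc)

lemma real_op_compose: "real_op (X o\<^sub>L Y) = real_op X o\<^sub>L real_op Y"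
  by (rule cmodule_op_eqI) (simp add: real_op_nth)

lemma real_op_add: "real_op (X + Y) = real_op X + real_op Y"
  by (rule cmodule_op_eqI) (simp add: real_op_nth blinfun.add_left)

lemma real_op_scaleR: "real_op (r *\<^sub>R X) = r *\<^sub>R real_op X"
  by (rule cmodule_op_eqI) (simp add: real_op_nth blinfun.scaleR_left)

lemma real_op_0 [simp]: "real_op 0 = 0"
  using real_op_scaleR[of 0 0] by simp

lemma real_op_minus: "real_op (- X) = - real_op X"
  using real_op_scaleR[of "-1" X] by simp

lemma real_op_diff: "real_op (X - Y) = real_op X - real_op Y"
  using real_op_add[of X "-Y"] by (simp add: real_op_minus)

lemma real_op_sum: "real_op (\<Sum>i\<in>S. f i) = (\<Sum>i\<in>S. real_op (f i))"
  by (induction S rule: infinite_finite_induct) (simp_all add: real_op_add)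

lemma real_op_id [simp]: "real_op id_blinfun = id_blinfun"
  by (rule cmodule_op_eqI) (simp add: real_op_nth)

text \<open>Boundedness is what later allows integrals to be moved through
  \<open>slice_op\<close>.\<close>

lemma bounded_linear_real_op: "bounded_linear (real_op :: ('v::banach \<Rightarrow>\<^sub>L 'v) \<Rightarrow> ('v, 'n::{finite,linorder}) cmodule \<Rightarrow>\<^sub>L ('v, 'n) cmodule)"
proof (rule bounded_linear_intro[where K="real CARD('n set)"])
  show "norm (real_op X :: ('v, 'n) cmodule \<Rightarrow>\<^sub>L ('v, 'n) cmodule) \<le> norm X * real CARD('n set)" for X
  proof (rule norm_blinfun_bound)
    fix v :: "('v, 'n) cmodule"
    have "norm (blinfun_apply (real_op X) v) \<le> (\<Sum>C\<in>UNIV. norm (blinfun_apply (real_op X) v $ C))"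
      unfolding norm_vec_def by (rule L2_set_le_sum) simp
    also have "\<dots> \<le> (\<Sum>C\<in>(UNIV :: 'n set set). norm X * norm v)"
      unfolding real_op_nth
      by (intro sum_mono order_trans[OF norm_blinfun] mult_left_mono Finite_Cartesian_Product.norm_nth_le) simp_all
    finally show "norm (blinfun_apply (real_op X) v) \<le> norm X * real CARD('n set) * norm v"
      by (simp add: mult_ac)
  qed simp
qed (simp_all add: real_op_add real_op_scaleR)

lemma cl_op_eq_sum: "cl_op T = (\<Sum>A\<in>UNIV. real_op (T $ A) o\<^sub>L cl_left (axis A 1))"
  by (rule cmodule_op_eqI)
    (simp add: cl_op_nth blinfun.sum_left real_op_nth cl_left_axis_nth blinfun.scaleR_right)

lemma cl_op_axis: "cl_op (axis A X) = real_op X o\<^sub>L cl_left (axis A 1)"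
proof -
  have "real_op (axis A X $ B) o\<^sub>L cl_left (axis B 1) = (if B = A then real_op X o\<^sub>L cl_left (axis A 1) else 0)" for B
    by (simp add: axis_def)
  then show ?thesis by (simp add: cl_op_eq_sum)
qed

lemma cl_op_add: "cl_op (S + T) = cl_op S + cl_op T"
  by (simp add: cl_op_eq_sum real_op_add blinfun_compose.add_left sum.distrib)

lemma cl_op_scaleR: "cl_op (r *\<^sub>R T) = r *\<^sub>R cl_op T"
  by (simp add: cl_op_eq_sum real_op_scaleR blinfun_compose.scaleR_left scaleR_sum_right)

lemma cl_op_sum: "cl_op (\<Sum>i\<in>S. f i) = (\<Sum>i\<in>S. cl_op (f i))"
  using cl_op_scaleR[of 0 0] by (induction S rule: infinite_finite_induct) (simp_all add: cl_op_add)

lemma B_Vn_subspace: "subspace B_Vn"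
  unfolding B_Vn_def
proof (intro subspaceI)
  show "0 \<in> range cl_op" using cl_op_scaleR[of 0 0] by (metis rangeI scaleR_zero_left)
qed (auto simp flip: cl_op_add cl_op_scaleR)

lemma real_op_cl_left_in_B_Vn: "real_op X o\<^sub>L cl_left a \<in> B_Vn"
proof -
  have "real_op X o\<^sub>L cl_left a = cl_op (\<chi> A. (a $ A) *\<^sub>R X)"
    by (rule cmodule_op_eqI)
      (simp add: cl_op_nth cl_left_nth real_op_nth blinfun.sum_right blinfun.scaleR_right blinfun.scaleR_left)
  then show ?thesis by (simp add: B_Vn_def)
qed

text \<open>Terms \<open>X a\<close> and \<open>Y b\<close> multiply to \<open>(X Y) (a b)\<close>,
  because \<open>Y\<close> can be moved past the Clifford number \<open>a\<close>.\<close>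

lemma B_Vn_compose:
  assumes "S \<in> B_Vn" "T \<in> B_Vn"
  shows "S o\<^sub>L T \<in> B_Vn"
proof -
  obtain a b where ab: "S = cl_op a" "T = cl_op b" using assms by (auto simp: B_Vn_def)
  have "(real_op X o\<^sub>L cl_left x) o\<^sub>L (real_op Y o\<^sub>L cl_left y) = real_op (X o\<^sub>L Y) o\<^sub>L cl_left (cl_mult x y)"
    for X Y :: "'a \<Rightarrow>\<^sub>L 'a" and x y :: "'b clifford"
    by (metis blinfun_compose_assoc cl_left_mult real_op_cl_left real_op_compose)
  then show ?thesis
    by (auto simp: ab cl_op_eq_sum[of a] cl_op_eq_sum[of b] blinfun_compose.sum_left blinfun_compose.sum_right
      real_op_cl_left_in_B_Vn intro!: subspace_sum[OF B_Vn_subspace])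
qed

section \<open>Vector operators and imaginary units\<close>

abbreviation gen_op :: "'n::{finite,linorder} \<Rightarrow> ('v::banach, 'n) cmodule \<Rightarrow>\<^sub>L ('v, 'n) cmodule" where
  "gen_op j \<equiv> cl_left (axis {j} 1)"

lemma gen_op_anticommute:
  "(gen_op i o\<^sub>L gen_op j) + (gen_op j o\<^sub>L gen_op i) = (if i = j then - 2 else 0) *\<^sub>R id_blinfun"
  unfolding cl_left_mult[symmetric] cl_left_add[symmetric] cl_generators cl_left_scalar ..

text \<open>Averaging the double sum with its transpose replaces \<open>e_i e_j\<close> by half an
  anticommutator, which is \<open>-1\<close> on the diagonal and \<open>0\<close> off it. It serves
  for the vector part of \<open>T\<close> and, with scalar operators, for \<open>I\<close>.\<close>

lemma vector_op_square:
  fixes X :: "'n::{finite,linorder} \<Rightarrow> 'v::banach \<Rightarrow>\<^sub>L 'v"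
  assumes comm: "\<And>i j. X i o\<^sub>L X j = X j o\<^sub>L X i"
  shows "(\<Sum>i\<in>UNIV. real_op (X i) o\<^sub>L gen_op i) o\<^sub>L (\<Sum>i\<in>UNIV. real_op (X i) o\<^sub>L gen_op i)
    = - real_op (\<Sum>i\<in>UNIV. X i o\<^sub>L X i)" (is "?L = - ?R")
proof -
  define P where "P i j = (real_op (X i o\<^sub>L X j) :: ('v, 'n) cmodule \<Rightarrow>\<^sub>L ('v, 'n) cmodule)" for i j
  have mul: "(real_op (X i) o\<^sub>L gen_op i) o\<^sub>L (real_op (X j) o\<^sub>L gen_op j) = P i j o\<^sub>L (gen_op i o\<^sub>L gen_op j)" for i j
    by (simp add: P_def real_op_compose blinfun_compose_assoc real_op_cl_left real_op_cl_left_left)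
  have L1: "?L = (\<Sum>i\<in>UNIV. \<Sum>j\<in>UNIV. P i j o\<^sub>L (gen_op i o\<^sub>L gen_op j))"
    by (simp add: blinfun_compose.sum_left blinfun_compose.sum_right mul)
      (rule sum.swap)
  have L2: "?L = (\<Sum>i\<in>UNIV. \<Sum>j\<in>UNIV. P i j o\<^sub>L (gen_op j o\<^sub>L gen_op i))"
    unfolding L1 by (subst sum.swap) (simp add: P_def comm)
  have "2 *\<^sub>R ?L = (\<Sum>i\<in>UNIV. \<Sum>j\<in>UNIV. P i j o\<^sub>L ((gen_op i o\<^sub>L gen_op j) + (gen_op j o\<^sub>L gen_op i)))"
    unfolding scaleR_2 by (subst L1, subst L2) (simp add: blinfun_compose.add_right sum.distrib)
  also have "\<dots> = (\<Sum>i\<in>UNIV. \<Sum>j\<in>UNIV. if j = i then - (2 *\<^sub>R P i i) else 0)"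
    unfolding gen_op_anticommute
    by (intro sum.cong refl) (auto simp: blinfun_compose.scaleR_right)
  also have "\<dots> = 2 *\<^sub>R - ?R"
    by (simp add: P_def real_op_sum sum_negf scaleR_sum_right)
  finally show ?thesis unfolding scaleR_cancel_left by simp
qed

definition imag_op :: "real ^ 'n::{finite,linorder} \<Rightarrow> ('v::banach, 'n) cmodule \<Rightarrow>\<^sub>L ('v, 'n) cmodule" where
  "imag_op I = cl_left (para (0, I))"

lemma imag_op_eq_sum: "imag_op I = (\<Sum>j\<in>UNIV. real_op ((I $ j) *\<^sub>R id_blinfun) o\<^sub>L gen_op j)"
proof -
  have "axis {j} (I $ j) = (I $ j) *\<^sub>R axis {j} 1" for j
    by (simp add: axis_def vec_eq_iff)
  then show ?thesis
    by (simp add: imag_op_def para_def cl_left_add cl_left_sum cl_left_scaleR cl_left_scalar real_op_scaleR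
      blinfun_compose.scaleR_left)
qed

lemma imag_op_square:
  assumes "norm I = 1"
  shows "imag_op I o\<^sub>L imag_op I = - (id_blinfun :: ('v::banach, 'n::{finite,linorder}) cmodule \<Rightarrow>\<^sub>L ('v, 'n) cmodule)"
proof -
  have "(\<Sum>j\<in>UNIV. I $ j * I $ j) = 1"
    using assms by (simp add: norm_eq_1 inner_vec_def)
  then have s: "(\<Sum>j\<in>UNIV. ((I $ j) *\<^sub>R id_blinfun) o\<^sub>L ((I $ j) *\<^sub>R id_blinfun)) = (id_blinfun :: 'v \<Rightarrow>\<^sub>L 'v)"
    by (simp add: blinfun_compose_simps flip: scaleR_sum_left)
  have "imag_op I o\<^sub>L imag_op I = - (real_op (\<Sum>j\<in>UNIV. ((I $ j) *\<^sub>R id_blinfun) o\<^sub>L ((I $ j) *\<^sub>R id_blinfun))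
      :: ('v, 'n) cmodule \<Rightarrow>\<^sub>L ('v, 'n) cmodule)"
    unfolding imag_op_eq_sum
    by (rule vector_op_square) (simp add: blinfun_compose.scaleR_left blinfun_compose.scaleR_right mult.commute)
  then show ?thesis by (simp only: s real_op_id)
qed

lemma imag_op_real_op: "imag_op I o\<^sub>L real_op X = real_op X o\<^sub>L imag_op I"
  by (simp add: imag_op_def real_op_cl_left)

lemma real_op_imag_op_left: "real_op X o\<^sub>L (imag_op I o\<^sub>L Y) = imag_op I o\<^sub>L (real_op X o\<^sub>L Y)"
  by (simp add: imag_op_real_op flip: blinfun_compose_assoc)

definition slice_op :: "real ^ 'n::{finite,linorder} \<Rightarrow> 'v::banach cop \<Rightarrow> ('v, 'n) cmodule \<Rightarrow>\<^sub>L ('v, 'n) cmodule" where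
  "slice_op I p = real_op (fst p) + (imag_op I o\<^sub>L real_op (snd p))"

lemma bounded_linear_slice_op: "bounded_linear (slice_op I)"
  unfolding slice_op_def[abs_def]
  by (intro bounded_linear_add bounded_linear_compose[OF bounded_linear_real_op]
    bounded_linear_compose[OF blinfun_compose.bounded_linear_right] bounded_linear_fst bounded_linear_snd)

lemmas slice_op_linear = linear_add[OF bounded_linear.linear[OF bounded_linear_slice_op]]
  linear_diff[OF bounded_linear.linear[OF bounded_linear_slice_op]]
  linear_scale[OF bounded_linear.linear[OF bounded_linear_slice_op]]

lemma slice_op_one [simp]: "slice_op I cop_one = id_blinfun"
  by (simp add: slice_op_def cop_one_def)

lemma slice_op_real [simp]: "slice_op I (X, 0) = real_op X"
  by (simp add: slice_op_def)

text \<open>Like \<open>\<i>\<close>, the operator \<open>imag_op I\<close> squares to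
  \<open>-1\<close> and commutes with all operators acting coefficientwise.\<close>

lemma slice_op_cmul:
  assumes "norm I = 1"
  shows "slice_op I (cmul p q) = slice_op I p o\<^sub>L slice_op I q"
proof -
  let ?J = "imag_op I" and ?A = "real_op (fst p)" and ?B = "real_op (snd p)" and ?C = "real_op (fst q)" and ?D = "real_op (snd q)"
  have 1: "?A o\<^sub>L (?J o\<^sub>L ?D) = ?J o\<^sub>L (?A o\<^sub>L ?D)"
    by (rule real_op_imag_op_left)
  have 2: "(?J o\<^sub>L ?B) o\<^sub>L ?C = ?J o\<^sub>L (?B o\<^sub>L ?C)" by (rule blinfun_compose_assoc)
  have "(?J o\<^sub>L ?B) o\<^sub>L (?J o\<^sub>L ?D) = (?J o\<^sub>L ?J) o\<^sub>L (?B o\<^sub>L ?D)"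
    by (simp add: blinfun_compose_assoc real_op_imag_op_left)
  then have 3: "(?J o\<^sub>L ?B) o\<^sub>L (?J o\<^sub>L ?D) = - (?B o\<^sub>L ?D)"
    by (simp add: imag_op_square[OF assms] blinfun_compose.minus_left)
  show ?thesis
    by (simp add: slice_op_def cmul_def real_op_add real_op_diff real_op_compose blinfun_compose.add_left
      blinfun_compose.add_right 1 2 3)
qed

lemma slice_op_cpow:
  assumes "norm I = 1"
  shows "slice_op I (cpow p n) = bl_pow (slice_op I p) n"
  by (induction n) (simp_all add: bl_pow_def slice_op_cmul[OF assms])

lemma cl_left_slice_pt: "cl_left (para (slice_pt I z)) = slice_op I (cop.cscale z cop_one)"
proof -
  have "para (slice_pt I z) = axis {} (Re z) + Im z *\<^sub>R para (0, I)"
    by (auto simp: para_def slice_pt_def vec_eq_iff axis_def sum_distrib_left intro!: sum.cong)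
  then show ?thesis
    by (simp add: cl_left_add cl_left_scalar cl_left_scaleR slice_op_def cscale_pair cop_one_def
       imag_op_def real_op_scaleR blinfun_compose.scaleR_right)
qed

lemma para_op_eq: "para_op T0 Tv = real_op T0 + (\<Sum>\<mu>\<in>UNIV. real_op (Tv \<mu>) o\<^sub>L gen_op \<mu>)"
  by (simp add: para_op_def cl_op_add cl_op_sum cl_op_axis)

definition norm_op :: "('v::banach \<Rightarrow>\<^sub>L 'v) \<Rightarrow> ('n::{finite,linorder} \<Rightarrow> 'v \<Rightarrow>\<^sub>L 'v) \<Rightarrow> 'v \<Rightarrow>\<^sub>L 'v" where
  "norm_op T0 Tv = (T0 o\<^sub>L T0) + (\<Sum>\<mu>\<in>UNIV. Tv \<mu> o\<^sub>L Tv \<mu>)"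

text \<open>With \<open>V\<close> the vector part this is \<open>(T0 + V) (T0 - V)\<close>, where
  \<open>V\<close> commutes with \<open>T0\<close> and \<open>V^2\<close> is minus the sum of the
  squares of its components.\<close>

lemma para_op_conj_op:
  fixes T0 :: "'v::banach \<Rightarrow>\<^sub>L 'v" and Tv :: "'n::{finite,linorder} \<Rightarrow> 'v \<Rightarrow>\<^sub>L 'v"
  assumes "commuting_components T0 Tv"
  shows "para_op T0 Tv o\<^sub>L conj_op T0 Tv = real_op (norm_op T0 Tv)"
proof -
  let ?V = "\<Sum>\<mu>\<in>UNIV. real_op (Tv \<mu>) o\<^sub>L gen_op \<mu>"
  have conj: "conj_op T0 Tv = real_op T0 - ?V"
    by (simp add: para_op_eq real_op_minus blinfun_compose.minus_left sum_negf)
  have comm: "?V o\<^sub>L real_op T0 = real_op T0 o\<^sub>L ?V"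
  proof -
    have "(real_op (Tv \<mu>) o\<^sub>L gen_op \<mu>) o\<^sub>L real_op T0 = real_op T0 o\<^sub>L (real_op (Tv \<mu>) o\<^sub>L gen_op \<mu>)" for \<mu>
    proof -
      have "(real_op (Tv \<mu>) o\<^sub>L gen_op \<mu>) o\<^sub>L real_op T0 = (real_op (Tv \<mu>) o\<^sub>L real_op T0) o\<^sub>L gen_op \<mu>"
        by (simp add: blinfun_compose_assoc real_op_cl_left real_op_cl_left_left)
      also have "real_op (Tv \<mu>) o\<^sub>L real_op T0 = real_op T0 o\<^sub>L (real_op (Tv \<mu>) :: ('v, 'n) cmodule \<Rightarrow>\<^sub>L ('v, 'n) cmodule)"
        using assms by (simp add: commuting_components_def flip: real_op_compose)
      finally show ?thesis by (simp add: blinfun_compose_assoc)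
    qed
    then show ?thesis by (simp add: blinfun_compose.sum_left blinfun_compose.sum_right)
  qed
  have "?V o\<^sub>L ?V = - real_op (\<Sum>\<mu>\<in>UNIV. Tv \<mu> o\<^sub>L Tv \<mu>)"
    by (rule vector_op_square) (use assms in \<open>simp add: commuting_components_def\<close>)
  then show ?thesis
    by (simp add: conj para_op_eq[of T0 Tv] norm_op_def blinfun_compose.add_left blinfun_compose.diff_right
      comm real_op_add real_op_compose)
qed

text \<open>The polynomial \<open>z^2 - 2 z X + N\<close>, used with \<open>X = T0\<close> and
  \<open>N = norm_op T0 Tv\<close>; neither \<open>I\<close> nor a Clifford unit is left in
  it.\<close>

definition Q_pair :: "('v::banach \<Rightarrow>\<^sub>L 'v) \<Rightarrow> ('v \<Rightarrow>\<^sub>L 'v) \<Rightarrow> complex \<Rightarrow> 'v cop" where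
  "Q_pair X N z = cop.cscale (z\<^sup>2) cop_one + (cop.cscale (- 2 * z) (X, 0) + (N, 0))"

lemma Q_op_slice_pt:
  fixes T0 :: "'v::banach \<Rightarrow>\<^sub>L 'v" and Tv :: "'n::{finite,linorder} \<Rightarrow> 'v \<Rightarrow>\<^sub>L 'v"
  assumes "commuting_components T0 Tv" "norm I = 1"
  shows "Q_op T0 Tv (slice_pt I z) = slice_op I (Q_pair T0 (norm_op T0 Tv) z)"
proof -
  have "slice_op I (cop.cscale (z\<^sup>2) (cop_one :: 'v cop)) = slice_op I (cop.cscale z cop_one) o\<^sub>L slice_op I (cop.cscale z cop_one)"
    by (simp add: power2_eq_square cop.cscale_mult cmul_cscale flip: slice_op_cmul[OF assms(2)])
  moreover have "cop.cscale (- 2 * z) (T0, 0) = (- 2) *\<^sub>R cmul (cop.cscale z cop_one) (T0, 0)"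
    by (simp only: cmul_cscale cmul_one) (simp add: cscale_pair)
  then have "slice_op I (cop.cscale (- 2 * z) (T0, 0)) = - 2 *\<^sub>R (slice_op I (cop.cscale z cop_one) o\<^sub>L real_op T0)"
    by (simp only: slice_op_linear slice_op_cmul[OF assms(2)] slice_op_real)
  ultimately show ?thesis
    by (simp add: Q_op_def Q_pair_def cl_left_slice_pt para_op_conj_op[OF assms(1)] slice_op_linear)
qed

text \<open>The main involution \<open>e\<^sub>j \<mapsto> - e\<^sub>j\<close>: it turns invertibility at \<open>s\<close> into invertibility at the conjugate of \<open>s\<close>.\<close>

definition parity_op :: "('v::banach, 'n::{finite,linorder}) cmodule \<Rightarrow>\<^sub>L ('v, 'n) cmodule" where
  "parity_op = Blinfun (\<lambda>v. \<Sum>A\<in>UNIV. axis A ((- 1) ^ card A *\<^sub>R v $ A))"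

lemma parity_op_nth:
  fixes v :: "('v::banach, 'n::{finite,linorder}) cmodule"
  shows "blinfun_apply parity_op v $ C = (- 1) ^ card C *\<^sub>R v $ C"
proof -
  have "bounded_linear (\<lambda>v::('v, 'n) cmodule. \<Sum>A\<in>UNIV. axis A ((- 1) ^ card A *\<^sub>R v $ A))"
    by (intro bounded_linear_sum bounded_linear_compose[OF bounded_linear_axis]
      bounded_linear_compose[OF bounded_linear_scaleR_right] bounded_linear_vec_nth)
  moreover have "(axis A x :: ('v, 'n) cmodule) $ C = (if A = C then x else 0)" for A x
    by (simp add: axis_def)
  ultimately show ?thesis
    by (simp add: parity_op_def bounded_linear_Blinfun_apply)
qed

lemma parity_op_square: "parity_op o\<^sub>L parity_op = id_blinfun"
  by (rule cmodule_op_eqI) (simp add: parity_op_nth flip: power_mult_distrib)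

lemma parity_op_real_op: "parity_op o\<^sub>L real_op X = real_op X o\<^sub>L parity_op"
  by (rule cmodule_op_eqI) (simp add: parity_op_nth real_op_nth blinfun.scaleR_right)

text \<open>Multiplication by \<open>e_j\<close> adds or removes one index, which flips the parity
  of their number.\<close>

lemma parity_op_gen_op: "parity_op o\<^sub>L gen_op j = - (gen_op j o\<^sub>L parity_op)"
proof (rule cmodule_op_eqI)
  fix v :: "('a, 'b) cmodule" and C
  have "(- 1 :: real) ^ card (sdiff {j} C) = - ((- 1) ^ card C)"
  proof (cases "j \<in> C")
    case True
    then have "sdiff {j} C = C - {j}" "card C = Suc (card (C - {j}))"
      using card_Suc_Diff1[of C j] by auto
    then show ?thesis by simp
  next
    case False
    then have "sdiff {j} C = insert j C" by auto
    then show ?thesis using False by simp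
  qed
  then show "blinfun_apply (parity_op o\<^sub>L gen_op j) v $ C = blinfun_apply (- (gen_op j o\<^sub>L parity_op)) v $ C"
    by (simp add: parity_op_nth cl_left_axis_nth blinfun.minus_left mult_ac)
qed

lemma parity_op_slice_op:
  fixes p :: "'v::banach cop" and I :: "real ^ 'n::{finite,linorder}"
  shows "parity_op o\<^sub>L slice_op I p = slice_op I (cop_cnj p) o\<^sub>L parity_op"
proof -
  have "parity_op o\<^sub>L (real_op X o\<^sub>L gen_op j) = - ((real_op X o\<^sub>L gen_op j) o\<^sub>L parity_op)"
    for X :: "'v \<Rightarrow>\<^sub>L 'v" and j :: 'n
  proof -
    have "parity_op o\<^sub>L (real_op X o\<^sub>L gen_op j) = (real_op X o\<^sub>L parity_op) o\<^sub>L gen_op j"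
      by (simp add: parity_op_real_op flip: blinfun_compose_assoc)
    then show ?thesis by (simp add: blinfun_compose_assoc parity_op_gen_op blinfun_compose.minus_right)
  qed
  then have "parity_op o\<^sub>L imag_op I = - (imag_op I o\<^sub>L (parity_op :: ('v, 'n) cmodule \<Rightarrow>\<^sub>L ('v, 'n) cmodule))"
    by (simp add: imag_op_eq_sum blinfun_compose.sum_left blinfun_compose.sum_right sum_negf)
  then have "parity_op o\<^sub>L (imag_op I o\<^sub>L real_op (snd p)) = - ((imag_op I o\<^sub>L real_op (snd p)) o\<^sub>L parity_op)"
    by (simp add: blinfun_compose.minus_left parity_op_real_op flip: blinfun_compose_assoc)
      (simp add: blinfun_compose_assoc parity_op_real_op)
  then show ?thesis
    by (simp add: slice_op_def cop_cnj_def blinfun_compose.add_left blinfun_compose.add_right parity_op_real_op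
      real_op_minus blinfun_compose.diff_left blinfun_compose.minus_left blinfun_compose.minus_right)
qed

text \<open>The coefficient of index \<open>{}\<close> is a copy of \<open>V\<close> in
  \<open>V_n\<close>: the inverse embeds \<open>x\<close> there, applies \<open>Z\<close> and reads
  that coefficient off again.\<close>

lemma real_op_inverse:
  fixes c :: "'v::banach \<Rightarrow>\<^sub>L 'v"
  assumes "bl_inverses (real_op c :: ('v, 'n::{finite,linorder}) cmodule \<Rightarrow>\<^sub>L ('v, 'n) cmodule) Z"
  obtains d where "bl_inverses c d"
proof -
  define d where "d = Blinfun (\<lambda>x. blinfun_apply Z (axis {} x) $ {})"
  have "bounded_linear (\<lambda>x. blinfun_apply Z (axis {} x) $ {})"
    by (intro bounded_linear_compose[OF bounded_linear_vec_nth] bounded_linear_compose[OF blinfun.bounded_linear_right]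
      bounded_linear_axis)
  then have d: "blinfun_apply d x = blinfun_apply Z (axis {} x) $ {}" for x
    by (simp add: d_def bounded_linear_Blinfun_apply)
  have Z: "blinfun_apply (real_op c) (blinfun_apply Z w) = w" "blinfun_apply Z (blinfun_apply (real_op c) w) = w" for w
    using assms unfolding bl_inverses_def by (metis blinfun_apply_blinfun_compose blinfun_apply_id_blinfun)+
  have ax: "blinfun_apply (real_op c) (axis {} x) = axis {} (blinfun_apply c x)" for x
    by (simp add: vec_eq_iff real_op_nth axis_def)
  have "blinfun_apply c (blinfun_apply d x) = x" for x
    using Z(1)[of "axis {} x"] real_op_nth[of c "blinfun_apply Z (axis {} x)" "{}"] by (simp add: d)
  moreover have "blinfun_apply d (blinfun_apply c x) = x" for x
    using Z(2)[of "axis {} x"] by (simp add: d ax)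
  ultimately have "bl_inverses c d"
    by (auto simp: bl_inverses_def intro!: blinfun_eqI)
  then show thesis by (rule that)
qed

text \<open>For commuting components this is \<open>p\<close> times its conjugate, the analogue of
  \<open>|z|^2\<close>.\<close>

definition det_op :: "'v::banach cop \<Rightarrow> 'v \<Rightarrow>\<^sub>L 'v" where
  "det_op p = (fst p o\<^sub>L fst p) + (snd p o\<^sub>L snd p)"

text \<open>The main involution makes the conjugate of \<open>p\<close> invertible along with
  \<open>p\<close>, hence also their product \<open>det_op p\<close>, which acts coefficientwise.
  The conclusion no longer involves \<open>I\<close>.\<close>

lemma det_op_invertible:
  assumes comm: "fst p o\<^sub>L snd p = snd p o\<^sub>L fst p" and I: "norm I = 1" and Y: "bl_inverses (slice_op I p) Y"
  obtains d where "bl_inverses (det_op p) d"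
proof -
  have cnj: "slice_op I (cop_cnj p) = parity_op o\<^sub>L (slice_op I p o\<^sub>L parity_op)"
  proof -
    have "parity_op o\<^sub>L (slice_op I p o\<^sub>L parity_op) = (slice_op I (cop_cnj p) o\<^sub>L parity_op) o\<^sub>L parity_op"
      by (simp add: parity_op_slice_op flip: blinfun_compose_assoc)
    then show ?thesis by (simp add: blinfun_compose_assoc parity_op_square)
  qed
  have "bl_inverses parity_op parity_op" by (simp add: bl_inverses_def parity_op_square)
  then have "bl_inverses (slice_op I (cop_cnj p)) ((parity_op o\<^sub>L Y) o\<^sub>L parity_op)"
    unfolding cnj by (intro bl_inverses_comp Y)
  then have "bl_inverses (slice_op I p o\<^sub>L slice_op I (cop_cnj p)) (((parity_op o\<^sub>L Y) o\<^sub>L parity_op) o\<^sub>L Y)"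
    by (intro bl_inverses_comp Y)
  moreover have "slice_op I p o\<^sub>L slice_op I (cop_cnj p) = real_op (det_op p)"
    using comm by (simp add: cop_cnj_def cmul_def det_op_def blinfun_compose_simps flip: slice_op_cmul[OF I])
  ultimately have "bl_inverses (real_op (det_op p)) (((parity_op o\<^sub>L Y) o\<^sub>L parity_op) o\<^sub>L Y)" by simp
  from real_op_inverse[OF this] that show thesis by blast
qed

text \<open>With \<open>d\<close> on the left one has a left inverse, with \<open>d\<close> on the
  right a right inverse. The two must agree, which spares showing that \<open>d\<close> commutes
  with the components.\<close>

lemma cop_inverse:
  assumes comm: "fst p o\<^sub>L snd p = snd p o\<^sub>L fst p" and d: "bl_inverses (det_op p) d"
  shows "cmul p (cmul (d, 0) (cop_cnj p)) = cop_one" "cmul (cmul (d, 0) (cop_cnj p)) p = cop_one"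
proof -
  have l: "cmul (cmul (d, 0) (cop_cnj p)) p = cop_one"
    using comm d by (simp add: cmul_assoc) (simp add: cmul_def cop_cnj_def cop_one_def det_op_def bl_inverses_def blinfun_compose_simps)
  have "cmul p (cmul (cop_cnj p) (d, 0)) = cop_one"
    using comm d by (simp flip: cmul_assoc) (simp add: cmul_def cop_cnj_def cop_one_def det_op_def bl_inverses_def blinfun_compose_simps)
  then have "cmul (cop_cnj p) (d, 0) = cmul (d, 0) (cop_cnj p)"
    using l by (metis cmul_assoc cmul_one)
  then show "cmul p (cmul (d, 0) (cop_cnj p)) = cop_one" "cmul (cmul (d, 0) (cop_cnj p)) p = cop_one"
    using l \<open>cmul p (cmul (cop_cnj p) (d, 0)) = cop_one\<close> by simp_all
qed

section \<open>The resolvent kernels on a slice\<close>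

text \<open>Invertibility is tested on \<open>V\<close>, so that one set serves all
  \<open>I\<close>.\<close>

definition resolvent_dom :: "('v::banach \<Rightarrow>\<^sub>L 'v) \<Rightarrow> ('v \<Rightarrow>\<^sub>L 'v) \<Rightarrow> complex set" where
  "resolvent_dom X N = {z. \<exists>d. bl_inverses (det_op (Q_pair X N z)) d}"

definition Q_pair_inv :: "('v::banach \<Rightarrow>\<^sub>L 'v) \<Rightarrow> ('v \<Rightarrow>\<^sub>L 'v) \<Rightarrow> complex \<Rightarrow> 'v cop" where
  "Q_pair_inv X N z = cmul (bl_inv (det_op (Q_pair X N z)), 0) (cop_cnj (Q_pair X N z))"

definition kernel :: "('v::banach \<Rightarrow>\<^sub>L 'v) \<Rightarrow> ('v \<Rightarrow>\<^sub>L 'v) \<Rightarrow> nat \<Rightarrow> nat \<Rightarrow> complex \<Rightarrow> 'v cop" where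
  "kernel X N \<nu> l z = cmul (cpow (cop.cscale z cop_one + (- X, 0)) \<nu>) (cpow (Q_pair_inv X N z) l)"

lemma Q_pair_cnj: "cop_cnj (Q_pair X N z) = Q_pair X N (cnj z)"
  by (simp add: Q_pair_def cop_cnj_def cscale_pair cop_one_def power2_eq_square algebra_simps)

lemma det_op_cnj: "det_op (Q_pair X N (cnj z)) = det_op (Q_pair X N z)"
  unfolding Q_pair_cnj[symmetric] by (simp add: det_op_def cop_cnj_def blinfun_compose_simps)

lemma Q_pair_commute:
  assumes "X o\<^sub>L N = N o\<^sub>L X"
  shows "fst (Q_pair X N z) o\<^sub>L snd (Q_pair X N z) = snd (Q_pair X N z) o\<^sub>L fst (Q_pair X N z)"
  using assms by (simp add: Q_pair_def cscale_pair cop_one_def blinfun_compose_simps algebra_simps)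

lemma norm_op_commute: "commuting_components T0 Tv \<Longrightarrow> T0 o\<^sub>L norm_op T0 Tv = norm_op T0 Tv o\<^sub>L T0"
  unfolding commuting_components_def norm_op_def blinfun_compose.add_left blinfun_compose.add_right
    blinfun_compose.sum_left blinfun_compose.sum_right blinfun_compose_assoc
  by (metis (no_types, lifting) blinfun_compose_assoc sum.cong)

lemma resolvent_dom_cnj: "cnj z \<in> resolvent_dom X N \<longleftrightarrow> z \<in> resolvent_dom X N"
  by (simp add: resolvent_dom_def det_op_cnj)

lemma Q_pair_inv_cnj: "cop_cnj (Q_pair_inv X N z) = Q_pair_inv X N (cnj z)"
  by (simp add: Q_pair_inv_def cop_cnj_cmul det_op_cnj Q_pair_cnj) (simp add: cop_cnj_def)

lemma kernel_cnj: "cop_cnj (kernel X N \<nu> l z) = kernel X N \<nu> l (cnj z)"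
proof -
  have "cop_cnj (cop.cscale z cop_one + (- X, 0)) = cop.cscale (cnj z) cop_one + (- X, 0)"
    by (simp add: cop_cnj_def cscale_pair cop_one_def)
  then show ?thesis by (simp add: kernel_def cop_cnj_cmul cop_cnj_cpow Q_pair_inv_cnj)
qed

lemma holo_Q_pair: "cop.holo UNIV (Q_pair X N)"
  unfolding Q_pair_def[abs_def]
  by (intro cop.holo_add cop.holo_cscale cop.holo_const holomorphic_intros open_UNIV)

lemma Q_pair_continuous: "continuous_on S (Q_pair X N)"
  using cop.holo_continuous_on[OF holo_Q_pair] continuous_on_subset by blast

lemma det_op_continuous: "continuous_on UNIV (\<lambda>z. det_op (Q_pair X N z))"
  unfolding det_op_def
  by (intro continuous_intros blinfun_compose.continuous_on Q_pair_continuous)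

lemma open_resolvent_dom: "open (resolvent_dom X N)"
  unfolding resolvent_dom_def by (rule bl_inverses_open_continuous(1)[OF det_op_continuous])

lemma Q_pair_inv_inverse:
  assumes "X o\<^sub>L N = N o\<^sub>L X" "z \<in> resolvent_dom X N"
  shows "cmul (Q_pair X N z) (Q_pair_inv X N z) = cop_one" "cmul (Q_pair_inv X N z) (Q_pair X N z) = cop_one"
proof -
  obtain d where d: "bl_inverses (det_op (Q_pair X N z)) d" using assms(2) by (auto simp: resolvent_dom_def)
  show "cmul (Q_pair X N z) (Q_pair_inv X N z) = cop_one" "cmul (Q_pair_inv X N z) (Q_pair X N z) = cop_one"
    unfolding Q_pair_inv_def bl_inv_eq[OF d] by (rule cop_inverse[OF Q_pair_commute[OF assms(1)] d])+
qed

text \<open>The defining formula contains a conjugate, so it yields continuity only; holomorphy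
  comes from being the inverse of a holomorphic function.\<close>

lemma holo_Q_pair_inv:
  assumes "X o\<^sub>L N = N o\<^sub>L X"
  shows "cop.holo (resolvent_dom X N) (Q_pair_inv X N)"
proof (rule holo_inverse[OF cop.holo_subset[OF holo_Q_pair subset_UNIV] _ open_resolvent_dom Q_pair_inv_inverse[OF assms]])
  have "continuous_on (resolvent_dom X N) (\<lambda>z. bl_inv (det_op (Q_pair X N z)))"
    unfolding resolvent_dom_def by (rule bl_inverses_open_continuous(2)[OF det_op_continuous])
  then show "continuous_on (resolvent_dom X N) (Q_pair_inv X N)"
    unfolding Q_pair_inv_def[abs_def]
    by (intro cmul.continuous_on continuous_on_Pair continuous_on_const bounded_linear.continuous_on[OF bounded_linear_cop_cnj]
      Q_pair_continuous)
qed

lemma holo_kernel: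
  assumes "X o\<^sub>L N = N o\<^sub>L X"
  shows "cop.holo (resolvent_dom X N) (kernel X N \<nu> l)"
  unfolding kernel_def[abs_def]
  by (intro holo_cmul holo_cpow holo_Q_pair_inv assms cop.holo_add cop.holo_cscale cop.holo_const
    open_resolvent_dom holomorphic_intros)

lemma S_resolvent_set_subset_resolvent_dom:
  assumes "commuting_components T0 Tv" "norm I = 1" "slice_pt I z \<in> S_resolvent_set T0 Tv"
  shows "z \<in> resolvent_dom T0 (norm_op T0 Tv)"
proof -
  obtain Y where "bl_inverses (slice_op I (Q_pair T0 (norm_op T0 Tv) z)) Y"
    using assms(3) by (auto simp: S_resolvent_set_def Q_op_slice_pt[OF assms(1,2)])
  then show ?thesis
    using det_op_invertible[OF Q_pair_commute[OF norm_op_commute[OF assms(1)]] assms(2)]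
    unfolding resolvent_dom_def by blast
qed

lemma bl_inv_Q_op:
  assumes "commuting_components T0 Tv" "norm I = 1" "z \<in> resolvent_dom T0 (norm_op T0 Tv)"
  shows "bl_inv (Q_op T0 Tv (slice_pt I z)) = slice_op I (Q_pair_inv T0 (norm_op T0 Tv) z)"
  unfolding Q_op_slice_pt[OF assms(1,2)]
  by (rule bl_inv_eq)
    (simp add: bl_inverses_def Q_pair_inv_inverse[OF norm_op_commute[OF assms(1)] assms(3)] flip: slice_op_cmul[OF assms(2)])

lemma K2_slice_pt:
  assumes "commuting_components T0 Tv" "norm I = 1" "z \<in> resolvent_dom T0 (norm_op T0 Tv)"
  shows "K2 T0 Tv \<nu> l (slice_pt I z) = slice_op I (kernel T0 (norm_op T0 Tv) \<nu> l z)"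
proof -
  have "cl_left (para (slice_pt I z)) - real_op T0 = slice_op I (cop.cscale z cop_one + (- T0, 0))"
    by (simp add: cl_left_slice_pt slice_op_linear real_op_minus)
  then show ?thesis
    by (simp add: K2_def kernel_def bl_inv_Q_op[OF assms] slice_op_cmul[OF assms(2)] slice_op_cpow[OF assms(2)])
qed

section \<open>The common plane of all slices and the coefficients of the function\<close>

definition plane :: "'n::{finite,linorder} paravector set \<Rightarrow> complex set" where
  "plane W = {z. (Re z, Im z) \<in> slice_dom W}"

lemma slice_eq_plane:
  assumes "axially_symmetric W" "I \<in> sphere 0 1"
  shows "slice W I = plane W"
proof -
  have "(Re z, Im z *\<^sub>R L) \<in> W" if z: "(Re z, Im z *\<^sub>R I) \<in> W" and L: "L \<in> sphere 0 1" for z L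
  proof -
    \<comment> \<open>Axial symmetry speaks of nonnegative multiples of unit vectors, so the sign of
      \<open>Im z\<close> is moved into the vector.\<close>
    have "(if Im z \<ge> 0 then L else - L) \<in> sphere 0 1" using L by simp
    then have "(Re z, norm (Im z *\<^sub>R I) *\<^sub>R (if Im z \<ge> 0 then L else - L)) \<in> W"
      using assms(1) z unfolding axially_symmetric_def by fastforce
    moreover have "norm (Im z *\<^sub>R I) *\<^sub>R (if Im z \<ge> 0 then L else - L) = Im z *\<^sub>R L"
      using assms(2) by simp
    ultimately show ?thesis by simp
  qed
  then show ?thesis
    using assms(2) by (auto simp: slice_def plane_def slice_dom_def slice_pt_def)
qed

lemma cnj_in_plane: "cnj z \<in> plane W \<longleftrightarrow> z \<in> plane W"
proof -
  have "(\<forall>I\<in>sphere 0 1. (Re z, - (Im z *\<^sub>R I)) \<in> W) \<longleftrightarrow> (\<forall>I\<in>sphere 0 1. (Re z, Im z *\<^sub>R I) \<in> W)"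
    by (metis (no_types, opaque_lifting) add.inverse_inverse dist_0_norm mem_sphere norm_minus_cancel scaleR_minus_right)
  then show ?thesis by (simp add: plane_def slice_dom_def)
qed

lemma continuous_on_slice_pt: "continuous_on S (slice_pt I)"
  unfolding slice_pt_def[abs_def] by (intro continuous_intros)

lemma slice_eq_vimage: "slice W I = slice_pt I -` W"
  by (auto simp: slice_def)

lemma open_slice: "open W \<Longrightarrow> open (slice W I)"
  unfolding slice_eq_vimage by (intro open_vimage continuous_on_slice_pt)

lemma closure_slice_subset: "closure (slice W I) \<subseteq> slice (closure W) I"
  unfolding slice_eq_vimage
  by (intro closure_minimal closed_vimage continuous_on_slice_pt closed_closure vimage_mono closure_subset)

lemma bounded_slice:
  assumes "bounded W" "norm I = 1"
  shows "bounded (slice W I)"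
proof -
  have "norm z = norm (slice_pt I z)" for z
    using assms(2) by (simp add: slice_pt_def norm_Pair cmod_def)
  then show ?thesis using assms(1) by (auto simp: bounded_iff slice_def)
qed

definition holo_components :: "'n::{finite,linorder} paravector set \<Rightarrow> ('n paravector \<Rightarrow> 'n clifford) \<Rightarrow> ('n set \<Rightarrow> complex \<Rightarrow> complex) \<Rightarrow> bool" where
  "holo_components W f F \<longleftrightarrow> (\<forall>C. F C holomorphic_on plane W \<and> (\<forall>z\<in>plane W. F C (cnj z) = cnj (F C z))) \<and>
    (\<forall>I\<in>sphere 0 1. \<forall>z\<in>plane W. f (slice_pt I z) =
       (\<chi> C. Re (F C z)) + cl_mult (para (0, I)) (\<chi> C. Im (F C z)))"

text \<open>In each coefficient the system for \<open>A\<close> and \<open>B\<close> is the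
  Cauchy-Riemann system for \<open>A + \<i> B\<close>; evenness of \<open>A\<close> and oddness of
  \<open>B\<close> become the reflection symmetry.\<close>

lemma left_slice_hyperholomorphic_components:
  assumes "left_slice_hyperholomorphic W f"
  obtains F where "holo_components W f F"
proof -
  obtain A B :: "real \<times> real \<Rightarrow> 'a clifford" and A' B' where
    AB: "\<And>p. p \<in> slice_dom W \<Longrightarrow> (A has_derivative blinfun_apply (A' p)) (at p)"
        "\<And>p. p \<in> slice_dom W \<Longrightarrow> (B has_derivative blinfun_apply (B' p)) (at p)"
        "\<And>p. p \<in> slice_dom W \<Longrightarrow> A (fst p, - snd p) = A p" "\<And>p. p \<in> slice_dom W \<Longrightarrow> B (fst p, - snd p) = - B p"
        "\<And>p. p \<in> slice_dom W \<Longrightarrow> blinfun_apply (A' p) (1, 0) = blinfun_apply (B' p) (0, 1)"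
        "\<And>p. p \<in> slice_dom W \<Longrightarrow> blinfun_apply (A' p) (0, 1) = - blinfun_apply (B' p) (1, 0)"
        "\<And>p I. p \<in> slice_dom W \<Longrightarrow> I \<in> sphere 0 1 \<Longrightarrow> f (fst p, snd p *\<^sub>R I) = A p + cl_mult (para (0, I)) (B p)"
    using assms unfolding left_slice_hyperholomorphic_def by blast
  define F where "F C z = Complex (A (Re z, Im z) $ C) (B (Re z, Im z) $ C)" for C z
  have "(F C has_field_derivative Complex (blinfun_apply (A' (Re z, Im z)) (1, 0) $ C) (blinfun_apply (B' (Re z, Im z)) (1, 0) $ C)) (at z)"
    if z: "z \<in> plane W" for C z
  proof -
    let ?p = "(Re z, Im z)"
    have p: "?p \<in> slice_dom W" using z by (simp add: plane_def)
    have bl: "bounded_linear (\<lambda>z. (Re z, Im z))"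
      by (intro bounded_linear_Pair bounded_linear_Re bounded_linear_Im)
    have d: "((\<lambda>z. A (Re z, Im z) $ C) has_derivative (\<lambda>h. blinfun_apply (A' ?p) (Re h, Im h) $ C)) (at z)"
      "((\<lambda>z. B (Re z, Im z) $ C) has_derivative (\<lambda>h. blinfun_apply (B' ?p) (Re h, Im h) $ C)) (at z)"
      by (intro bounded_linear.has_derivative[OF bounded_linear_vec_nth]
        has_derivative_compose[OF bounded_linear_imp_has_derivative[OF bl]] AB(1,2)[OF p])+
    have F_eq: "F C = (\<lambda>z. of_real (A (Re z, Im z) $ C) + \<i> * of_real (B (Re z, Im z) $ C))"
      by (auto simp: F_def complex_eq_iff)
    have "(F C has_derivative (\<lambda>h. of_real (blinfun_apply (A' ?p) (Re h, Im h) $ C)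
        + \<i> * of_real (blinfun_apply (B' ?p) (Re h, Im h) $ C))) (at z)"
      unfolding F_eq
      by (intro has_derivative_add has_derivative_mult_right has_derivative_of_real d)
    moreover have "of_real (blinfun_apply (A' ?p) (Re h, Im h) $ C) + \<i> * of_real (blinfun_apply (B' ?p) (Re h, Im h) $ C)
      = Complex (blinfun_apply (A' ?p) (1, 0) $ C) (blinfun_apply (B' ?p) (1, 0) $ C) * h" for h
    proof -
      have "(Re h, Im h) = Re h *\<^sub>R (1, 0) + Im h *\<^sub>R (0, 1)" by simp
      then have "blinfun_apply X (Re h, Im h) = Re h *\<^sub>R blinfun_apply X (1, 0) + Im h *\<^sub>R blinfun_apply X (0, 1)"
        for X :: "(real \<times> real) \<Rightarrow>\<^sub>L 'a clifford"
        by (metis blinfun.add_right blinfun.scaleR_right)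
      then show ?thesis using AB(5,6)[OF p]
        by (simp add: complex_eq_iff algebra_simps)
    qed
    ultimately show ?thesis by (simp add: has_field_derivative_def)
  qed
  then have "F C holomorphic_on plane W" for C
    unfolding holomorphic_on_def field_differentiable_def using has_field_derivative_at_within by blast
  moreover have "F C (cnj z) = cnj (F C z)" if "z \<in> plane W" for C z
    using AB(3,4)[of "(Re z, Im z)"] that by (simp add: F_def plane_def complex_eq_iff)
  moreover have "f (slice_pt I z) = (\<chi> C. Re (F C z)) + cl_mult (para (0, I)) (\<chi> C. Im (F C z))"
    if "z \<in> plane W" "I \<in> sphere 0 1" for I z
    using AB(7)[of "(Re z, Im z)" I] that by (simp add: F_def plane_def slice_pt_def)
  ultimately have "holo_components W f F" by (simp add: holo_components_def)
  then show thesis by (rule that)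
qed

text \<open>With \<open>e_C\<close> as the last factor, the part of \<open>f\<close> that depends on
  \<open>I\<close> stands next to the kernel and is absorbed by \<open>slice_op\<close>.\<close>

lemma cl_left_holo_components:
  assumes "holo_components W f F" "I \<in> sphere 0 1" "z \<in> plane W"
  shows "cl_left (f (slice_pt I z)) = (\<Sum>C\<in>UNIV. slice_op I (cop.cscale (F C z) cop_one) o\<^sub>L cl_left (axis C 1))"
proof -
  have e: "cl_left a = (\<Sum>C\<in>UNIV. a $ C *\<^sub>R cl_left (axis C 1))" for a :: "'a clifford"
  proof -
    have "a = (\<Sum>C\<in>UNIV. a $ C *\<^sub>R axis C 1)" by (simp add: basis_expansion flip: scalar_mult_eq_scaleR)
    then show ?thesis by (metis (no_types, lifting) cl_left_scaleR cl_left_sum sum.cong)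
  qed
  have "cl_left (f (slice_pt I z)) = cl_left (\<chi> C. Re (F C z)) + (imag_op I o\<^sub>L cl_left (\<chi> C. Im (F C z)))"
    using assms by (simp add: holo_components_def cl_left_add cl_left_mult imag_op_def)
  also have "\<dots> = (\<Sum>C\<in>UNIV. (Re (F C z) *\<^sub>R cl_left (axis C 1)) + (imag_op I o\<^sub>L (Im (F C z) *\<^sub>R cl_left (axis C 1))))"
    unfolding e[of "\<chi> C. Re (F C z)"] e[of "\<chi> C. Im (F C z)"] blinfun_compose.sum_right sum.distrib by simp
  also have "\<dots> = (\<Sum>C\<in>UNIV. slice_op I (cop.cscale (F C z) cop_one) o\<^sub>L cl_left (axis C 1))"
    by (intro sum.cong refl)
      (simp add: slice_op_def cscale_pair cop_one_def real_op_scaleR blinfun_compose.add_left blinfun_compose.scaleR_left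
        blinfun_compose.scaleR_right)
  finally show ?thesis .
qed

section \<open>Boundary integrals of symmetric kernels\<close>

locale symmetric_kernel =
  fixes k :: "complex \<Rightarrow> 'v::banach cop" and R \<Omega> :: "complex set" and F :: "'n::{finite,linorder} set \<Rightarrow> complex \<Rightarrow> complex"
  assumes open_R: "open R" and open_\<Omega>: "open \<Omega>" and holo_k: "cop.holo R k" and holo_F: "\<And>C. F C holomorphic_on \<Omega>"
    and cnj_R: "\<And>z. cnj z \<in> R \<longleftrightarrow> z \<in> R" and cnj_\<Omega>: "\<And>z. cnj z \<in> \<Omega> \<longleftrightarrow> z \<in> \<Omega>"
    and cnj_k: "\<And>z. cop_cnj (k z) = k (cnj z)" and cnj_F: "\<And>C z. z \<in> \<Omega> \<Longrightarrow> F C (cnj z) = cnj (F C z)"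
begin

text \<open>The factor \<open>- \<i>\<close> stems from \<open>ds_I = ds (- I)\<close>.\<close>

definition G :: "'n set \<Rightarrow> complex \<Rightarrow> 'v cop" where
  "G C z = cop.cscale (- \<i> * F C z) (k z)"

lemma open_S: "open (R \<inter> \<Omega>)"
  using open_R open_\<Omega> by auto

lemma holo_G: "cop.holo (R \<inter> \<Omega>) (G C)"
  unfolding G_def[abs_def]
  by (intro cop.holo_cscale open_S holomorphic_intros holomorphic_on_subset[OF holo_F] cop.holo_subset[OF holo_k]) auto

definition admissible :: "complex set \<Rightarrow> (real \<Rightarrow> complex) set \<Rightarrow> bool" where
  "admissible D \<Gamma> \<longleftrightarrow> oriented_boundary D \<Gamma> \<and> open D \<and> - R \<subseteq> D \<and> closure D \<subseteq> \<Omega> \<and> (\<forall>z. cnj z \<in> D \<longleftrightarrow> z \<in> D)"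

definition cycle_int :: "(real \<Rightarrow> complex) set \<Rightarrow> 'n set \<Rightarrow> 'v cop" where
  "cycle_int \<Gamma> C = (\<Sum>\<gamma>\<in>\<Gamma>. cop.path_int \<gamma> (G C))"

text \<open>Points outside \<open>R\<close> lie in \<open>D\<close> and points outside
  \<open>\<Omega>\<close> lie off its closure; the orientation fixes the winding sums there, and the
  curves on the frontier meet neither.\<close>

lemma admissibleD:
  assumes "admissible D \<Gamma>"
  shows "finite \<Gamma>" "\<And>\<gamma>. \<gamma> \<in> \<Gamma> \<Longrightarrow> valid_path \<gamma>" "\<And>\<gamma>. \<gamma> \<in> \<Gamma> \<Longrightarrow> pathfinish \<gamma> = pathstart \<gamma>"
    "\<And>\<gamma>. \<gamma> \<in> \<Gamma> \<Longrightarrow> path_image \<gamma> \<subseteq> R \<inter> \<Omega>"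
    "\<And>w. w \<notin> R \<Longrightarrow> (\<Sum>\<gamma>\<in>\<Gamma>. winding_number \<gamma> w) = 1" "\<And>w. w \<notin> \<Omega> \<Longrightarrow> (\<Sum>\<gamma>\<in>\<Gamma>. winding_number \<gamma> w) = 0"
proof -
  have D: "open D" "- R \<subseteq> D" "closure D \<subseteq> \<Omega>" "oriented_boundary D \<Gamma>" using assms by (auto simp: admissible_def)
  then show "finite \<Gamma>" "\<And>\<gamma>. \<gamma> \<in> \<Gamma> \<Longrightarrow> valid_path \<gamma>" "\<And>\<gamma>. \<gamma> \<in> \<Gamma> \<Longrightarrow> pathfinish \<gamma> = pathstart \<gamma>"
    "\<And>w. w \<notin> R \<Longrightarrow> (\<Sum>\<gamma>\<in>\<Gamma>. winding_number \<gamma> w) = 1" "\<And>w. w \<notin> \<Omega> \<Longrightarrow> (\<Sum>\<gamma>\<in>\<Gamma>. winding_number \<gamma> w) = 0"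
    by (auto simp: oriented_boundary_def jordan_family_def)
  have "frontier D \<subseteq> R \<inter> \<Omega>"
    using D(1-3) by (auto simp: frontier_def interior_open)
  then show "\<And>\<gamma>. \<gamma> \<in> \<Gamma> \<Longrightarrow> path_image \<gamma> \<subseteq> R \<inter> \<Omega>"
    using D(4) unfolding oriented_boundary_def by blast
qed

text \<open>The difference of two boundaries winds \<open>1 - 1\<close> times around points outside
  \<open>R\<close> and \<open>0 - 0\<close> times around points outside \<open>\<Omega>\<close>. The
  sum type keeps apart curves that occur in both.\<close>

lemma cycle_int_eq:
  assumes "admissible D\<^sub>1 \<Gamma>\<^sub>1" "admissible D\<^sub>2 \<Gamma>\<^sub>2"
  shows "cycle_int \<Gamma>\<^sub>1 C = cycle_int \<Gamma>\<^sub>2 C"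
proof -
  note 1 = admissibleD[OF assms(1)] and 2 = admissibleD[OF assms(2)]
  define c :: "(real \<Rightarrow> complex) + (real \<Rightarrow> complex) \<Rightarrow> real" where "c = case_sum (\<lambda>_. 1) (\<lambda>_. - 1)"
  have "(\<Sum>i\<in>\<Gamma>\<^sub>1 <+> \<Gamma>\<^sub>2. c i *\<^sub>R cop.path_int (case_sum id id i) (G C)) = 0"
  proof (rule cop.holo_Cauchy_cycle[OF open_S _ _ _ _ _ holo_G])
    show "finite (\<Gamma>\<^sub>1 <+> \<Gamma>\<^sub>2)" using 1 2 by simp
    show "path_image (case_sum id id i) \<subseteq> R \<inter> \<Omega>" if "i \<in> \<Gamma>\<^sub>1 <+> \<Gamma>\<^sub>2" for i
      using that 1(4) 2(4) by (elim PlusE) simp_all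
    fix w assume "w \<notin> R \<inter> \<Omega>"
    then have "(\<Sum>\<gamma>\<in>\<Gamma>\<^sub>1. winding_number \<gamma> w) = (\<Sum>\<gamma>\<in>\<Gamma>\<^sub>2. winding_number \<gamma> w)"
      using 1(5,6) 2(5,6) by (cases "w \<in> R") auto
    then show "(\<Sum>i\<in>\<Gamma>\<^sub>1 <+> \<Gamma>\<^sub>2. c i * winding_number (case_sum id id i) w) = 0"
      using 1(1) 2(1) by (simp add: sum.Plus c_def sum_negf)
  qed (use 1(2,3) 2(2,3) in auto)
  then show ?thesis
    using 1(1) 2(1) by (simp add: sum.Plus c_def cycle_int_def sum_negf)
qed

text \<open>Conjugation turns the factor \<open>- \<i>\<close> of \<open>G\<close> into
  \<open>\<i>\<close>, hence the minus sign. The derivative of the conjugated path is computed off a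
  finite set, which the integral ignores.\<close>

lemma cop_cnj_path_int:
  assumes \<gamma>: "valid_path \<gamma>" "path_image \<gamma> \<subseteq> R \<inter> \<Omega>"
  shows "cop_cnj (cop.path_int \<gamma> (G C)) = - cop.path_int (cnj \<circ> \<gamma>) (G C)"
proof -
  obtain E D where E: "finite E" and D: "\<And>t. t \<in> {0..1} - E \<Longrightarrow> (\<gamma> has_vector_derivative D t) (at t)"
    using \<gamma>(1) unfolding valid_path_def piecewise_C1_differentiable_on_def C1_differentiable_on_def by blast
  have int: "((\<lambda>t. cop_cnj (cop.cscale (vector_derivative \<gamma> (at t within {0..1})) (G C (\<gamma> t))))
      has_integral cop_cnj (cop.path_int \<gamma> (G C))) {0..1}"
    unfolding cop.path_int_def
    using has_integral_linear[OF integrable_integral[OF cop.holo_path_integrable[OF \<gamma> open_S holo_G]] bounded_linear_cop_cnj]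
    by (simp add: o_def)
  have eq: "cop_cnj (cop.cscale (vector_derivative \<gamma> (at t within {0..1})) (G C (\<gamma> t)))
     = - cop.cscale (vector_derivative (cnj \<circ> \<gamma>) (at t within {0..1})) (G C ((cnj \<circ> \<gamma>) t))" if t: "t \<in> {0..1} - E" for t
  proof -
    have "\<gamma> t \<in> \<Omega>" using \<gamma>(2) t by (auto simp: path_image_def)
    then have "cop_cnj (G C (\<gamma> t)) = - G C (cnj (\<gamma> t))"
      by (simp add: G_def cop_cnj_cscale cnj_k cnj_F) (simp add: cscale.minus_left)
    moreover have "((cnj \<circ> \<gamma>) has_vector_derivative cnj (D t)) (at t)"
      using bounded_linear.has_vector_derivative[OF bounded_linear_cnj D[OF t]] by (simp add: o_def)
    then have "vector_derivative (cnj \<circ> \<gamma>) (at t within {0..1}) = cnj (D t)"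
      using t by (intro vector_derivative_at_within_ivl) auto
    moreover have "vector_derivative \<gamma> (at t within {0..1}) = D t"
      using t by (intro vector_derivative_at_within_ivl[OF D]) auto
    ultimately show ?thesis by (simp add: cop_cnj_cscale cscale.minus_right)
  qed
  have "((\<lambda>t. - cop.cscale (vector_derivative (cnj \<circ> \<gamma>) (at t within {0..1})) (G C ((cnj \<circ> \<gamma>) t)))
      has_integral cop_cnj (cop.path_int \<gamma> (G C))) {0..1}"
    by (rule has_integral_spike_finite[OF E _ int]) (simp only: eq)
  then have "((\<lambda>t. cop.cscale (vector_derivative (cnj \<circ> \<gamma>) (at t within {0..1})) (G C ((cnj \<circ> \<gamma>) t)))
      has_integral - cop_cnj (cop.path_int \<gamma> (G C))) {0..1}"
    by (simp add: has_integral_neg_iff)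
  then show ?thesis
    unfolding cop.path_int_def[of "cnj \<circ> \<gamma>"] by (simp add: integral_unique)
qed

text \<open>The image of the cycle under conjugation, reversed, is another positively oriented boundary
  of the symmetric domain; so the integral of the symmetric integrand is real.\<close>

lemma snd_cycle_int:
  assumes "admissible D \<Gamma>"
  shows "snd (cycle_int \<Gamma> C) = 0"
proof -
  note 1 = admissibleD[OF assms]
  \<comment> \<open>The conjugate cycle is added, not subtracted: conjugation reverses orientation,
    so its winding numbers cancel those of \<open>\<Gamma>\<close>.\<close>
  have "(\<Sum>i\<in>\<Gamma> <+> \<Gamma>. 1 *\<^sub>R cop.path_int (case_sum id ((\<circ>) cnj) i) (G C)) = 0"
  proof (rule cop.holo_Cauchy_cycle[OF open_S _ _ _ _ _ holo_G])
    show "finite (\<Gamma> <+> \<Gamma>)" using 1 by simp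
    show "path_image (case_sum id ((\<circ>) cnj) i) \<subseteq> R \<inter> \<Omega>" if "i \<in> \<Gamma> <+> \<Gamma>" for i
    proof -
      have "z \<in> R \<and> z \<in> \<Omega>" if "\<gamma> \<in> \<Gamma>" "z \<in> path_image \<gamma>" for \<gamma> z
        using 1(4) that by blast
      then show ?thesis using that by (auto simp: path_image_compose cnj_R cnj_\<Omega>)
    qed
    fix w assume w: "w \<notin> R \<inter> \<Omega>"
    have "winding_number (cnj \<circ> \<gamma>) w = - cnj (winding_number \<gamma> (cnj w))" if "\<gamma> \<in> \<Gamma>" for \<gamma>
    proof -
      have "cnj w \<notin> path_image \<gamma>" using w 1(4)[OF that] by (metis IntD1 IntD2 IntI cnj_R cnj_\<Omega> subsetD)
      then show ?thesis
        using winding_number_cnj[of \<gamma> "cnj w"] valid_path_imp_path[OF 1(2)[OF that]] by simp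
    qed
    then have "(\<Sum>\<gamma>\<in>\<Gamma>. winding_number (cnj \<circ> \<gamma>) w) = - cnj (\<Sum>\<gamma>\<in>\<Gamma>. winding_number \<gamma> (cnj w))"
      by (simp add: sum_negf)
    \<comment> \<open>The sums are \<open>1\<close> outside \<open>R\<close> and \<open>0\<close>
      outside \<open>\<Omega>\<close>; these values are real and both complements are
      symmetric.\<close>
    also have "\<dots> = - (\<Sum>\<gamma>\<in>\<Gamma>. winding_number \<gamma> w)"
      using w 1(5,6) by (cases "w \<in> R") (simp_all add: cnj_R cnj_\<Omega>)
    finally show "(\<Sum>i\<in>\<Gamma> <+> \<Gamma>. complex_of_real 1 * winding_number (case_sum id ((\<circ>) cnj) i) w) = 0"
      using 1(1) by (simp add: sum.Plus)
  qed (use 1(2,3) in \<open>auto simp: valid_path_cnj pathfinish_compose pathstart_compose\<close>)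
  then have "cycle_int \<Gamma> C + (\<Sum>\<gamma>\<in>\<Gamma>. cop.path_int (cnj \<circ> \<gamma>) (G C)) = 0"
    using 1(1) by (simp add: sum.Plus cycle_int_def)
  moreover have "cop_cnj (cycle_int \<Gamma> C) = - (\<Sum>\<gamma>\<in>\<Gamma>. cop.path_int (cnj \<circ> \<gamma>) (G C))"
    using cop_cnj_path_int[OF 1(2,4)]
    by (simp add: cycle_int_def linear_sum[OF bounded_linear.linear[OF bounded_linear_cop_cnj]] sum_negf)
  ultimately have "cop_cnj (cycle_int \<Gamma> C) = cycle_int \<Gamma> C"
    by (metis add_eq_0_iff2)
  then have "- snd (cycle_int \<Gamma> C) = snd (cycle_int \<Gamma> C)"
    by (metis cop_cnj_def snd_conv)
  then have "2 *\<^sub>R snd (cycle_int \<Gamma> C) = 0"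
    by (metis add.left_inverse scaleR_2)
  then show ?thesis by simp
qed

text \<open>Kernel, tangent vector, \<open>- I\<close> and the coefficients of \<open>f\<close> are
  all images under \<open>slice_op\<close>, so their product is the image of one product; the map
  \<open>p \<mapsto> slice_op I p e_C\<close> is bounded linear and passes through the
  integral.\<close>

lemma slice_integrand_has_integral:
  assumes I: "I \<in> sphere 0 1" and \<gamma>: "valid_path \<gamma>" "path_image \<gamma> \<subseteq> R \<inter> \<Omega>"
    and K: "\<And>z. z \<in> R \<Longrightarrow> K (slice_pt I z) = slice_op I (k z)"
    and f: "\<And>z. z \<in> \<Omega> \<Longrightarrow> cl_left (f (slice_pt I z)) = (\<Sum>C\<in>UNIV. slice_op I (cop.cscale (F C z) (cop_one :: 'v cop)) o\<^sub>L cl_left (axis C 1))"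
  shows "(slice_integrand K f I \<gamma> has_integral
    (\<Sum>C\<in>UNIV. slice_op I (cop.path_int \<gamma> (G C)) o\<^sub>L cl_left (axis C 1))) {0..1}"
proof -
  have I1: "norm I = 1" using I by simp
  have bl: "bounded_linear (\<lambda>p. slice_op I p o\<^sub>L cl_left (axis C 1))" for C
    by (intro bounded_linear_compose[OF blinfun_compose.bounded_linear_left] bounded_linear_slice_op)
  have int: "((\<lambda>t. \<Sum>C\<in>UNIV. slice_op I (cop.cscale (vector_derivative \<gamma> (at t within {0..1})) (G C (\<gamma> t))) o\<^sub>L cl_left (axis C 1))
    has_integral (\<Sum>C\<in>UNIV. slice_op I (cop.path_int \<gamma> (G C)) o\<^sub>L cl_left (axis C 1))) {0..1}"
    unfolding cop.path_int_def
    using has_integral_linear[OF integrable_integral[OF cop.holo_path_integrable[OF \<gamma> open_S holo_G]] bl]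
    by (intro has_integral_sum) (simp_all add: o_def)
  have eq: "slice_integrand K f I \<gamma> t
    = (\<Sum>C\<in>UNIV. slice_op I (cop.cscale (vector_derivative \<gamma> (at t within {0..1})) (G C (\<gamma> t))) o\<^sub>L cl_left (axis C 1))"
    if t: "t \<in> {0..1}" for t
  proof -
    let ?v = "vector_derivative \<gamma> (at t within {0..1})"
    have \<gamma>t: "\<gamma> t \<in> R" "\<gamma> t \<in> \<Omega>" using \<gamma>(2) t by (auto simp: path_image_def)
    have "(0, - I) = slice_pt I (- \<i>)" by (simp add: slice_pt_def)
    then have "cl_left (cl_mult (para (slice_pt I ?v)) (para (0, - I)))
        = slice_op I (cmul (cop.cscale ?v cop_one) (cop.cscale (- \<i>) cop_one))"
      by (simp only: cl_left_mult cl_left_slice_pt slice_op_cmul[OF I1])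
    also have "cmul (cop.cscale ?v cop_one) (cop.cscale (- \<i>) cop_one) = cop.cscale (?v * - \<i>) (cop_one :: 'v cop)"
      unfolding cmul_cscale(1) by (simp only: cmul_one cop.cscale_mult)
    finally have m: "cl_left (cl_mult (para (slice_pt I ?v)) (para (0, - I))) = slice_op I (cop.cscale (?v * - \<i>) (cop_one :: 'v cop))" .
    show ?thesis
      unfolding slice_integrand_def m f[OF \<gamma>t(2)] K[OF \<gamma>t(1)] blinfun_compose.sum_right
      by (simp add: cmul_cscale G_def flip: slice_op_cmul[OF I1] cop.cscale_mult blinfun_compose_assoc)
        (simp add: mult_ac)
  qed
  show ?thesis
    by (rule has_integral_eq[OF eq[symmetric] int])
qed

end

section \<open>Linear combinations of boundary integrals\<close>

definition boundary_integral_is ::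
  "'n::{finite,linorder} paravector set \<Rightarrow> 'n paravector set \<Rightarrow> ('n paravector \<Rightarrow> 'n clifford) \<Rightarrow>
    ('n paravector \<Rightarrow> ('v::banach, 'n) cmodule \<Rightarrow>\<^sub>L ('v, 'n) cmodule) \<Rightarrow> (('v, 'n) cmodule \<Rightarrow>\<^sub>L ('v, 'n) cmodule) \<Rightarrow> bool" where
  "boundary_integral_is \<Sigma> W f K X \<longleftrightarrow> (\<forall>I\<in>sphere 0 1. \<forall>U \<Gamma>. bounded U \<and> slice_cauchy_domain U \<and>
      \<Sigma> \<subseteq> U \<and> closure U \<subseteq> W \<and> oriented_boundary (slice U I) \<Gamma> \<longrightarrow>
      (\<forall>\<gamma>\<in>\<Gamma>. slice_integrand K f I \<gamma> integrable_on {0..1}) \<and>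
      (\<Sum>\<gamma>\<in>\<Gamma>. integral {0..1} (slice_integrand K f I \<gamma>)) = X)"

text \<open>With the value existential, the property is stable under sums, real multiples and
  suitable left factors, so resolvents can be treated term by term.\<close>

definition boundary_integral_ok ::
  "'n::{finite,linorder} paravector set \<Rightarrow> 'n paravector set \<Rightarrow> ('n paravector \<Rightarrow> 'n clifford) \<Rightarrow>
    ('n paravector \<Rightarrow> ('v::banach, 'n) cmodule \<Rightarrow>\<^sub>L ('v, 'n) cmodule) \<Rightarrow> bool" where
  "boundary_integral_ok \<Sigma> W f K \<longleftrightarrow> (\<exists>X\<in>B_Vn. boundary_integral_is \<Sigma> W f K X)"

lemma boundary_integral_ok_0: "boundary_integral_ok \<Sigma> W f (\<lambda>_. 0)"
  unfolding boundary_integral_ok_def boundary_integral_is_def slice_integrand_def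
  by (rule bexI[OF _ subspace_0[OF B_Vn_subspace]]) auto

lemma boundary_integral_is_add:
  assumes "boundary_integral_is \<Sigma> W f K X" "boundary_integral_is \<Sigma> W f L Y"
  shows "boundary_integral_is \<Sigma> W f (\<lambda>s. K s + L s) (X + Y)"
proof -
  have "slice_integrand (\<lambda>s. K s + L s) f I \<gamma> = (\<lambda>t. slice_integrand K f I \<gamma> t + slice_integrand L f I \<gamma> t)" for I \<gamma>
    by (simp add: slice_integrand_def blinfun_compose.add_left fun_eq_iff)
  then show ?thesis
    using assms unfolding boundary_integral_is_def
    by (simp add: integral_add integrable_add sum.distrib)
qed

lemma boundary_integral_ok_add:
  assumes "boundary_integral_ok \<Sigma> W f K" "boundary_integral_ok \<Sigma> W f L"
  shows "boundary_integral_ok \<Sigma> W f (\<lambda>s. K s + L s)"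
proof -
  obtain X Y where "X \<in> B_Vn" "Y \<in> B_Vn" "boundary_integral_is \<Sigma> W f K X" "boundary_integral_is \<Sigma> W f L Y"
    using assms by (auto simp: boundary_integral_ok_def)
  then show ?thesis
    unfolding boundary_integral_ok_def
    by (intro bexI[of _ "X + Y"] boundary_integral_is_add subspace_add[OF B_Vn_subspace])
qed

text \<open>A constant left factor leaves the integral because the kernel is the leftmost factor of
  the integrand.\<close>

lemma boundary_integral_is_compose:
  assumes "boundary_integral_is \<Sigma> W f K X"
  shows "boundary_integral_is \<Sigma> W f (\<lambda>s. T o\<^sub>L K s) (T o\<^sub>L X)"
proof -
  have "slice_integrand (\<lambda>s. T o\<^sub>L K s) f I \<gamma> = (o\<^sub>L) T \<circ> slice_integrand K f I \<gamma>" for I \<gamma>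
    by (simp add: slice_integrand_def blinfun_compose_assoc fun_eq_iff)
  moreover note bl = blinfun_compose.bounded_linear_right[of T]
  ultimately show ?thesis
    using assms unfolding boundary_integral_is_def
    by (simp add: integral_linear[OF _ bl] integrable_linear[OF _ bl] flip: blinfun_compose.sum_right)
qed

lemma boundary_integral_ok_compose:
  assumes "boundary_integral_ok \<Sigma> W f K" and T: "\<And>X. X \<in> B_Vn \<Longrightarrow> T o\<^sub>L X \<in> B_Vn"
  shows "boundary_integral_ok \<Sigma> W f (\<lambda>s. T o\<^sub>L K s)"
proof -
  obtain X where "X \<in> B_Vn" "boundary_integral_is \<Sigma> W f K X"
    using assms(1) by (auto simp: boundary_integral_ok_def)
  then show ?thesis
    unfolding boundary_integral_ok_def by (intro bexI[of _ "T o\<^sub>L X"] boundary_integral_is_compose T)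
qed

lemma boundary_integral_ok_scaleR:
  assumes "boundary_integral_ok \<Sigma> W f K"
  shows "boundary_integral_ok \<Sigma> W f (\<lambda>s. r *\<^sub>R K s)"
  using boundary_integral_ok_compose[OF assms, of "r *\<^sub>R id_blinfun"]
  by (simp add: blinfun_compose.scaleR_left subspace_scale[OF B_Vn_subspace])

lemma boundary_integral_ok_diff:
  "boundary_integral_ok \<Sigma> W f K \<Longrightarrow> boundary_integral_ok \<Sigma> W f L \<Longrightarrow> boundary_integral_ok \<Sigma> W f (\<lambda>s. K s - L s)"
  using boundary_integral_ok_add[OF _ boundary_integral_ok_scaleR, of \<Sigma> W f K L "-1"] by simp

lemma boundary_integral_ok_sum:
  assumes "\<And>i. i \<in> A \<Longrightarrow> boundary_integral_ok \<Sigma> W f (K i)"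
  shows "boundary_integral_ok \<Sigma> W f (\<lambda>s. \<Sum>i\<in>A. K i s)"
  using assms
  by (induction A rule: infinite_finite_induct) (simp_all add: boundary_integral_ok_0 boundary_integral_ok_add)

lemma boundary_integral_ok_kernel:
  fixes T0 :: "'v::banach \<Rightarrow>\<^sub>L 'v" and Tv :: "'n::{finite,linorder} \<Rightarrow> 'v \<Rightarrow>\<^sub>L 'v"
    and k :: "complex \<Rightarrow> 'v cop"
    and K :: "'n paravector \<Rightarrow> ('v, 'n) cmodule \<Rightarrow>\<^sub>L ('v, 'n) cmodule"
  assumes comm: "commuting_components T0 Tv" and f: "left_slice_hyperholomorphic W f"
    and k: "cop.holo (resolvent_dom T0 (norm_op T0 Tv)) k" "\<And>z. cop_cnj (k z) = k (cnj z)"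
    and K: "\<And>I z. norm I = 1 \<Longrightarrow> z \<in> resolvent_dom T0 (norm_op T0 Tv) \<Longrightarrow> K (slice_pt I z) = slice_op I (k z)"
  shows "boundary_integral_ok (S_spectrum T0 Tv) W f K"
proof -
  obtain F where F: "holo_components W f F" by (rule left_slice_hyperholomorphic_components[OF f])
  have W: "open W" "axially_symmetric W" using f by (auto simp: left_slice_hyperholomorphic_def)
  define R where "R = resolvent_dom T0 (norm_op T0 Tv)"
  \<comment> \<open>Some unit vector is needed to recognise the plane domain as a slice of the open
    set \<open>W\<close>.\<close>
  have "norm (axis undefined 1 :: (real, 'n) vec) = 1" by simp
  then have "open (plane W)"
    using open_slice[OF W(1)] slice_eq_plane[OF W(2)] by (metis mem_sphere_0)
  then interpret symmetric_kernel k R "plane W" F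
    using F k unfolding R_def holo_components_def
    by unfold_locales (auto simp: open_resolvent_dom resolvent_dom_cnj cnj_in_plane)
  let ?P = "\<lambda>U \<Gamma> I. bounded U \<and> slice_cauchy_domain U \<and> S_spectrum T0 Tv \<subseteq> U \<and> closure U \<subseteq> W \<and> oriented_boundary (slice U I) \<Gamma>"
  have adm: "admissible (plane U) \<Gamma>" if P: "?P U \<Gamma> I" and I: "I \<in> sphere 0 1" for U \<Gamma> I
  proof -
    have U: "open U" "axially_symmetric U" using P by (auto simp: slice_cauchy_domain_def)
    have eq: "slice U I = plane U" by (rule slice_eq_plane[OF U(2) I])
    have "- R \<subseteq> slice U I"
    proof
      fix z assume "z \<in> - R"
      then have "slice_pt I z \<in> S_spectrum T0 Tv"
        using S_resolvent_set_subset_resolvent_dom[OF comm, of I z] I by (auto simp: R_def S_spectrum_def)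
      then show "z \<in> slice U I" using P by (auto simp: slice_def)
    qed
    moreover have "closure (slice U I) \<subseteq> plane W"
      using closure_slice_subset[of U I] P slice_eq_plane[OF W(2) I] by (auto simp: slice_def)
    ultimately show ?thesis
      using P open_slice[OF U(1), of I] by (simp add: admissible_def eq cnj_in_plane)
  qed
  \<comment> \<open>The cycle integrals are real, so \<open>slice_op I\<close> acts on them as
    \<open>real_op\<close> and \<open>I\<close> disappears.\<close>
  define X where "X \<Gamma> = (\<Sum>C\<in>UNIV. real_op (fst (cycle_int \<Gamma> C)) o\<^sub>L cl_left (axis C 1) :: ('v, 'n) cmodule \<Rightarrow>\<^sub>L ('v, 'n) cmodule)" for \<Gamma>
  have X_in: "X \<Gamma> \<in> B_Vn" for \<Gamma>
    unfolding X_def by (intro subspace_sum[OF B_Vn_subspace] real_op_cl_left_in_B_Vn)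
  have main: "(\<forall>\<gamma>\<in>\<Gamma>. slice_integrand K f I \<gamma> integrable_on {0..1}) \<and>
      (\<Sum>\<gamma>\<in>\<Gamma>. integral {0..1} (slice_integrand K f I \<gamma>)) = X \<Gamma>" if P: "?P U \<Gamma> I" and I: "I \<in> sphere 0 1" for U \<Gamma> I
  proof -
    note a = admissibleD[OF adm[OF P I]]
    have int: "(slice_integrand K f I \<gamma> has_integral
      (\<Sum>C\<in>UNIV. slice_op I (cop.path_int \<gamma> (G C)) o\<^sub>L cl_left (axis C 1))) {0..1}" if "\<gamma> \<in> \<Gamma>" for \<gamma>
      by (rule slice_integrand_has_integral[OF I a(2,4)[OF that]])
        (use K I cl_left_holo_components[OF F I] in \<open>auto simp: R_def\<close>)
    have "(\<Sum>\<gamma>\<in>\<Gamma>. integral {0..1} (slice_integrand K f I \<gamma>))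
      = (\<Sum>\<gamma>\<in>\<Gamma>. \<Sum>C\<in>UNIV. slice_op I (cop.path_int \<gamma> (G C)) o\<^sub>L cl_left (axis C 1))"
      using int by (intro sum.cong) (auto simp: integral_unique)
    also have "\<dots> = (\<Sum>C\<in>UNIV. slice_op I (cycle_int \<Gamma> C) o\<^sub>L cl_left (axis C 1))"
      by (subst sum.swap) (simp add: cycle_int_def linear_sum[OF bounded_linear.linear[OF bounded_linear_slice_op]] blinfun_compose.sum_left)
    also have "\<dots> = X \<Gamma>"
      by (simp add: X_def slice_op_def snd_cycle_int[OF adm[OF P I]])
    finally show ?thesis using int by auto
  qed
  show ?thesis
  \<comment> \<open>The common value is taken from an arbitrary admissible choice; if there is none,
    any operator qualifies.\<close>
  proof (cases "\<exists>U \<Gamma> I. ?P U \<Gamma> I \<and> I \<in> sphere 0 1")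
    case True
    then obtain U0 \<Gamma>0 I0 where 0: "?P U0 \<Gamma>0 I0" "I0 \<in> sphere 0 1" by blast
    have "X \<Gamma> = X \<Gamma>0" if "?P U \<Gamma> I" "I \<in> sphere 0 1" for U \<Gamma> I
      unfolding X_def using cycle_int_eq[OF adm[OF that] adm[OF 0]] by simp
    then show ?thesis
      unfolding boundary_integral_ok_def boundary_integral_is_def
      using main X_in[of \<Gamma>0] by (intro bexI[of _ "X \<Gamma>0"]) auto
  next
    case False
    then show ?thesis
      unfolding boundary_integral_ok_def boundary_integral_is_def using subspace_0[OF B_Vn_subspace] by blast
  qed
qed

lemma boundary_integral_ok_K2:
  assumes "commuting_components T0 Tv" "left_slice_hyperholomorphic W f"
  shows "boundary_integral_ok (S_spectrum T0 Tv) W f (K2 T0 Tv \<nu> l)"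
  by (rule boundary_integral_ok_kernel[OF assms holo_kernel[OF norm_op_commute[OF assms(1)]] kernel_cnj
      K2_slice_pt[OF assms(1)]])

text \<open>The conjugate of \<open>T\<close> contains Clifford units and need not come from the
  complexified operators on \<open>V\<close>, which forces the splitting; multiplying the kernel by
  \<open>z\<close> preserves holomorphy and symmetry.\<close>

lemma boundary_integral_ok_K1L:
  assumes "commuting_components T0 Tv" "left_slice_hyperholomorphic W f"
  shows "boundary_integral_ok (S_spectrum T0 Tv) W f (K1L T0 Tv \<nu> l)"
proof -
  let ?N = "norm_op T0 Tv"
  have "boundary_integral_ok (S_spectrum T0 Tv) W f (\<lambda>s. cl_left (para s) o\<^sub>L K2 T0 Tv \<nu> l s)"
  proof (rule boundary_integral_ok_kernel[OF assms, where k="\<lambda>z. cop.cscale z (kernel T0 ?N \<nu> l z)"])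
    show "cop.holo (resolvent_dom T0 ?N) (\<lambda>z. cop.cscale z (kernel T0 ?N \<nu> l z))"
      by (intro cop.holo_cscale open_resolvent_dom holomorphic_on_ident holo_kernel norm_op_commute assms)
    show "cop_cnj (cop.cscale z (kernel T0 ?N \<nu> l z)) = cop.cscale (cnj z) (kernel T0 ?N \<nu> l (cnj z))" for z
      by (simp add: cop_cnj_cscale kernel_cnj)
    show "cl_left (para (slice_pt I z)) o\<^sub>L K2 T0 Tv \<nu> l (slice_pt I z) = slice_op I (cop.cscale z (kernel T0 ?N \<nu> l z))"
      if "norm I = 1" "z \<in> resolvent_dom T0 ?N" for I z
      by (simp add: K2_slice_pt[OF assms(1) that] cl_left_slice_pt cmul_cscale flip: slice_op_cmul[OF that(1)])
  qed
  moreover have "boundary_integral_ok (S_spectrum T0 Tv) W f (\<lambda>s. conj_op T0 Tv o\<^sub>L K2 T0 Tv \<nu> l s)"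
    by (intro boundary_integral_ok_compose boundary_integral_ok_K2 assms B_Vn_compose) (auto simp: para_op_def B_Vn_def)
  ultimately have "boundary_integral_ok (S_spectrum T0 Tv) W f
     (\<lambda>s. (cl_left (para s) o\<^sub>L K2 T0 Tv \<nu> l s) - (conj_op T0 Tv o\<^sub>L K2 T0 Tv \<nu> l s))"
    by (rule boundary_integral_ok_diff)
  then show ?thesis
    by (simp add: K1L_def[abs_def] K2_def blinfun_compose.diff_left)
qed

text \<open>\<open>boundary_integral_ok\<close> speaks of all oriented boundaries and would be
  vacuous without one; their existence enters here, together with the normalising factor.\<close>

lemma is_calculus_value_exists:
  fixes K :: "'n::{finite,linorder} paravector \<Rightarrow> ('v::banach, 'n) cmodule \<Rightarrow>\<^sub>L ('v, 'n) cmodule"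
  assumes "boundary_integral_ok \<Sigma> W f K"
  shows "\<exists>F\<in>B_Vn. \<forall>I\<in>sphere 0 1. \<forall>U. bounded U \<and> slice_cauchy_domain U \<and> \<Sigma> \<subseteq> U \<and> closure U \<subseteq> W \<longrightarrow>
    is_calculus_value K f I U F"
proof -
  obtain X where X: "X \<in> B_Vn" "boundary_integral_is \<Sigma> W f K X"
    using assms by (auto simp: boundary_integral_ok_def)
  have ex: "\<exists>\<Gamma>. oriented_boundary (slice U I) \<Gamma>" if U: "bounded U" "slice_cauchy_domain U" "I \<in> sphere 0 1" for U I
  proof -
    obtain \<Gamma> where "jordan_family \<Gamma>" "frontier (slice U I) = (\<Union>\<gamma>\<in>\<Gamma>. path_image \<gamma>)"
      using U(2,3) unfolding slice_cauchy_domain_def by blast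
    then show ?thesis
      using U by (intro oriented_boundary_exists open_slice bounded_slice) (auto simp: slice_cauchy_domain_def)
  qed
  have "is_calculus_value K f I U ((1 / (2 * pi)) *\<^sub>R X)"
    if I: "I \<in> sphere 0 1" and U: "bounded U \<and> slice_cauchy_domain U \<and> \<Sigma> \<subseteq> U \<and> closure U \<subseteq> W" for I U
  proof -
    have "(\<forall>\<gamma>\<in>\<Gamma>. slice_integrand K f I \<gamma> integrable_on {0..1}) \<and>
        (\<Sum>\<gamma>\<in>\<Gamma>. integral {0..1} (slice_integrand K f I \<gamma>)) = X" if "oriented_boundary (slice U I) \<Gamma>" for \<Gamma>
      using X(2) I U that unfolding boundary_integral_is_def by blast
    then show ?thesis
      using ex[of U I] I U by (simp add: is_calculus_value_def)
  qed
  then show ?thesis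
    using subspace_scale[OF B_Vn_subspace X(1)] by blast
qed

theorem theorem6p28:
  fixes T0 :: "'v::banach \<Rightarrow>\<^sub>L 'v"
    and Tv :: "'n::{finite,linorder} \<Rightarrow> 'v \<Rightarrow>\<^sub>L 'v"
    and f :: "'n paravector \<Rightarrow> 'n clifford"
    and W :: "'n paravector set"
    and b0 :: "nat \<Rightarrow> nat \<Rightarrow> nat \<Rightarrow> real"
    and \<beta> m :: nat
  assumes "odd CARD('n)"
    and "\<beta> + m \<le> (CARD('n) - 1) div 2"
    and "commuting_components T0 Tv"
    and "real_spectrum T0"
    and "\<And>\<mu>. \<mu> \<noteq> Max UNIV \<Longrightarrow> real_spectrum (Tv \<mu>)"
    and "left_slice_hyperholomorphic W f"
  shows "(\<beta> > 0 \<longrightarrow>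
      (\<exists>F\<in>B_Vn. \<forall>I\<in>sphere 0 1. \<forall>U. bounded U \<and> slice_cauchy_domain U \<and>
        S_spectrum T0 Tv \<subseteq> U \<and> closure U \<subseteq> W \<longrightarrow>
        is_calculus_value (D_resolvent \<beta> m T0 Tv) f I U F)) \<and>
    (\<exists>F\<in>B_Vn. \<forall>I\<in>sphere 0 1. \<forall>U. bounded U \<and> slice_cauchy_domain U \<and>
        S_spectrum T0 Tv \<subseteq> U \<and> closure U \<subseteq> W \<longrightarrow>
        is_calculus_value (Dbar_resolvent b0 \<beta> m T0 Tv) f I U F)"
proof -
  \<comment> \<open>The parity of \<open>\<beta>\<close> selects which linear combination occurs;
    its coefficients never have to be evaluated.\<close>
  note intros = boundary_integral_ok_scaleR boundary_integral_ok_diff boundary_integral_ok_add boundary_integral_ok_sum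
    boundary_integral_ok_K1L boundary_integral_ok_K2 assms(3,6)
  have "boundary_integral_ok (S_spectrum T0 Tv) W f (D_resolvent \<beta> m T0 Tv)"
  proof (cases "odd \<beta>")
    case True
    show ?thesis unfolding D_resolvent_def[abs_def] Let_def if_P[OF True] by (intro intros)
  next
    case False
    show ?thesis unfolding D_resolvent_def[abs_def] Let_def if_not_P[OF False] by (intro intros)
  qed
  moreover have "boundary_integral_ok (S_spectrum T0 Tv) W f (Dbar_resolvent b0 \<beta> m T0 Tv)"
  proof (cases "odd \<beta>")
    case True
    show ?thesis unfolding Dbar_resolvent_def[abs_def] Let_def if_P[OF True] by (intro intros)
  next
    case False
    show ?thesis unfolding Dbar_resolvent_def[abs_def] Let_def if_not_P[OF False] by (intro intros)
  qed
  ultimately show ?thesis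
    using is_calculus_value_exists by blast
qed

end
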